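(* Let $\sigma(t)=(\lambda_h(t),\Lambda_h(t))$, $t\in\mathbb R$, be the real-analytic time parametrization of the separatrix described in the context, with $\sigma(0)=(\lambda_0,0)$, $\lambda_0\in(\tfrac23\pi,\pi)$. Let $a_\pm=-\tfrac12\pm\tfrac{\sqrt2}{2}$ and $$A=\int_0^{a_+}\frac{1}{1-x}\sqrt{\frac{x}{3(x+1)(a_+-x)(x-a_-)}}\,dx\ (\approx0.177744),\qquad \Pi_A=\{t\in\mathbb C:|\operatorname{Im}t|<A\}.$$ Then: (i) $\sigma$ extends analytically to $\Pi_A$; (ii) $\sigma$ has only two singularities in $\partial\Pi_A$, at $t=\pm iA$; (iii) there exists $\nu>0$ such that, for $t\in\mathbb C$ with $|t-iA|<\nu$ and $\arg(t-iA)\in(-\tfrac{3\pi}2,\tfrac\pi2)$, $$\lambda_h(t)=\pi+3\alpha_+(t-iA)^{2/3}+\mathcal O\big((t-iA)^{4/3}\big),\qquad \Lambda_h(t)=-\frac{2\alpha_+}{3}\frac{1}{(t-iA)^{1/3}}+\mathcal O\big((t-iA)^{1/3}\big),$$ with $\alpha_+\in\mathbb C$ such that $\alpha_+^3=\tfrac12$; and analogously, for $|t+iA|<\nu$ and $\arg(t+iA)\in(-\tfrac\pi2,\tfrac{3\pi}2)$, the same expansions hold with $iA$ replaced by $-iA$ and $\alpha_+$ replaced by $\alpha_-=\overline{\alpha_+}$.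
   Context: Consider the one-degree-of-freedom Hamiltonian $H_{\mathrm{pend}}(\lambda,\Lambda)=-\tfrac32\Lambda^2+V(\lambda)$, $V(\lambda)=1-\cos\lambda-\frac1{\sqrt{2+2\cos\lambda}}$, with equations $\dot\lambda=-3\Lambda$, $\dot\Lambda=-\sin\lambda\big(1-(2+2\cos\lambda)^{-3/2}\big)$. It has a saddle at $(0,0)$ and two homoclinic orbits (separatrices) in the energy level $H_{\mathrm{pend}}=-\tfrac12$; the "right" separatrix has $\lambda\in(0,\pi)$. $\sigma(t)=(\lambda_h(t),\Lambda_h(t))$ is the solution parametrizing this right separatrix with initial condition $\sigma(0)=(\lambda_0,0)$, $\lambda_0\in(\tfrac23\pi,\pi)$ (so $\sigma(t)\to(0,0)$ as $t\to\pm\infty$). *)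

theory Defs
  imports "HOL-Analysis.Analysis"
begin

definition V_pend :: "real \<Rightarrow> real" where
  "V_pend l = 1 - cos l - 1 / sqrt (2 + 2 * cos l)"

definition H_pend :: "real \<Rightarrow> real \<Rightarrow> real" where
  "H_pend l L = - (3/2) * L^2 + V_pend l"

definition a_plus :: real where "a_plus = - 1/2 + sqrt 2 / 2"
definition a_minus :: real where "a_minus = - 1/2 - sqrt 2 / 2"

definition A_strip :: real where
  "A_strip = integral {0..a_plus}
     (\<lambda>x. 1 / (1 - x) * sqrt (x / (3 * (x + 1) * (a_plus - x) * (x - a_minus))))"

definition Pi_strip :: "real \<Rightarrow> complex set" where
  "Pi_strip a = {t. \<bar>Im t\<bar> < a}"

definition br_arg :: "real \<Rightarrow> complex \<Rightarrow> real" where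
  "br_arg a w = (THE \<theta>. a \<le> \<theta> \<and> \<theta> < a + 2 * pi \<and> cis \<theta> = sgn w)"

definition br_pow :: "real \<Rightarrow> complex \<Rightarrow> real \<Rightarrow> complex" where
  "br_pow a w p = (if w = 0 then 0
     else exp (complex_of_real p * (complex_of_real (ln (cmod w)) + \<i> * complex_of_real (br_arg a w))))"

definition slit_disc :: "complex \<Rightarrow> real \<Rightarrow> real \<Rightarrow> complex set" where
  "slit_disc z0 r a = {t. t \<noteq> z0 \<and> cmod (t - z0) < r \<and> a < br_arg a (t - z0)}"

definition extends_holo_at :: "(complex \<Rightarrow> complex) \<Rightarrow> complex set \<Rightarrow> complex \<Rightarrow> bool" where
  "extends_holo_at f S z \<longleftrightarrow>
     (\<exists>e>0. \<exists>g. g holomorphic_on ball z e \<and> (\<forall>w \<in> ball z e \<inter> S. g w = f w))"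

end

theory Submission
  imports Defs "HOL-Complex_Analysis.Complex_Analysis"
begin

text \<open>On the energy level the inverse of the separatrix is an integral \<open>T\<close> of \<open>dt / d\<lambda> = - 1 / (3 * \<Lambda>)\<close>.
  With \<open>q = cos (\<lambda> / 2)\<close> this integrand has negative real part on the half-strip
  \<open>0 < Re \<lambda> < 2 * \<pi>\<close>, \<open>Im \<lambda> < 0\<close> (where \<open>Im q > 0\<close>), so by the Noshiro--Warschawski criterion \<open>T\<close> is
  injective there. \<open>T\<close> is a Schwarz--Christoffel type map: it sends the boundary of the half-strip onto
  the boundary of an L-shaped region, whose reentrant corner \<open>\<i> * A\<close> is the image of \<open>\<pi>\<close>.
  A properness and connectedness argument shows that its image contains the part
  \<open>Re t > 0\<close>, \<open>0 < Im t < h\<close> of that region, with \<open>h > A\<close>, and reflecting the inverse function in both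
  axes extends the separatrix to the strip \<open>\<bar>Im t\<bar> < h\<close> slit along the imaginary axis from \<open>\<plusminus> \<i> * A\<close>.
  Near the corner, \<open>F(\<zeta>) = (T(\<pi> - \<zeta>) - \<i> * A)\<^sup>2\<close> is real on the real axis, hence holomorphic around 0,
  and it has a zero of order 3 with leading coefficient \<open>- 2 / 27\<close>; extracting its cube root and inverting
  gives the expansions.\<close>

section \<open>A square root on the closed upper half-plane\<close>

text \<open>Time 0 is the turning point. Real time leads from there down to the saddle, imaginary
  time from there up to the collision \<open>lambda = pi\<close>, where \<open>q = 0\<close>. On the
  boundary of the half-strip each root in the integrand is real or imaginary, so \<open>T\<close>
  moves parallel to an axis there. When \<open>q\<close> passes \<open>a_plus\<close>, 0 or
  \<open>a_minus\<close>, one radicand changes sign and the direction turns by a right angle. Beyond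
  the reentrant corner the path runs to the left, then up from level \<open>A\<close> to level
  \<open>h\<close>. This vertical side is the reason for \<open>h > A\<close>, and the gap is why no
  point of the lines \<open>\<bar>Im t\<bar> = A\<close> other than
  \<open>\<plusminus> \<i> * A\<close> is singular. The exponents reflect the interior angle 3 pi /
  2 at the corner: a straight angle at \<open>lambda = pi\<close> opens to it, so
  \<open>T - \<i> * A\<close> grows like the power 3/2 of the distance to \<open>pi\<close>, and its
  square has order 3. If \<open>w ^ 3 = (t - \<i> * A) ^ 2\<close> and
  \<open>lambda = pi + 3 * \<alpha> * w + ...\<close>, the coefficient -2/27 forces
  \<open>2 * \<alpha> ^ 3 = 1\<close>.\<close>

definition usqrt :: "complex \<Rightarrow> complex" where
  "usqrt w = cis (pi / 4) * csqrt (- \<i> * w)"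

lemma cis_pi4_sq: "cis (pi / 4) * cis (pi / 4) = \<i>"
  by (simp add: cis_mult)

lemma usqrt_power2 [simp]: "(usqrt w)\<^sup>2 = w"
  by (simp add: usqrt_def power_mult_distrib) (simp add: power2_eq_square cis_pi4_sq)

lemma usqrt_mult_self: "usqrt w * usqrt w = w"
  using usqrt_power2[of w] by (simp only: power2_eq_square)

lemma usqrt_eq_0_iff [simp]: "usqrt w = 0 \<longleftrightarrow> w = 0"
  by (simp add: usqrt_def)

lemma norm_usqrt: "cmod (usqrt w) = sqrt (cmod w)"
proof -
  have "(cmod (usqrt w))\<^sup>2 = cmod w" by (metis norm_power usqrt_power2)
  then show ?thesis by (metis norm_ge_zero real_sqrt_unique)
qed

lemma usqrt_pos_Im:
  assumes "0 < Im w"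
  shows "0 < Re (usqrt w)" "0 < Im (usqrt w)"
proof -
  define c where "c = csqrt (- \<i> * w)"
  have c0: "0 \<le> Re c" using csqrt_principal[of "- \<i> * w"] unfolding c_def by linarith
  have "Re (c\<^sup>2) = Im w" by (simp add: c_def)
  then have *: "(Re c)\<^sup>2 - (Im c)\<^sup>2 > 0" using assms by (simp add: power2_eq_square)
  then have "\<bar>Im c\<bar> < \<bar>Re c\<bar>" by (simp add: abs_le_square_iff not_le flip: abs_less_iff) (meson abs_le_square_iff linorder_not_le)
  then have lt: "\<bar>Im c\<bar> < Re c" using c0 by linarith
  have "usqrt w = cis (pi / 4) * c" by (simp add: usqrt_def c_def)
  then have "Re (usqrt w) = sqrt 2 / 2 * (Re c - Im c)" "Im (usqrt w) = sqrt 2 / 2 * (Re c + Im c)"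
    by (simp_all add: cos_45 sin_45 algebra_simps)
  moreover have "0 < Re c - Im c" "0 < Re c + Im c" using lt by linarith+
  ultimately show "0 < Re (usqrt w)" "0 < Im (usqrt w)"
    by (simp_all del: times_divide_eq_left)
qed

lemma usqrt_of_real_nonneg:
  assumes "0 \<le> x" shows "usqrt (of_real x) = of_real (sqrt x)"
proof -
  have "csqrt (- \<i> * of_real x) = cis (- pi / 4) * of_real (sqrt x)"
  proof (rule csqrt_unique)
    have "(complex_of_real (sqrt x))\<^sup>2 = of_real x" using assms by (metis of_real_power real_sqrt_pow2)
    moreover have "(cis (- pi / 4))\<^sup>2 = - \<i>" unfolding Complex.DeMoivre by simp
    ultimately show "(cis (- pi / 4) * complex_of_real (sqrt x))\<^sup>2 = - \<i> * complex_of_real x"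
      by (simp only: power_mult_distrib)
    show "0 < Re (cis (- pi / 4) * complex_of_real (sqrt x)) \<or>
      Re (cis (- pi / 4) * complex_of_real (sqrt x)) = 0 \<and> 0 \<le> Im (cis (- pi / 4) * complex_of_real (sqrt x))"
      using assms by (cases "x = 0") (simp_all add: cos_45)
  qed
  then show ?thesis by (simp add: usqrt_def cis_mult flip: mult.assoc)
qed

lemma usqrt_of_real_nonpos:
  assumes "x \<le> 0" shows "usqrt (of_real x) = \<i> * of_real (sqrt (- x))"
proof -
  have "csqrt (- \<i> * of_real x) = cis (pi / 4) * of_real (sqrt (-x))"
  proof (rule csqrt_unique)
    have "(complex_of_real (sqrt (-x)))\<^sup>2 = of_real (-x)"
      using assms by (metis of_real_power real_sqrt_pow2 neg_0_le_iff_le)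
    moreover have "(cis (pi / 4))\<^sup>2 = \<i>" unfolding Complex.DeMoivre by simp
    ultimately show "(cis (pi / 4) * complex_of_real (sqrt (-x)))\<^sup>2 = - \<i> * complex_of_real x"
      by (simp only: power_mult_distrib) simp
    show "0 < Re (cis (pi / 4) * complex_of_real (sqrt (-x))) \<or>
      Re (cis (pi / 4) * complex_of_real (sqrt (-x))) = 0 \<and> 0 \<le> Im (cis (pi / 4) * complex_of_real (sqrt (-x)))"
      using assms by (cases "x = 0") (simp_all add: cos_45)
  qed
  then show ?thesis by (simp add: usqrt_def cis_pi4_sq flip: mult.assoc)
qed

text \<open>The cut of \<open>csqrt\<close> is met by \<open>- \<i> * w\<close> only when
  \<open>w\<close> is on the closed negative imaginary axis. Hence \<open>usqrt\<close> is
  holomorphic across the real line away from 0 and the derivative there is two-sided.\<close>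

lemma DERIV_usqrt:
  assumes "0 \<le> Im w" "w \<noteq> 0"
  shows "(usqrt has_field_derivative 1 / (2 * usqrt w)) (at w)"
proof -
  have ni: "- \<i> * w \<notin> \<real>\<^sub>\<le>\<^sub>0"
    using assms by (auto simp: complex_nonpos_Reals_iff complex_eq_iff)
  have "(usqrt has_field_derivative cis (pi / 4) * (- \<i> / (2 * csqrt (- \<i> * w)))) (at w)"
    unfolding usqrt_def by (rule derivative_eq_intros ni refl)+ simp
  moreover have "cis (pi / 4) * (- \<i> / (2 * csqrt (- \<i> * w))) = 1 / (2 * usqrt w)"
    using cis_pi4_sq assms(2) by (simp add: usqrt_def field_simps)
  ultimately show ?thesis by simp
qed

lemma continuous_on_usqrt: "continuous_on {w. 0 \<le> Im w} usqrt"
proof (clarsimp simp: continuous_on_eq_continuous_within)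
  fix w assume w: "0 \<le> Im w"
  show "continuous (at w within {w. 0 \<le> Im w}) usqrt"
  proof (cases "w = 0")
    case True
    have "((\<lambda>w. sqrt (cmod w)) \<longlongrightarrow> sqrt (cmod 0)) (at 0 within {w. 0 \<le> Im w})"
      by (intro tendsto_intros)
    then have "(usqrt \<longlongrightarrow> 0) (at 0 within {w. 0 \<le> Im w})"
      by (simp add: tendsto_norm_zero_iff[of usqrt, symmetric] norm_usqrt)
    then show ?thesis using True by (simp add: continuous_within usqrt_def)
  next
    case False
    then show ?thesis
      using DERIV_usqrt[OF w] DERIV_isCont continuous_at_imp_continuous_at_within by blast
  qed
qed

section \<open>The half-strip and its image under q = cos (lambda / 2)\<close>

definition half_strip :: "complex set" where
  "half_strip = {z. 0 \<le> Re z \<and> Re z \<le> 2 * pi \<and> Im z \<le> 0} - {0}"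

definition half_strip_int :: "complex set" where
  "half_strip_int = {z. 0 < Re z \<and> Re z < 2 * pi \<and> Im z < 0}"

text \<open>A conformal map of \<open>half_strip_int\<close> onto the upper half-plane. The left
  edge goes to q > 1, the real edge to -1 <= q < 1 and the right edge to q <= -1. So the value
  \<open>a_plus\<close> is taken on the real edge and \<open>a_minus\<close> on the right
  edge.\<close>

definition hcos :: "complex \<Rightarrow> complex" where "hcos z = cos (z / 2)"

lemma half_strip_int_subset: "half_strip_int \<subseteq> half_strip"
  by (auto simp: half_strip_def half_strip_int_def)

lemma open_half_strip_int: "open half_strip_int"
  unfolding half_strip_int_def
  by (intro open_Collect_conj open_Collect_less continuous_intros)

lemma interior_half_strip_subset: "interior half_strip \<subseteq> half_strip_int"
proof
  fix z assume "z \<in> interior half_strip"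
  then obtain e where e: "e > 0" "ball z e \<subseteq> half_strip" by (meson mem_interior)
  have "z + of_real (e / 2) \<in> ball z e" "z - of_real (e / 2) \<in> ball z e"
       "z + \<i> * of_real (e / 2) \<in> ball z e"
    using e(1) by (simp_all add: dist_norm norm_mult)
  then have "z + of_real (e / 2) \<in> half_strip" "z - of_real (e / 2) \<in> half_strip"
       "z + \<i> * of_real (e / 2) \<in> half_strip" using e by blast+
  then show "z \<in> half_strip_int" using e by (simp add: half_strip_def half_strip_int_def)
qed

lemma half_strip_I: "0 < Re z \<Longrightarrow> Re z \<le> 2 * pi \<Longrightarrow> Im z \<le> 0 \<Longrightarrow> z \<in> half_strip"
  by (auto simp: half_strip_def)

text \<open>The origin is left out because it is the saddle, reached only after infinite time. It is
  an extreme point of the closed half-strip, so convexity survives its removal.\<close>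

lemma convex_half_strip: "convex half_strip"
proof (rule convexI)
  fix x y :: complex and u v :: real
  assume x: "x \<in> half_strip" and y: "y \<in> half_strip" and uv: "0 \<le> u" "0 \<le> v" "u + v = 1"
  let ?z = "u *\<^sub>R x + v *\<^sub>R y"
  have "u * Re x + v * Re y \<le> u * (2*pi) + v * (2*pi)"
    using x y uv by (intro add_mono mult_left_mono) (auto simp: half_strip_def)
  then have 1: "u * Re x + v * Re y \<le> 2 * pi" using uv by (metis distrib_right mult_1)
  have ux: "u * Re x \<ge> 0" "v * Re y \<ge> 0" "u * Im x \<le> 0" "v * Im y \<le> 0"
    using x y uv by (auto simp: half_strip_def mult_nonneg_nonpos)
  have "?z \<noteq> 0"
  proof
    assume "?z = 0"
    then have "u * Re x + v * Re y = 0" "u * Im x + v * Im y = 0" by (auto simp: complex_eq_iff)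
    then have "u * Re x = 0" "v * Re y = 0" "u * Im x = 0" "v * Im y = 0" using ux by linarith+
    then have "u = 0" "v = 0" using x y by (auto simp: half_strip_def complex_eq_iff)
    then show False using uv by simp
  qed
  then show "?z \<in> half_strip" using 1 ux by (auto simp: half_strip_def)
qed

lemma Re_hcos: "Re (hcos z) = cos (Re z / 2) * cosh (Im z / 2)"
  and Im_hcos: "Im (hcos z) = - sin (Re z / 2) * sinh (Im z / 2)"
  by (simp_all add: hcos_def Re_cos Im_cos cosh_def sinh_def exp_minus field_simps)

lemma Im_hcos_nonneg: "z \<in> half_strip \<Longrightarrow> 0 \<le> Im (hcos z)"
  by (auto simp: Im_hcos half_strip_def intro!: mult_nonneg_nonpos sin_ge_zero)

lemma Im_hcos_pos: "z \<in> half_strip_int \<Longrightarrow> 0 < Im (hcos z)"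
  by (auto simp: Im_hcos half_strip_int_def intro!: mult_pos_neg sin_gt_zero)

lemma DERIV_hcos: "(hcos has_field_derivative - sin (z / 2) / 2) (at z)"
  unfolding hcos_def by (auto intro!: derivative_eq_intros)

lemma hcos_edge_cases:
  assumes "z \<in> half_strip" "Im (hcos z) = 0"
  shows "Im z = 0 \<or> Re z = 0 \<or> Re z = 2 * pi"
proof -
  have "sin (Re z / 2) = 0 \<or> Im z = 0" using assms by (simp add: Im_hcos)
  then show ?thesis
  proof
    assume "sin (Re z / 2) = 0"
    then show ?thesis using sin_gt_zero[of "Re z / 2"] assms(1) by (force simp: half_strip_def)
  qed simp
qed

text \<open>The two points where the kinetic energy vanishes: the turning point on the real axis and the
  one on the right edge of the half-strip.\<close>

definition turn_plus :: complex where "turn_plus = of_real (2 * arccos a_plus)"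
definition turn_minus :: complex where "turn_minus = 2 * pi - \<i> * of_real (2 * arcosh (- a_minus))"

lemma sqrt2_bounds: "7/5 < sqrt 2" "sqrt 2 < 3/2"
  by (rule real_less_rsqrt, simp add: power2_eq_square, rule real_less_lsqrt, simp_all add: power2_eq_square)

lemma a_plus_bounds: "1/5 < a_plus" "a_plus < 1/4"
  using sqrt2_bounds by (auto simp: a_plus_def)

lemma a_minus_bounds: "- (5/4) < a_minus" "a_minus < - (6/5)"
  using sqrt2_bounds by (auto simp: a_minus_def)

lemma hcos_eq_a_plus_iff:
  assumes "z \<in> half_strip"
  shows "hcos z = of_real a_plus \<longleftrightarrow> z = turn_plus"
proof
  assume q: "hcos z = of_real a_plus"
  then have R: "cos (Re z / 2) * cosh (Im z / 2) = a_plus" and I: "Im (hcos z) = 0"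
    using Re_hcos[of z] by auto
  from hcos_edge_cases[OF assms I] consider "Im z = 0" | "Re z = 0" | "Re z = 2 * pi" by blast
  then show "z = turn_plus"
  proof cases
    case 1
    then have "Re z / 2 = arccos a_plus" using R assms arccos_cos[of "Re z / 2"] by (auto simp: half_strip_def)
    then show ?thesis using 1 by (simp add: turn_plus_def complex_eq_iff)
  next
    case 2
    then show ?thesis using R a_plus_bounds cosh_real_ge_1[of "Im z / 2"] by auto
  next
    case 3
    then show ?thesis using R a_plus_bounds cosh_real_ge_1[of "Im z / 2"] by auto
  qed
next
  assume z: "z = turn_plus"
  then show "hcos z = of_real a_plus"
    using a_plus_bounds by (simp add: hcos_def turn_plus_def cos_of_real)
qed

lemma hcos_eq_a_minus_iff:
  assumes "z \<in> half_strip"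
  shows "hcos z = of_real a_minus \<longleftrightarrow> z = turn_minus"
proof
  assume q: "hcos z = of_real a_minus"
  then have R: "cos (Re z / 2) * cosh (Im z / 2) = a_minus" and I: "Im (hcos z) = 0"
    using Re_hcos[of z] by auto
  from hcos_edge_cases[OF assms I] consider "Im z = 0" | "Re z = 0" | "Re z = 2 * pi" by blast
  then show "z = turn_minus"
  proof cases
    case 1
    then show ?thesis using R a_minus_bounds cos_ge_minus_one[of "Re z / 2"] by auto
  next
    case 2
    then show ?thesis using R a_minus_bounds cosh_real_ge_1[of "Im z / 2"] by auto
  next
    case 3
    then have "cosh (- Im z / 2) = - a_minus" using R by auto
    then have "- Im z / 2 = arcosh (- a_minus)"
      using assms arcosh_cosh_real[of "- Im z / 2"] by (auto simp: half_strip_def)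
    then show ?thesis using 3 by (simp add: turn_minus_def complex_eq_iff)
  qed
next
  assume z: "z = turn_minus"
  have "Re (hcos z) = a_minus"
    using a_minus_bounds by (simp add: Re_hcos z turn_minus_def)
  moreover have "Im (hcos z) = 0" by (simp add: Im_hcos z turn_minus_def)
  ultimately show "hcos z = of_real a_minus" by (simp add: complex_eq_iff)
qed

lemma turn_plus_in: "turn_plus \<in> half_strip"
  using a_plus_bounds arccos_lbound[of a_plus] arccos_ubound[of a_plus] arccos_less_arccos[of a_plus 1]
  by (auto simp: turn_plus_def half_strip_def)

lemma turn_minus_in: "turn_minus \<in> half_strip"
  using a_minus_bounds arcosh_nonneg_real[of "- a_minus"] pi_gt_zero
  by (auto simp: turn_minus_def half_strip_def complex_eq_iff)

section \<open>The time function on the half-strip\<close>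

lemma usqrt_0: "usqrt 0 = 0" by simp

lemma Re_sin_quarter: "Re (sin (z / 4)) = sin (Re z / 4) * cosh (Im z / 4)"
  and Im_sin_quarter: "Im (sin (z / 4)) = cos (Re z / 4) * sinh (Im z / 4)"
  by (simp_all add: Re_sin Im_sin cosh_def sinh_def exp_minus field_simps)

lemma sin_quarter_nz:
  assumes "z \<in> half_strip" shows "sin (z / 4) \<noteq> 0"
proof (cases "Re z = 0")
  case True
  then have "Im z \<noteq> 0" using assms by (auto simp: half_strip_def complex_eq_iff)
  then have "Im (sin (z / 4)) \<noteq> 0" using True by (simp add: Im_sin_quarter)
  then show ?thesis by (metis zero_complex.sel(2))
next
  case False
  then have "sin (Re z / 4) > 0" using assms pi_gt_zero by (intro sin_gt_zero) (auto simp: half_strip_def)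
  then have "Re (sin (z / 4)) \<noteq> 0" by (simp add: Re_sin_quarter)
  then show ?thesis by (metis zero_complex.sel(1))
qed

text \<open>For \<open>H_pend = - 1 / 2\<close> and \<open>q = cos (\<lambda> / 2)\<close> one has \<open>(3 * \<Lambda>)\<^sup>2 = 12 * (1 - q) * (q - a_plus) * (q - a_minus) / q\<close>
  and \<open>1 - q = 2 * sin (\<lambda> / 4) ^ 2\<close>; this is \<open>dt / d\<lambda> = - 1 / (3 * \<Lambda>)\<close> with the branches of the roots
  that are continuous on the closed upper half-plane.\<close>

definition dtime :: "complex \<Rightarrow> complex" where
  "dtime z = - usqrt (hcos z) /
     (2 * of_real (sqrt 6) * sin (z / 4) * usqrt (hcos z - of_real a_plus) * usqrt (hcos z - of_real a_minus))"

lemma DERIV_usqrt_hcos: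
  assumes "z \<in> half_strip" "hcos z \<noteq> of_real a"
  shows "((\<lambda>z. usqrt (hcos z - of_real a)) has_field_derivative
    - sin (z / 2) / 2 / (2 * usqrt (hcos z - of_real a))) (at z)"
proof -
  have "((\<lambda>z. hcos z - of_real a) has_field_derivative - sin (z / 2) / 2) (at z)"
    using DERIV_diff[OF DERIV_hcos DERIV_const] by simp
  from DERIV_chain2[OF DERIV_usqrt this] Im_hcos_nonneg[OF assms(1)] assms(2)
  show ?thesis by (simp add: field_simps)
qed

lemma continuous_on_hcos: "continuous_on A hcos"
  unfolding hcos_def by (intro continuous_intros) auto

lemma continuous_on_usqrt_hcos: "continuous_on half_strip (\<lambda>z. usqrt (hcos z - of_real a))"
  by (rule continuous_on_compose2[OF continuous_on_usqrt])
     (auto intro!: continuous_intros continuous_on_hcos simp: Im_hcos_nonneg)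

text \<open>Because \<open>usqrt (p z)\<close> squares to \<open>p z\<close>, the quotient equals
  \<open>(n z / p z) * usqrt (p z)\<close>. The first factor tends to \<open>n' / p'\<close>, the
  second to 0.\<close>

lemma tendsto_div_usqrt:
  fixes n p :: "complex \<Rightarrow> complex"
  assumes n: "(n has_field_derivative n') (at z0 within A)" "n z0 = 0"
    and p: "(p has_field_derivative p') (at z0 within A)" "p z0 = 0" "p' \<noteq> 0"
  shows "((\<lambda>z. n z / usqrt (p z)) \<longlongrightarrow> 0) (at z0 within A)"
proof -
  have "continuous (at z0 within A) p" using p(1) DERIV_continuous by blast
  then have "(p \<longlongrightarrow> 0) (at z0 within A)" using p(2) by (simp add: continuous_within)
  then have "((\<lambda>z. sqrt (cmod (p z))) \<longlongrightarrow> sqrt (cmod 0)) (at z0 within A)" by (intro tendsto_intros)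
  then have u: "((\<lambda>z. usqrt (p z)) \<longlongrightarrow> 0) (at z0 within A)"
    by (simp add: tendsto_norm_zero_iff[of "\<lambda>z. usqrt (p z)", symmetric] norm_usqrt)
  have n1: "((\<lambda>z. n z / (z - z0)) \<longlongrightarrow> n') (at z0 within A)"
    and p1: "((\<lambda>z. p z / (z - z0)) \<longlongrightarrow> p') (at z0 within A)"
    using n p by (auto simp: has_field_derivative_iff)
  have "((\<lambda>z. (n z / (z - z0)) / (p z / (z - z0)) * usqrt (p z)) \<longlongrightarrow> n' / p' * 0) (at z0 within A)"
    by (intro tendsto_intros n1 p1 u p(3))
  then have *: "((\<lambda>z. (n z / (z - z0)) / (p z / (z - z0)) * usqrt (p z)) \<longlongrightarrow> 0) (at z0 within A)" by simp
  have ev: "\<forall>\<^sub>F z in at z0 within A. (n z / (z - z0)) / (p z / (z - z0)) * usqrt (p z) = n z / usqrt (p z)"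
    unfolding eventually_at_filter
  proof (rule always_eventually, intro allI impI)
    fix z assume "z \<noteq> z0" "z \<in> A"
    \<comment> \<open>If \<open>p z = 0\<close>, both sides are 0, since division by 0 yields
      0.\<close>
    then show "(n z / (z - z0)) / (p z / (z - z0)) * usqrt (p z) = n z / usqrt (p z)"
      using usqrt_mult_self[of "p z"] by (cases "p z = 0") (auto simp: field_simps)
  qed
  show ?thesis using Lim_transform_eventually[OF * ev] .
qed

lemma hcos_turn_plus: "hcos turn_plus = of_real a_plus"
  using hcos_eq_a_plus_iff[OF turn_plus_in] by simp

lemma hcos_turn_minus: "hcos turn_minus = of_real a_minus"
  using hcos_eq_a_minus_iff[OF turn_minus_in] by simp

text \<open>So \<open>hcos\<close> takes the values \<open>a_plus\<close> and \<open>a_minus\<close>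
  simply, and the singularities of \<open>dtime\<close> at the turning points are exactly of order
  -1/2.\<close>

lemma sin_half_turn_nz: "sin (turn_plus / 2) \<noteq> 0" "sin (turn_minus / 2) \<noteq> 0"
proof -
  have *: "sin w \<noteq> 0" if "cos w = of_real a" "a\<^sup>2 \<noteq> 1" for w :: complex and a
  proof
    assume "sin w = 0"
    then have "(cos w)\<^sup>2 = 1" using sin_cos_squared_add[of w] by simp
    then have "complex_of_real (a\<^sup>2) = of_real 1" using that(1) by simp
    then show False using that(2) unfolding of_real_eq_iff by simp
  qed
  have "a_plus\<^sup>2 \<noteq> 1" "a_minus\<^sup>2 \<noteq> 1" using a_plus_bounds a_minus_bounds by (auto simp: power2_eq_1_iff)
  then show "sin (turn_plus / 2) \<noteq> 0" "sin (turn_minus / 2) \<noteq> 0"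
    using * hcos_turn_plus hcos_turn_minus unfolding hcos_def by blast+
qed

lemma hcos_nz_int: "z \<in> half_strip_int \<Longrightarrow> hcos z \<noteq> of_real a"
  using Im_hcos_pos[of z] by auto

lemma dtime_differentiable:
  assumes "z \<in> half_strip" "hcos z \<noteq> 0" "z \<noteq> turn_plus" "z \<noteq> turn_minus"
  shows "dtime field_differentiable at z"
proof -
  have [simp]: "(\<lambda>z. usqrt (hcos z - of_real a)) field_differentiable at z" if "hcos z \<noteq> of_real a" for a
    using DERIV_usqrt_hcos[OF assms(1) that] field_differentiable_def by blast
  have ne: "hcos z \<noteq> of_real a_plus" "hcos z \<noteq> of_real a_minus" "hcos z \<noteq> of_real 0"
    using assms hcos_eq_a_plus_iff hcos_eq_a_minus_iff by auto
  have 0: "(\<lambda>z. usqrt (hcos z - of_real 0)) field_differentiable at z"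
    using DERIV_usqrt_hcos[OF assms(1) ne(3)] field_differentiable_def by blast
  have s: "(\<lambda>z. sin (z / 4)) field_differentiable at z"
    unfolding field_differentiable_def by (rule exI) (auto intro!: derivative_eq_intros)
  have "(\<lambda>z. - usqrt (hcos z - of_real 0) /
     (2 * of_real (sqrt 6) * sin (z / 4) * usqrt (hcos z - of_real a_plus) * usqrt (hcos z - of_real a_minus))) field_differentiable at z"
    using ne sin_quarter_nz[OF assms(1)]
    by (intro field_differentiable_divide field_differentiable_minus field_differentiable_mult
        field_differentiable_const 0 s) auto
  then show ?thesis unfolding dtime_def[abs_def] by simp
qed

text \<open>The singularities of the integrand at the two turning points are of inverse square root type;
  subtracting suitable multiples of derivatives of square roots leaves a function that is
  continuous up to the boundary. (At the turning points themselves the quotients have the value 0.)\<close>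

lemma sep_time_exists:
  "\<exists>T. continuous_on half_strip T \<and> T turn_plus = 0 \<and>
     (\<forall>z\<in>half_strip - {turn_plus, turn_minus}. (T has_field_derivative dtime z) (at z within half_strip))"
proof -
  define g where "g b z = - usqrt (hcos z) / (2 * of_real (sqrt 6) * sin (z / 4) * usqrt (hcos z - of_real b))" for b z
  define q' where "q' z = - sin (z / 2) / 2" for z :: complex
  \<comment> \<open>\<open>R1\<close> is the derivative of
    \<open>c1 * usqrt (hcos z - a_plus)\<close>. The constant makes the numerator
    \<open>g a_minus z - c1 * (q' z / 2)\<close> of \<open>dtime z - R1 z\<close> vanish at
    \<open>turn_plus\<close>, so that \<open>tendsto_div_usqrt\<close> applies; \<open>c2\<close>
    does the same at \<open>turn_minus\<close>.\<close>
  define c1 where "c1 = 2 * g a_minus turn_plus / q' turn_plus"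
  define c2 where "c2 = 2 * g a_plus turn_minus / q' turn_minus"
  define R1 where "R1 z = c1 * (q' z / (2 * usqrt (hcos z - of_real a_plus)))" for z
  define R2 where "R2 z = c2 * (q' z / (2 * usqrt (hcos z - of_real a_minus)))" for z
  define f1 where "f1 z = dtime z - R1 z - R2 z" for z
  note tm = turn_plus_in turn_minus_in
  have apm: "a_plus \<noteq> a_minus" "a_plus \<noteq> 0" "a_minus \<noteq> 0" using a_plus_bounds a_minus_bounds by auto
  have dq': "q' field_differentiable at z" for z
    unfolding field_differentiable_def q'_def by (rule exI) (auto intro!: derivative_eq_intros)
  have cq': "continuous (at z within half_strip) q'" for z
    using dq' field_differentiable_imp_continuous_at continuous_at_imp_continuous_at_within by blast
  have cu: "continuous (at z within half_strip) (\<lambda>z. usqrt (hcos z - of_real a))" if "z \<in> half_strip" for z a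
    using continuous_on_usqrt_hcos[of a] that by (simp add: continuous_on_eq_continuous_within)
  have cu0: "continuous (at z within half_strip) (\<lambda>z. usqrt (hcos z))" if "z \<in> half_strip" for z
    using cu[OF that, of 0] by simp
  have cs: "continuous (at z within half_strip) (\<lambda>z. sin (z / 4))" for z
    by (intro continuous_intros) auto
  have dg: "g b field_differentiable at z" if "z \<in> half_strip" "hcos z \<noteq> 0" "hcos z \<noteq> of_real b" for b z
  proof -
    have 0: "(\<lambda>z. usqrt (hcos z - of_real 0)) field_differentiable at z"
      using DERIV_usqrt_hcos[of z 0] that field_differentiable_def by fastforce
    have 1: "(\<lambda>z. usqrt (hcos z - of_real b)) field_differentiable at z"
      using DERIV_usqrt_hcos[of z b] that field_differentiable_def by fastforce
    have s: "(\<lambda>z. sin (z / 4)) field_differentiable at z"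
      unfolding field_differentiable_def by (rule exI) (auto intro!: derivative_eq_intros)
    have "(\<lambda>z. - usqrt (hcos z - of_real 0) / (2 * of_real (sqrt 6) * sin (z / 4) * usqrt (hcos z - of_real b)))
      field_differentiable at z"
      using that sin_quarter_nz[OF that(1)]
      by (intro field_differentiable_divide field_differentiable_minus field_differentiable_mult
        field_differentiable_const 0 1 s) auto
    then show ?thesis unfolding g_def[abs_def] by simp
  qed
  have cR1: "continuous (at z within half_strip) R1" if "z \<in> half_strip" "z \<noteq> turn_plus" for z
    unfolding R1_def using that hcos_eq_a_plus_iff[of z]
    by (intro continuous_intros cq' cu) auto
  have cR2: "continuous (at z within half_strip) R2" if "z \<in> half_strip" "z \<noteq> turn_minus" for z
    unfolding R2_def using that hcos_eq_a_minus_iff[of z]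
    by (intro continuous_intros cq' cu) auto
  have cdt: "continuous (at z within half_strip) dtime" if "z \<in> half_strip" "z \<noteq> turn_plus" "z \<noteq> turn_minus" for z
    unfolding dtime_def[abs_def]
    using that sin_quarter_nz[OF that(1)] hcos_eq_a_minus_iff[of z] hcos_eq_a_plus_iff[of z]
    by (intro continuous_intros cu cu0 cs) auto
  have main: "((\<lambda>z. (g b z - c * (q' z / 2)) / usqrt (hcos z - of_real a)) \<longlongrightarrow> 0) (at t within half_strip)"
    if "t \<in> half_strip" "hcos t = of_real a" "a \<noteq> b" "a \<noteq> 0" "c = 2 * g b t / q' t" "sin (t / 2) \<noteq> 0" for a b c t
  proof -
    have "(\<lambda>z. g b z - c * (q' z / 2)) field_differentiable at t"
      using that by (intro field_differentiable_diff dg field_differentiable_mult field_differentiable_const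
         field_differentiable_divide dq') auto
    then obtain n' where "((\<lambda>z. g b z - c * (q' z / 2)) has_field_derivative n') (at t)"
      by (auto simp: field_differentiable_def)
    then have n: "((\<lambda>z. g b z - c * (q' z / 2)) has_field_derivative n') (at t within half_strip)"
      by (rule DERIV_subset) simp
    have "((\<lambda>z. hcos z - of_real a) has_field_derivative - sin (t / 2) / 2) (at t within half_strip)"
      using DERIV_subset[OF DERIV_diff[OF DERIV_hcos DERIV_const]] by simp
    from tendsto_div_usqrt[OF n _ this] show ?thesis
      using that by (simp add: q'_def)
  qed
  have f1p: "f1 z = (g a_minus z - c1 * (q' z / 2)) / usqrt (hcos z - of_real a_plus) - R2 z" for z
    by (simp add: f1_def R1_def dtime_def g_def diff_divide_distrib mult_ac)
  have f1m: "f1 z = (g a_plus z - c2 * (q' z / 2)) / usqrt (hcos z - of_real a_minus) - R1 z" for z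
    by (simp add: f1_def R2_def dtime_def g_def diff_divide_distrib mult_ac)
  have turn_ne: "turn_plus \<noteq> turn_minus"
    using hcos_turn_plus hcos_turn_minus apm by (metis of_real_eq_iff)
  have "continuous_on half_strip f1"
    unfolding continuous_on_eq_continuous_within
  proof
    fix z assume z: "z \<in> half_strip"
    consider "z = turn_plus" | "z = turn_minus" | "z \<noteq> turn_plus" "z \<noteq> turn_minus" by blast
    then show "continuous (at z within half_strip) f1"
    proof cases
      case 1
      have "((\<lambda>z. (g a_minus z - c1 * (q' z / 2)) / usqrt (hcos z - of_real a_plus)) \<longlongrightarrow> 0) (at turn_plus within half_strip)"
        by (rule main[OF tm(1) hcos_turn_plus apm(1,2) c1_def sin_half_turn_nz(1)])
      then have "continuous (at turn_plus within half_strip) (\<lambda>z. (g a_minus z - c1 * (q' z / 2)) / usqrt (hcos z - of_real a_plus))"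
        unfolding continuous_within by (simp only: hcos_turn_plus diff_self usqrt_0 div_by_0)
      from continuous_diff[OF this cR2[OF tm(1) turn_ne]] show ?thesis unfolding f1p[abs_def] 1 .
    next
      case 2
      have "((\<lambda>z. (g a_plus z - c2 * (q' z / 2)) / usqrt (hcos z - of_real a_minus)) \<longlongrightarrow> 0) (at turn_minus within half_strip)"
        by (rule main[OF tm(2) hcos_turn_minus apm(1)[symmetric] apm(3) c2_def sin_half_turn_nz(2)])
      then have "continuous (at turn_minus within half_strip) (\<lambda>z. (g a_plus z - c2 * (q' z / 2)) / usqrt (hcos z - of_real a_minus))"
        unfolding continuous_within by (simp only: hcos_turn_minus diff_self usqrt_0 div_by_0)
      from continuous_diff[OF this cR1[OF tm(2) turn_ne[symmetric]]] show ?thesis unfolding f1m[abs_def] 2 .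
    next
      case 3
      show ?thesis unfolding f1_def by (intro continuous_diff cdt cR1 cR2 z 3)
    qed
  qed
  moreover have "f1 field_differentiable at z" if "z \<in> interior half_strip - {}" for z
  proof -
    have zi: "z \<in> half_strip_int" and z: "z \<in> half_strip"
      using that interior_half_strip_subset interior_subset by auto
    have ne: "hcos z \<noteq> of_real a" for a using hcos_nz_int[OF zi] .
    have fd: "(\<lambda>z. usqrt (hcos z - of_real a)) field_differentiable at z" for a
      using DERIV_usqrt_hcos[OF z ne] field_differentiable_def by blast
    have "dtime field_differentiable at z"
      using ne[of 0] ne[of a_plus] ne[of a_minus] hcos_turn_plus hcos_turn_minus
      by (intro dtime_differentiable z) auto
    then show ?thesis unfolding f1_def R1_def R2_def using ne
      by (intro field_differentiable_diff field_differentiable_mult field_differentiable_divide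
          field_differentiable_const fd dq') auto
  qed
  \<comment> \<open>A primitive on a convex set requires differentiability only in the interior. On
    the boundary continuity is enough, which matters at \<open>pi\<close>, where
    \<open>usqrt (hcos z)\<close> is not differentiable.\<close>
  ultimately obtain T1 where T1: "\<And>z. z \<in> half_strip \<Longrightarrow> (T1 has_field_derivative f1 z) (at z within half_strip)"
    using holomorphic_convex_primitive[OF convex_half_strip, of "{}" f1] by blast
  define T2 where "T2 z = T1 z + c1 * usqrt (hcos z - of_real a_plus) + c2 * usqrt (hcos z - of_real a_minus)" for z
  have "continuous_on half_strip T2"
    unfolding T2_def using T1 by (intro continuous_intros continuous_on_usqrt_hcos DERIV_continuous_on)
  moreover have "(T2 has_field_derivative dtime z) (at z within half_strip)"
    if "z \<in> half_strip - {turn_plus, turn_minus}" for z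
  proof -
    have "hcos z \<noteq> of_real a_plus" "hcos z \<noteq> of_real a_minus" and z: "z \<in> half_strip"
      using that hcos_eq_a_plus_iff hcos_eq_a_minus_iff by auto
    then have "(T2 has_field_derivative f1 z + c1 * (q' z / (2 * usqrt (hcos z - of_real a_plus)))
        + c2 * (q' z / (2 * usqrt (hcos z - of_real a_minus)))) (at z within half_strip)"
      unfolding T2_def q'_def
      by (intro DERIV_add T1 z DERIV_cmult DERIV_subset[OF DERIV_usqrt_hcos]) auto
    then show ?thesis by (simp add: f1_def R1_def R2_def)
  qed
  ultimately show ?thesis
    by (intro exI[of _ "\<lambda>z. T2 z - T2 turn_plus"]) (auto intro!: continuous_intros derivative_eq_intros)
qed

definition sep_time :: "complex \<Rightarrow> complex" where
  "sep_time = (SOME T. continuous_on half_strip T \<and> T turn_plus = 0 \<and>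
     (\<forall>z\<in>half_strip - {turn_plus, turn_minus}. (T has_field_derivative dtime z) (at z within half_strip)))"

lemma continuous_on_sep_time: "continuous_on half_strip sep_time"
  and sep_time_turn_plus [simp]: "sep_time turn_plus = 0"
  and DERIV_sep_time: "z \<in> half_strip \<Longrightarrow> z \<noteq> turn_plus \<Longrightarrow> z \<noteq> turn_minus \<Longrightarrow>
     (sep_time has_field_derivative dtime z) (at z within half_strip)"
  using someI_ex[OF sep_time_exists] unfolding sep_time_def[symmetric] by auto

lemma turn_notin_int: "turn_plus \<notin> half_strip_int" "turn_minus \<notin> half_strip_int"
  using hcos_nz_int hcos_turn_plus hcos_turn_minus by blast+

lemma DERIV_sep_time_int:
  assumes "z \<in> half_strip_int" shows "(sep_time has_field_derivative dtime z) (at z)"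
proof -
  have "(sep_time has_field_derivative dtime z) (at z within half_strip_int)"
    by (rule DERIV_subset[OF DERIV_sep_time half_strip_int_subset])
       (metis assms half_strip_int_subset turn_notin_int subsetD)+
  then show ?thesis using assms open_half_strip_int by (metis at_within_open)
qed

text \<open>Vieta for q^2 + q - 1/4, the quadratic factor of the kinetic energy in
  \<open>q\<close>.\<close>

lemma a_plus_minus: "a_plus + a_minus = - 1" "a_plus * a_minus = - (1/4)"
  by (simp_all add: a_plus_def a_minus_def field_simps)

lemma Re_divide_pos_iff: "v \<noteq> 0 \<Longrightarrow> 0 < Re (u / v) \<longleftrightarrow> 0 < Re u * Re v + Im u * Im v"
  by (simp add: Re_divide' zero_less_divide_iff flip: cmod_power2)

lemma Im_divide_neg_iff: "v \<noteq> 0 \<Longrightarrow> Im (u / v) < 0 \<longleftrightarrow> Im u * Re v < Re u * Im v"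
  by (simp add: Im_divide' divide_less_0_iff flip: cmod_power2)

text \<open>The reciprocal of the square of this quotient is \<open>q + 1 - 1 / (4 * q)\<close>, which maps the upper
  half-plane into itself.\<close>

lemma usqrt_quotient_quadrant:
  assumes "0 < Im q"
  shows "0 < Re (usqrt q / (usqrt (q - of_real a_plus) * usqrt (q - of_real a_minus)))" (is "0 < Re ?r")
    and "Im (usqrt q / (usqrt (q - of_real a_plus) * usqrt (q - of_real a_minus))) < 0"
proof -
  define u v w where "u = usqrt q" and "v = usqrt (q - of_real a_plus)" and "w = usqrt (q - of_real a_minus)"
  have pos: "0 < Re u" "0 < Im u" "0 < Re v" "0 < Im v" "0 < Re w" "0 < Im w"
    using assms usqrt_pos_Im by (auto simp: u_def v_def w_def)
  have nz: "u \<noteq> 0" "v \<noteq> 0" "w \<noteq> 0" using pos by auto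
  have sq: "u\<^sup>2 = q" "v\<^sup>2 = q - of_real a_plus" "w\<^sup>2 = q - of_real a_minus" by (simp_all add: u_def v_def w_def)
  have vq: "q - of_real a_plus \<noteq> 0" using nz sq by auto
  have R1: "0 < Re (u / v)" using nz pos by (simp add: Re_divide_pos_iff add_pos_pos)
  have "Im ((u / v)\<^sup>2) < 0"
    using assms a_plus_bounds vq unfolding power_divide sq by (simp add: Im_divide_neg_iff algebra_simps)
  then have "2 * Re (u / v) * Im (u / v) < 0" by (simp only: Im_power2)
  then have I1: "Im (u / v) < 0" using R1 by (simp add: mult_less_0_iff)
  \<comment> \<open>\<open>u / v\<close> lies in the fourth quadrant and \<open>w\<close> in the
    first, so the argument of \<open>u / v / w\<close> is between -pi and 0. The sign of the
    imaginary part of its square then excludes the third quadrant.\<close>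
  have I2: "Im (u / v / w) < 0"
    using nz by (subst Im_divide_neg_iff) (use pos I1 R1 in \<open>auto intro: less_trans[OF mult_neg_pos mult_pos_pos]\<close>)
  have "Im ((u / v / w)\<^sup>2) < 0"
  proof -
    have q0: "q \<noteq> 0" using assms by auto
    have "inverse ((u / v / w)\<^sup>2) = (q - of_real a_plus) * (q - of_real a_minus) / q"
      using nz by (simp add: power_divide sq field_simps)
    also have "\<dots> = (q\<^sup>2 - of_real (a_plus + a_minus) * q + of_real (a_plus * a_minus)) / q"
      by (simp add: algebra_simps power2_eq_square)
    also have "\<dots> = q + 1 - 1 / (4 * q)"
      using q0 by (simp only: a_plus_minus) (simp add: field_simps power2_eq_square)
    finally have e: "inverse ((u / v / w)\<^sup>2) = q + 1 - 1 / (4 * q)" .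
    have "Im (1 / (4 * q)) < 0" using q0 assms by (subst Im_divide_neg_iff) auto
    then have "0 < Im (inverse ((u / v / w)\<^sup>2))" unfolding e using assms by simp
    then show ?thesis by (simp add: divide_less_0_iff not_sum_power2_lt_zero)
  qed
  then have "2 * Re (u / v / w) * Im (u / v / w) < 0" by (simp only: Im_power2)
  then have R2: "0 < Re (u / v / w)" using I2 by (simp add: mult_less_0_iff)
  from R2 I2 show "0 < Re ?r" "Im ?r < 0" by (simp_all add: u_def v_def w_def)
qed

lemma dtime_eq: "dtime z = - (usqrt (hcos z) / (usqrt (hcos z - of_real a_plus) * usqrt (hcos z - of_real a_minus)))
     / (of_real (2 * sqrt 6) * sin (z / 4))"
  by (simp add: dtime_def mult_ac)

text \<open>Both the quotient of roots \<open>r\<close> and the factor \<open>s\<close> proportional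
  to \<open>sin (z / 4)\<close> lie in the open fourth quadrant. Their arguments differ by less than
  pi / 2, so \<open>r / s\<close> has positive real part, and
  \<open>dtime z = - r / s\<close>.\<close>

lemma Re_dtime_neg:
  assumes "z \<in> half_strip_int" shows "Re (dtime z) < 0"
proof -
  define r where "r = usqrt (hcos z) / (usqrt (hcos z - of_real a_plus) * usqrt (hcos z - of_real a_minus))"
  have r: "0 < Re r" "Im r < 0" using usqrt_quotient_quadrant[OF Im_hcos_pos[OF assms]] by (auto simp: r_def)
  define s where "s = of_real (2 * sqrt 6) * sin (z / 4)"
  have "0 < sin (Re z / 4)" "0 < cos (Re z / 4)"
    using assms by (auto simp: half_strip_int_def intro!: sin_gt_zero cos_gt_zero)
  then have "0 < Re (sin (z / 4))" "Im (sin (z / 4)) < 0"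
    using assms by (auto simp: Re_sin_quarter Im_sin_quarter half_strip_int_def mult_pos_neg)
  then have s: "0 < Re s" "Im s < 0" by (simp_all add: s_def mult_pos_neg)
  then have "s \<noteq> 0" by auto
  then have "0 < Re (r / s)" using r s by (simp add: Re_divide_pos_iff add_pos_pos mult_neg_neg)
  then show ?thesis unfolding dtime_eq r_def[symmetric] s_def[symmetric] by simp
qed

text \<open>The complex derivative is known only relative to \<open>half_strip\<close>. Pulled back
  along a line that stays in this set it becomes a genuine real derivative, so monotonicity
  arguments work on the edges as well as inside.\<close>

lemma DERIV_sep_time_line:
  assumes K: "\<And>s. s \<in> {a<..<b} \<Longrightarrow> p + of_real s * d \<in> half_strip" and s: "a < s" "s < b"
    and ne: "p + of_real s * d \<noteq> turn_plus" "p + of_real s * d \<noteq> turn_minus"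
  shows "((\<lambda>s. Re (sep_time (p + of_real s * d))) has_real_derivative Re (d * dtime (p + of_real s * d))) (at s)"
    and "((\<lambda>s. Im (sep_time (p + of_real s * d))) has_real_derivative Im (d * dtime (p + of_real s * d))) (at s)"
proof -
  let ?g = "\<lambda>s. p + complex_of_real s * d"
  have g: "(?g has_vector_derivative d) (at s within {a<..<b})"
    by (auto intro!: derivative_eq_intros)
  have "(sep_time has_field_derivative dtime (?g s)) (at (?g s) within half_strip)"
    using K s ne by (intro DERIV_sep_time) auto
  then have "(sep_time has_field_derivative dtime (?g s)) (at (?g s) within ?g ` {a<..<b})"
    by (rule DERIV_subset) (use K in auto)
  from field_vector_diff_chain_within[OF g this]
  have "((\<lambda>s. sep_time (?g s)) has_vector_derivative d * dtime (?g s)) (at s within {a<..<b})"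
    by (simp add: o_def)
  then have v: "((\<lambda>s. sep_time (?g s)) has_vector_derivative d * dtime (?g s)) (at s)"
    using s by (metis at_within_open greaterThanLessThan_iff open_greaterThanLessThan)
  show "((\<lambda>s. Re (sep_time (?g s))) has_real_derivative Re (d * dtime (?g s))) (at s)"
    unfolding has_real_derivative_iff_has_vector_derivative
    by (rule bounded_linear.has_vector_derivative[OF bounded_linear_Re v])
  show "((\<lambda>s. Im (sep_time (?g s))) has_real_derivative Im (d * dtime (?g s))) (at s)"
    unfolding has_real_derivative_iff_has_vector_derivative
    by (rule bounded_linear.has_vector_derivative[OF bounded_linear_Im v])
qed

lemma continuous_on_sep_time_line:
  assumes K: "\<And>s. s \<in> A \<Longrightarrow> p + of_real s * d \<in> half_strip"
  shows "continuous_on A (\<lambda>s. sep_time (p + of_real s * d))"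
  by (rule continuous_on_compose2[OF continuous_on_sep_time]) (use K in \<open>auto intro!: continuous_intros\<close>)

lemma interior_half_strip: "interior half_strip = half_strip_int"
  using interior_half_strip_subset interior_maximal[OF half_strip_int_subset open_half_strip_int] by blast

text \<open>Noshiro--Warschawski: along a segment, \<open>sep_time\<close> divided by the direction has decreasing real part.\<close>

lemma sep_time_inj_int:
  assumes z: "z \<in> half_strip_int" and w: "w \<in> half_strip" and eq: "sep_time z = sep_time w"
  shows "z = w"
proof (rule ccontr)
  assume ne: "z \<noteq> w"
  define d where "d = w - z"
  have d: "d \<noteq> 0" using ne by (simp add: d_def)
  have seg: "z + of_real s * d \<in> half_strip_int" if "0 < s" "s < 1" for s
  proof -
    \<comment> \<open>One interior endpoint suffices for this, which is why \<open>w\<close> may lie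
      on an edge.\<close>
    have "open_segment z w \<subseteq> interior half_strip"
      by (rule in_interior_closure_convex_segment[OF convex_half_strip])
         (use z w closure_subset in \<open>auto simp: interior_half_strip\<close>)
    moreover have "z + of_real s * d \<in> open_segment z w"
      unfolding in_segment using ne that by (auto intro!: exI[of _ s] simp: d_def algebra_simps scaleR_conv_of_real)
    ultimately show ?thesis by (auto simp: interior_half_strip)
  qed
  have segK: "z + of_real s * d \<in> half_strip" if "0 \<le> s" "s \<le> 1" for s
    using seg[of s] that z w half_strip_int_subset by (cases "s = 0"; cases "s = 1") (auto simp: d_def)
  define F where "F s = Re (sep_time (z + of_real s * d) / d)" for s
  have F: "F s = (Re (sep_time (z + of_real s * d)) * Re d + Im (sep_time (z + of_real s * d)) * Im d) / (cmod d)\<^sup>2" for s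
    by (simp add: F_def Re_divide')
  have "F 1 < F 0"
  proof (rule DERIV_neg_imp_decreasing_open[where f = F])
    fix s :: real assume s: "0 < s" "s < 1"
    let ?z = "z + of_real s * d"
    have zi: "?z \<in> half_strip_int" using seg s by simp
    have ne: "?z \<noteq> turn_plus" "?z \<noteq> turn_minus" using zi turn_notin_int by metis+
    have D: "((\<lambda>s. Re (sep_time (z + of_real s * d))) has_real_derivative Re (d * dtime ?z)) (at s)"
      "((\<lambda>s. Im (sep_time (z + of_real s * d))) has_real_derivative Im (d * dtime ?z)) (at s)"
      using DERIV_sep_time_line[of 0 1 z d s] segK s ne by auto
    have "(F has_real_derivative (Re (d * dtime ?z) * Re d + Im (d * dtime ?z) * Im d) / (cmod d)\<^sup>2) (at s)"
      unfolding F[abs_def] by (rule DERIV_cdivide[OF DERIV_add[OF DERIV_cmult_right[OF D(1)] DERIV_cmult_right[OF D(2)]]])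
    moreover have "(Re (d * dtime ?z) * Re d + Im (d * dtime ?z) * Im d) / (cmod d)\<^sup>2 = Re (d * dtime ?z / d)"
      by (simp only: Re_divide')
    ultimately show "\<exists>y. (F has_real_derivative y) (at s) \<and> y < 0"
      using Re_dtime_neg[OF zi] d by auto
  next
    show "continuous_on {0..1} F" unfolding F_def
      using d by (intro continuous_intros continuous_on_sep_time_line) (use segK in auto)
  qed simp
  then show False using eq by (simp add: F_def d_def)
qed

section \<open>Boundary values on the real edge\<close>

definition lam_turn :: real where "lam_turn = 2 * arccos a_plus"

lemma turn_plus_eq: "turn_plus = of_real lam_turn" by (simp add: turn_plus_def lam_turn_def)

lemma cos_half_lam_turn: "cos (lam_turn / 2) = a_plus"
  using a_plus_bounds by (simp add: lam_turn_def)

lemma lam_turn_bounds: "1 < lam_turn" "lam_turn < pi"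
proof -
  have "cos (pi / 2) < a_plus" using a_plus_bounds by simp
  then have "arccos a_plus < arccos (cos (pi / 2))"
    using a_plus_bounds by (intro arccos_less_arccos) auto
  then show "lam_turn < pi" by (simp add: lam_turn_def arccos_cos)
  have "cos (pi / 3) > a_plus" using a_plus_bounds by (simp add: cos_60)
  then have "arccos (cos (pi / 3)) < arccos a_plus"
    using a_plus_bounds by (intro arccos_less_arccos) auto
  moreover have "arccos (cos (pi / 3)) = pi / 3" by (rule arccos_cos) auto
  ultimately show "1 < lam_turn" using pi_gt3 by (simp add: lam_turn_def)
qed

lemma real_in_half_strip: "0 < x \<Longrightarrow> x \<le> 2 * pi \<Longrightarrow> of_real x \<in> half_strip"
  by (auto simp: half_strip_def)

lemma of_real_ne_turn_minus: "of_real x \<noteq> turn_minus"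
  using a_minus_bounds cosh_arcosh_real[of "- a_minus"] by (auto simp: turn_minus_def complex_eq_iff)

lemma hcos_of_real: "hcos (of_real x) = of_real (cos (x / 2))"
  using cos_of_real[of "x / 2", where 'a = complex] by (simp add: hcos_def)

lemma sin_quarter_of_real: "sin (of_real x / 4) = complex_of_real (sin (x / 4))"
  using sin_of_real[of "x / 4", where 'a = complex] by simp

text \<open>On the real edge the number of imaginary roots is 0 before \<open>lam_turn\<close>, 1
  between \<open>lam_turn\<close> and \<open>pi\<close>, and 2 beyond \<open>pi\<close>. Accordingly
  \<open>dtime\<close> is negative, a positive multiple of \<open>\<i>\<close>, and negative again;
  this and the next two formulas record the three cases.\<close>

lemma dtime_real_1:
  assumes "a_plus \<le> cos (x / 2)"
  shows "dtime (of_real x) = of_real (- sqrt (cos (x / 2)) /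
     (2 * sqrt 6 * sin (x / 4) * sqrt (cos (x / 2) - a_plus) * sqrt (cos (x / 2) - a_minus)))"
  using assms a_plus_bounds a_minus_bounds
  by (simp add: dtime_def hcos_of_real sin_quarter_of_real usqrt_of_real_nonneg flip: of_real_diff)

lemma minus_divide_i: "- A / (B * (\<i> * r) * D) = \<i> * (A / (B * r * D))" for A B r D :: complex
  by (cases "B = 0 \<or> r = 0 \<or> D = 0") (auto simp: field_simps)

lemma dtime_real_2:
  assumes "cos (x / 2) \<le> a_plus" "0 \<le> cos (x / 2)"
  shows "dtime (of_real x) = \<i> * of_real (sqrt (cos (x / 2)) /
     (2 * sqrt 6 * sin (x / 4) * sqrt (a_plus - cos (x / 2)) * sqrt (cos (x / 2) - a_minus)))"
proof -
  have "usqrt (hcos (of_real x)) = of_real (sqrt (cos (x / 2)))"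
    "usqrt (hcos (of_real x) - of_real a_plus) = \<i> * of_real (sqrt (a_plus - cos (x / 2)))"
    "usqrt (hcos (of_real x) - of_real a_minus) = of_real (sqrt (cos (x / 2) - a_minus))"
    using assms a_plus_bounds a_minus_bounds
    by (simp_all add: hcos_of_real usqrt_of_real_nonneg usqrt_of_real_nonpos flip: of_real_diff)
  then show ?thesis
    by (simp only: dtime_def sin_quarter_of_real minus_divide_i of_real_mult of_real_divide of_real_numeral)
qed

lemma dtime_real_3:
  assumes "cos (x / 2) \<le> 0"
  shows "dtime (of_real x) = of_real (- sqrt (- cos (x / 2)) /
     (2 * sqrt 6 * sin (x / 4) * sqrt (a_plus - cos (x / 2)) * sqrt (cos (x / 2) - a_minus)))"
proof -
  have "cos (x / 2) \<ge> a_minus" using a_minus_bounds cos_ge_minus_one[of "x/2"] by linarith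
  then show ?thesis using assms a_plus_bounds
  by (simp add: dtime_def hcos_of_real sin_quarter_of_real usqrt_of_real_nonneg usqrt_of_real_nonpos
         flip: of_real_diff)
qed

lemma sin_quarter_pos: "0 < x \<Longrightarrow> x \<le> 2 * pi \<Longrightarrow> 0 < sin (x / 4)"
  by (intro sin_gt_zero) (use pi_gt_zero in auto)

lemma cos_half_mono: "0 \<le> x \<Longrightarrow> x < y \<Longrightarrow> y \<le> 2 * pi \<Longrightarrow> cos (y / 2) < cos (x / 2)"
  by (intro cos_monotone_0_pi) auto

lemma DERIV_sep_time_real:
  assumes "0 < x" "x < 2 * pi" "x \<noteq> lam_turn"
  shows "((\<lambda>x. Re (sep_time (of_real x))) has_real_derivative Re (dtime (of_real x))) (at x)"
    and "((\<lambda>x. Im (sep_time (of_real x))) has_real_derivative Im (dtime (of_real x))) (at x)"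
  using DERIV_sep_time_line[of 0 "2*pi" 0 1 x] assms of_real_ne_turn_minus real_in_half_strip
  by (auto simp: turn_plus_eq)

lemma continuous_on_sep_time_real:
  assumes "A \<subseteq> {0<..2*pi}" shows "continuous_on A (\<lambda>x. sep_time (of_real x))"
  using continuous_on_sep_time_line[of A 0 1] real_in_half_strip subsetD[OF assms] by fastforce

lemma sep_time_real_1:
  assumes "0 < x" "x \<le> lam_turn"
  shows "Im (sep_time (of_real x)) = 0"
    and "x < y \<Longrightarrow> y \<le> lam_turn \<Longrightarrow> Re (sep_time (of_real y)) < Re (sep_time (of_real x))"
proof -
  have D: "dtime (of_real s) = of_real (Re (dtime (of_real s)))" "Re (dtime (of_real s)) < 0"
    if "x < s" "s < lam_turn" for s
  proof -
    have c: "a_plus < cos (s / 2)"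
      using cos_half_mono[of s lam_turn] cos_half_lam_turn that assms lam_turn_bounds by auto
    then have *: "a_plus \<le> cos (s / 2)" by simp
    show "dtime (of_real s) = of_real (Re (dtime (of_real s)))" by (simp only: dtime_real_1[OF *] Re_complex_of_real)
    show "Re (dtime (of_real s)) < 0" unfolding dtime_real_1[OF *] Re_complex_of_real
      using c a_plus_bounds a_minus_bounds sin_quarter_pos[of s] that assms lam_turn_bounds
      by (intro divide_neg_pos mult_pos_pos) auto
  qed
  have cont: "continuous_on {x..lam_turn} (\<lambda>x. sep_time (of_real x))"
    by (rule continuous_on_sep_time_real) (use assms lam_turn_bounds in auto)
  have "Im (sep_time (of_real x)) = Im (sep_time (of_real lam_turn))" if "x < lam_turn"
  proof (rule DERIV_isconst_end[where f = "\<lambda>x. Im (sep_time (of_real x))", symmetric])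
    show "continuous_on {x..lam_turn} (\<lambda>x. Im (sep_time (of_real x)))" by (intro continuous_intros cont)
    show "((\<lambda>x. Im (sep_time (of_real x))) has_real_derivative 0) (at s)" if "x < s" "s < lam_turn" for s
    proof -
      have "Im (dtime (of_real s)) = 0" by (metis D(1) that Im_complex_of_real)
      then show ?thesis using DERIV_sep_time_real(2)[of s] that assms lam_turn_bounds by auto
    qed
  qed fact
  then show "Im (sep_time (of_real x)) = 0" using assms by (cases "x = lam_turn") (auto simp flip: turn_plus_eq)
  show "Re (sep_time (of_real y)) < Re (sep_time (of_real x))" if "x < y" "y \<le> lam_turn"
  proof (rule DERIV_neg_imp_decreasing_open[where f = "\<lambda>x. Re (sep_time (of_real x))"])
    show "continuous_on {x..y} (\<lambda>x. Re (sep_time (of_real x)))"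
      using that by (intro continuous_intros continuous_on_subset[OF cont]) auto
    show "\<exists>z. ((\<lambda>x. Re (sep_time (of_real x))) has_real_derivative z) (at s) \<and> z < 0"
      if "x < s" "s < y" for s
      using D(2)[of s] DERIV_sep_time_real(1)[of s] that assms \<open>y \<le> lam_turn\<close> lam_turn_bounds by auto
  qed fact
qed

lemma Re_sep_time_real_pos:
  assumes "0 < x" "x < lam_turn" shows "0 < Re (sep_time (of_real x))"
  using sep_time_real_1(2)[of x lam_turn] assms by (simp flip: turn_plus_eq)

lemma sep_time_real_2:
  assumes "lam_turn \<le> x" "x \<le> pi"
  shows "Re (sep_time (of_real x)) = 0"
    and "x < y \<Longrightarrow> y \<le> pi \<Longrightarrow> Im (sep_time (of_real x)) < Im (sep_time (of_real y))"
proof -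
  have D: "Re (dtime (of_real s)) = 0" "Im (dtime (of_real s)) > 0"
    if "lam_turn < s" "s < pi" for s
  proof -
    have c: "cos (s / 2) < a_plus" "0 < cos (s / 2)"
      using cos_half_mono[of lam_turn s] cos_half_mono[of s pi] cos_half_lam_turn that lam_turn_bounds by auto
    then have *: "cos (s / 2) \<le> a_plus" "0 \<le> cos (s / 2)" by simp_all
    show "Re (dtime (of_real s)) = 0" by (simp only: dtime_real_2[OF *]) simp
    have "0 < sqrt (cos (s / 2)) /
     (2 * sqrt 6 * sin (s / 4) * sqrt (a_plus - cos (s / 2)) * sqrt (cos (s / 2) - a_minus))"
      using c a_minus_bounds sin_quarter_pos[of s] that lam_turn_bounds
      by (intro divide_pos_pos mult_pos_pos) auto
    then show "Im (dtime (of_real s)) > 0" unfolding dtime_real_2[OF *] by simp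
  qed
  have cont: "continuous_on {a..b} (\<lambda>x. sep_time (of_real x))" if "lam_turn \<le> a" "b \<le> pi" for a b
    by (rule continuous_on_sep_time_real) (use that lam_turn_bounds in auto)
  have "Re (sep_time (of_real x)) = Re (sep_time (of_real lam_turn))" if "lam_turn < x"
  proof (rule DERIV_isconst_end[where f = "\<lambda>x. Re (sep_time (of_real x))"])
    show "continuous_on {lam_turn..x} (\<lambda>x. Re (sep_time (of_real x)))" using assms by (intro continuous_intros cont) auto
    show "((\<lambda>x. Re (sep_time (of_real x))) has_real_derivative 0) (at s)" if "lam_turn < s" "s < x" for s
      using D(1)[of s] DERIV_sep_time_real(1)[of s] that assms lam_turn_bounds by auto
  qed fact
  then show "Re (sep_time (of_real x)) = 0" using assms by (cases "x = lam_turn") (auto simp flip: turn_plus_eq)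
  show "Im (sep_time (of_real x)) < Im (sep_time (of_real y))" if "x < y" "y \<le> pi"
  proof (rule DERIV_pos_imp_increasing_open[where f = "\<lambda>x. Im (sep_time (of_real x))"])
    show "continuous_on {x..y} (\<lambda>x. Im (sep_time (of_real x)))" using that assms by (intro continuous_intros cont) auto
    show "\<exists>z. ((\<lambda>x. Im (sep_time (of_real x))) has_real_derivative z) (at s) \<and> 0 < z"
      if "x < s" "s < y" for s
      using D(2)[of s] DERIV_sep_time_real(2)[of s] that assms \<open>y \<le> pi\<close> lam_turn_bounds by auto
  qed (use that in auto)
qed

text \<open>At \<open>pi\<close> the path turns from the imaginary axis to the left: this is the
  reentrant corner, and from here on it stays outside the first quadrant until the upper side is
  reached.\<close>

lemma sep_time_real_3:
  assumes "pi \<le> x" "x \<le> 2 * pi"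
  shows "Im (sep_time (of_real x)) = Im (sep_time (of_real pi))"
    and "pi < x \<Longrightarrow> Re (sep_time (of_real x)) < 0"
proof -
  have D: "dtime (of_real s) = of_real (Re (dtime (of_real s)))" "Re (dtime (of_real s)) < 0"
    if "pi < s" "s < x" for s
  proof -
    have c: "cos (s / 2) < 0" using cos_half_mono[of pi s] that assms by auto
    then have *: "cos (s / 2) \<le> 0" by simp
    have m: "a_minus < cos (s / 2)" using a_minus_bounds cos_ge_minus_one[of "s/2"] by linarith
    show "dtime (of_real s) = of_real (Re (dtime (of_real s)))" by (simp only: dtime_real_3[OF *] Re_complex_of_real)
    show "Re (dtime (of_real s)) < 0" unfolding dtime_real_3[OF *] Re_complex_of_real
      using c a_plus_bounds m sin_quarter_pos[of s] that assms
      by (intro divide_neg_pos mult_pos_pos) (auto intro: order.strict_trans[OF _ that(1)])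
  qed
  have cont: "continuous_on {pi..x} (\<lambda>x. sep_time (of_real x))"
    by (rule continuous_on_sep_time_real) (use assms in \<open>auto intro: order.strict_trans2[OF pi_gt_zero]\<close>)
  have "Im (sep_time (of_real x)) = Im (sep_time (of_real pi))" if "pi < x"
  proof (rule DERIV_isconst_end[where f = "\<lambda>x. Im (sep_time (of_real x))"])
    show "continuous_on {pi..x} (\<lambda>x. Im (sep_time (of_real x)))" by (intro continuous_intros cont)
    show "((\<lambda>x. Im (sep_time (of_real x))) has_real_derivative 0) (at s)" if "pi < s" "s < x" for s
    proof -
      have "Im (dtime (of_real s)) = 0" by (metis D(1) that Im_complex_of_real)
      then show ?thesis using DERIV_sep_time_real(2)[of s] that assms lam_turn_bounds by auto
    qed
  qed fact
  then show "Im (sep_time (of_real x)) = Im (sep_time (of_real pi))" using assms by (cases "x = pi") auto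
  show "Re (sep_time (of_real x)) < 0" if "pi < x"
  proof -
    have "Re (sep_time (of_real x)) < Re (sep_time (of_real pi))"
    proof (rule DERIV_neg_imp_decreasing_open[where f = "\<lambda>x. Re (sep_time (of_real x))"])
      show "continuous_on {pi..x} (\<lambda>x. Re (sep_time (of_real x)))" by (intro continuous_intros cont)
      show "\<exists>y. ((\<lambda>x. Re (sep_time (of_real x))) has_real_derivative y) (at s) \<and> y < 0"
        if "pi < s" "s < x" for s
        using D(2)[OF that] DERIV_sep_time_real(1)[of s] that assms lam_turn_bounds by auto
    qed fact
    then show ?thesis using sep_time_real_2(1)[of pi] lam_turn_bounds by simp
  qed
qed

text \<open>The substitution \<open>x = cos (lambda / 2)\<close>, with the sign of
  \<open>d lambda / dx\<close> dropped. The factor \<open>1 - x\<close> hidden in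
  \<open>2 * sin (lambda / 4) ^ 2\<close> joins the one in \<open>1 - x\<^sup>2\<close>, and their
  product leaves the root as \<open>1 - x\<close>.\<close>

lemma integrand_substitution:
  assumes x: "0 < x" "x < a_plus"
  shows "Im (dtime (of_real (2 * arccos x))) * (2 / sqrt (1 - x\<^sup>2))
    = 1 / (1 - x) * sqrt (x / (3 * (x + 1) * (a_plus - x) * (x - a_minus)))"
proof -
  have x1: "x < 1" using x a_plus_bounds by simp
  define s where "s = sin (arccos x / 2)"
  have ac: "0 < arccos x" "arccos x \<le> pi" using x1 x arccos_less_arccos[of x 1] arccos_ubound[of x] by auto
  have s0: "0 < s" unfolding s_def using ac by (intro sin_gt_zero) auto
  have s2: "2 * s\<^sup>2 = 1 - x"
    using cos_double_sin[of "arccos x / 2"] x x1 by (simp add: s_def)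
  then have s: "s = sqrt ((1 - x) / 2)" using s0 by (intro real_sqrt_unique[symmetric]) auto
  have sq1: "1 - x\<^sup>2 = (1 - x) * (1 + x)" by (simp add: algebra_simps power2_eq_square)
  have "Im (dtime (of_real (2 * arccos x))) = sqrt x / (2 * sqrt 6 * s * sqrt (a_plus - x) * sqrt (x - a_minus))"
    using dtime_real_2[of "2 * arccos x"] x x1 by (simp add: s_def)
  then have "Im (dtime (of_real (2 * arccos x))) * (2 / sqrt (1 - x\<^sup>2))
      = sqrt x / (sqrt 6 * s * sqrt (a_plus - x) * sqrt (x - a_minus) * sqrt (1 - x\<^sup>2))" by simp
  also have "sqrt 6 * s * sqrt (a_plus - x) * sqrt (x - a_minus) * sqrt (1 - x\<^sup>2)
     = sqrt (6 * ((1 - x) / 2) * (a_plus - x) * (x - a_minus) * ((1 - x) * (1 + x)))"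
    by (simp only: sq1 s real_sqrt_mult)
  also have "6 * ((1 - x) / 2) * (a_plus - x) * (x - a_minus) * ((1 - x) * (1 + x))
     = (1 - x)\<^sup>2 * (3 * (x + 1) * (a_plus - x) * (x - a_minus))"
  proof -
    have "6 * ((1 - x) / 2) = 3 * (1 - x)" by simp
    then show ?thesis by (simp only: power2_eq_square) (simp only: ac_simps)
  qed
  also have "sqrt \<dots> = (1 - x) * sqrt (3 * (x + 1) * (a_plus - x) * (x - a_minus))"
    using x1 by (simp only: real_sqrt_mult) simp
  finally show ?thesis by (simp only: real_sqrt_divide) simp
qed

text \<open>The integrand is unbounded at \<open>a_plus\<close>, but its primitive is known in terms
  of \<open>sep_time\<close> and is continuous up to both ends, so the fundamental theorem with
  differentiability in the interior applies. The minus sign in \<open>F\<close> accounts for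
  \<open>arccos\<close> being decreasing.\<close>

lemma sep_time_pi: "sep_time (of_real pi) = \<i> * of_real A_strip"
proof -
  define F where "F x = - Im (sep_time (of_real (2 * arccos x)))" for x
  have ap: "0 < a_plus" "a_plus < 1" using a_plus_bounds by auto
  have rng: "2 * arccos x \<in> {lam_turn..pi}" if "0 \<le> x" "x \<le> a_plus" for x
    using that ap arccos_le_arccos[of x a_plus] arccos_le_pi2[of x] by (auto simp: lam_turn_def)
  have "continuous_on {0..a_plus} F" unfolding F_def
    by (intro continuous_intros continuous_on_compose2[OF continuous_on_sep_time_real[OF order_refl]])
       (use rng ap lam_turn_bounds in \<open>auto dest: rng intro!: continuous_intros\<close>, (fastforce dest: rng)+)
  moreover have "(F has_vector_derivative
     1 / (1 - x) * sqrt (x / (3 * (x + 1) * (a_plus - x) * (x - a_minus)))) (at x)" if "x \<in> {0<..<a_plus}" for x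
  proof -
    have x: "0 < x" "x < a_plus" "x < 1" using that ap by auto
    have "arccos a_plus < arccos x" using x ap by (intro arccos_less_arccos) auto
    then have "2 * arccos x \<in> {lam_turn..pi}" "2 * arccos x \<noteq> lam_turn"
      using rng[of x] x by (auto simp: lam_turn_def)
    then have y: "0 < 2 * arccos x" "2 * arccos x < 2 * pi" "2 * arccos x \<noteq> lam_turn"
      using lam_turn_bounds by auto
    have "(arccos has_real_derivative inverse (- sqrt (1 - x\<^sup>2))) (at x)"
      using x by (intro DERIV_arccos) auto
    then have "((\<lambda>x. 2 * arccos x) has_real_derivative 2 * inverse (- sqrt (1 - x\<^sup>2))) (at x)"
      by (rule DERIV_cmult)
    from DERIV_minus[OF DERIV_chain2[OF DERIV_sep_time_real(2)[OF y] this]]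
    have "(F has_real_derivative Im (dtime (of_real (2 * arccos x))) * (2 / sqrt (1 - x\<^sup>2))) (at x)"
      unfolding F_def[abs_def] by (simp add: field_simps)
    then show ?thesis unfolding integrand_substitution[OF x(1,2)] has_real_derivative_iff_has_vector_derivative .
  qed
  ultimately have "((\<lambda>x. 1 / (1 - x) * sqrt (x / (3 * (x + 1) * (a_plus - x) * (x - a_minus))))
     has_integral F a_plus - F 0) {0..a_plus}"
    using ap by (intro fundamental_theorem_of_calculus_interior) auto
  then have "A_strip = F a_plus - F 0" unfolding A_strip_def by (rule integral_unique)
  also have "F a_plus = 0" unfolding F_def turn_plus_def[symmetric] by simp
  finally have "Im (sep_time (of_real pi)) = A_strip" by (simp add: F_def)
  then show ?thesis using sep_time_real_2(1)[of pi] lam_turn_bounds by (simp add: complex_eq_iff)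
qed

lemma A_strip_pos: "0 < A_strip"
  using sep_time_real_2(2)[of lam_turn pi] lam_turn_bounds
  by (simp add: sep_time_pi flip: turn_plus_eq)

section \<open>Boundary values on the vertical edges\<close>

definition y_turn :: real where "y_turn = 2 * arcosh (- a_minus)"

lemma cosh_half_y_turn: "cosh (y_turn / 2) = - a_minus"
  using a_minus_bounds by (simp add: y_turn_def)

lemma y_turn_pos: "0 < y_turn"
proof -
  have "0 \<le> y_turn" using a_minus_bounds arcosh_nonneg_real[of "- a_minus"] by (simp add: y_turn_def)
  moreover have "y_turn \<noteq> 0" using cosh_half_y_turn a_minus_bounds by auto
  ultimately show ?thesis by simp
qed

lemma turn_minus_eq: "turn_minus = of_real (2 * pi) + of_real y_turn * (- \<i>)"
  by (simp add: turn_minus_def y_turn_def)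

text \<open>The level \<open>h\<close> of the upper horizontal side of the L-shaped region.\<close>

definition height :: real where "height = Im (sep_time turn_minus)"

lemma right_edge_in: "0 \<le> s \<Longrightarrow> of_real (2 * pi) + of_real s * (- \<i>) \<in> half_strip"
  by (auto simp: half_strip_def complex_eq_iff)

lemma left_edge_in: "0 < s \<Longrightarrow> 0 + of_real s * (- \<i>) \<in> half_strip"
  by (auto simp: half_strip_def complex_eq_iff)

lemma right_edge_eval:
  "hcos (of_real (2 * pi) + of_real s * (- \<i>)) = of_real (- cosh (s / 2))"
  "sin ((of_real (2 * pi) + of_real s * (- \<i>)) / 4) = of_real (cosh (s / 4))"
  by (simp_all add: complex_eq_iff Re_hcos Im_hcos Re_sin_quarter Im_sin_quarter)

lemma left_edge_eval:
  "hcos (0 + of_real s * (- \<i>)) = of_real (cosh (s / 2))"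
  "sin ((0 + of_real s * (- \<i>)) / 4) = - \<i> * of_real (sinh (s / 4))"
  by (simp_all add: complex_eq_iff Re_hcos Im_hcos Re_sin_quarter Im_sin_quarter)

lemma usqrt_diff_real:
  assumes "q = of_real c"
  shows "a \<le> c \<Longrightarrow> usqrt (q - of_real a) = of_real (sqrt (c - a))"
    and "c \<le> a \<Longrightarrow> usqrt (q - of_real a) = \<i> * of_real (sqrt (a - c))"
  using usqrt_of_real_nonneg[of "c - a"] usqrt_of_real_nonpos[of "c - a"] assms by auto

lemma cnj_eq_minus_imp: "cnj w = - w \<Longrightarrow> Re w = 0" by (simp add: complex_eq_iff)
text \<open>Two of the three roots are imaginary above \<open>turn_minus\<close>, so
  \<open>dtime\<close> is real there and walking down the edge moves \<open>T\<close> vertically.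
  Below it all three are imaginary, and \<open>T\<close> moves horizontally.\<close>

lemma dtime_right_1:
  assumes "0 < s" "s < y_turn"
  shows "Im (dtime (of_real (2 * pi) + of_real s * (- \<i>))) = 0"
    and "Re (dtime (of_real (2 * pi) + of_real s * (- \<i>))) < 0"
proof -
  have c: "cosh (s / 2) < - a_minus" "1 \<le> cosh (s / 2)"
    using assms cosh_real_strict_mono[of "s/2" "y_turn/2"] cosh_half_y_turn cosh_real_ge_1 by auto
  define z where "z = of_real (2 * pi) + of_real s * (- \<i>)"
  have q: "hcos z = of_real (- cosh (s / 2))" unfolding z_def by (rule right_edge_eval)
  have "usqrt (hcos z) = \<i> * of_real (sqrt (cosh (s / 2)))"
    "usqrt (hcos z - of_real a_plus) = \<i> * of_real (sqrt (cosh (s / 2) + a_plus))"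
    "usqrt (hcos z - of_real a_minus) = of_real (sqrt (- cosh (s / 2) - a_minus))"
    using c a_plus_bounds a_minus_bounds usqrt_diff_real[OF q, of 0] usqrt_diff_real[OF q, of a_plus] usqrt_diff_real[OF q, of a_minus]
    by (auto simp: add.commute)
  then have "dtime z = of_real (- (sqrt (cosh (s / 2)) / (2 * sqrt 6 * cosh (s / 4) * sqrt (cosh (s / 2) + a_plus)
     * sqrt (- cosh (s / 2) - a_minus))))"
    by (simp add: dtime_def z_def right_edge_eval(2)[simplified])
  moreover have "0 < sqrt (cosh (s / 2)) / (2 * sqrt 6 * cosh (s / 4) * sqrt (cosh (s / 2) + a_plus)
     * sqrt (- cosh (s / 2) - a_minus))"
    using c a_plus_bounds by (intro divide_pos_pos mult_pos_pos) auto
  ultimately show "Im (dtime z) = 0" "Re (dtime z) < 0" by simp_all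
qed

lemma dtime_right_2:
  assumes "y_turn < s"
  shows "Re (dtime (of_real (2 * pi) + of_real s * (- \<i>))) = 0"
proof -
  have c: "cosh (s / 2) > - a_minus" "1 \<le> cosh (s / 2)"
    using assms y_turn_pos cosh_real_strict_mono[of "y_turn/2" "s/2"] cosh_half_y_turn cosh_real_ge_1 by auto
  define z where "z = of_real (2 * pi) + of_real s * (- \<i>)"
  have q: "hcos z = of_real (- cosh (s / 2))" unfolding z_def by (rule right_edge_eval)
  have "usqrt (hcos z) = \<i> * of_real (sqrt (cosh (s / 2)))"
    "usqrt (hcos z - of_real a_plus) = \<i> * of_real (sqrt (cosh (s / 2) + a_plus))"
    "usqrt (hcos z - of_real a_minus) = \<i> * of_real (sqrt (cosh (s / 2) + a_minus))"
    using c a_plus_bounds a_minus_bounds usqrt_diff_real[OF q, of 0] usqrt_diff_real[OF q, of a_plus] usqrt_diff_real[OF q, of a_minus]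
    by (auto simp: add.commute)
  then have "cnj (dtime z) = - dtime z"
    by (simp add: dtime_def z_def right_edge_eval(2)[simplified])
  then show "Re (dtime z) = 0" by (rule cnj_eq_minus_imp)
qed

lemma dtime_left:
  assumes "0 < s"
  shows "Re (dtime (0 + of_real s * (- \<i>))) = 0"
proof -
  have c: "1 \<le> cosh (s / 2)" using cosh_real_ge_1 by auto
  define z where "z = 0 + of_real s * (- \<i>)"
  have q: "hcos z = of_real (cosh (s / 2))" unfolding z_def by (rule left_edge_eval)
  have "usqrt (hcos z) = of_real (sqrt (cosh (s / 2)))"
    "usqrt (hcos z - of_real a_plus) = of_real (sqrt (cosh (s / 2) - a_plus))"
    "usqrt (hcos z - of_real a_minus) = of_real (sqrt (cosh (s / 2) - a_minus))"
    using c a_plus_bounds a_minus_bounds usqrt_diff_real[OF q, of 0] usqrt_diff_real[OF q, of a_plus] usqrt_diff_real[OF q, of a_minus]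
    by (auto simp: add.commute)
  then have "cnj (dtime z) = - dtime z"
    by (simp add: dtime_def z_def left_edge_eval(2)[simplified])
  then show "Re (dtime z) = 0" by (rule cnj_eq_minus_imp)
qed

lemma of_real_ne_turns:
  "0 < s \<Longrightarrow> of_real (2 * pi) + of_real s * (- \<i>) \<noteq> turn_plus"
  "s \<noteq> y_turn \<Longrightarrow> of_real (2 * pi) + of_real s * (- \<i>) \<noteq> turn_minus"
  "0 + of_real s * (- \<i>) \<noteq> turn_plus" "0 + of_real s * (- \<i>) \<noteq> turn_minus"
  using lam_turn_bounds by (auto simp: turn_plus_eq turn_minus_eq complex_eq_iff)

text \<open>\<open>T\<close> moves vertically on this piece, so the real part keeps the negative
  value that it has at \<open>2 * pi\<close>.\<close>

lemma sep_time_right_1: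
  assumes "0 \<le> s" "s \<le> y_turn"
  shows "Re (sep_time (of_real (2 * pi) + of_real s * (- \<i>))) < 0"
proof -
  define g where "g s = sep_time (of_real (2 * pi) + of_real s * (- \<i>))" for s
  have cont: "continuous_on {0..s} g" unfolding g_def
    by (rule continuous_on_sep_time_line, rule right_edge_in) auto
  have "Re (g s) = Re (g 0)" if "0 < s"
  proof (rule DERIV_isconst_end[where f = "\<lambda>s. Re (g s)"])
    show "continuous_on {0..s} (\<lambda>s. Re (g s))" by (intro continuous_intros cont)
    show "((\<lambda>s. Re (g s)) has_real_derivative 0) (at u)" if "0 < u" "u < s" for u
      using DERIV_sep_time_line(1)[of 0 s "of_real (2 * pi)" "- \<i>" u] right_edge_in of_real_ne_turns[of u]
        dtime_right_1[of u] that assms by (auto simp: g_def)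
  qed fact
  then have "Re (g s) = Re (g 0)" using assms by (cases "s = 0") auto
  moreover have "Re (g 0) < 0" using sep_time_real_3(2)[of "2 * pi"] pi_gt_zero by (simp add: g_def)
  ultimately show ?thesis by (simp add: g_def)
qed

text \<open>Walking down the right edge from \<open>2 * pi\<close>, where \<open>T\<close> is still
  at level \<open>A_strip\<close>, the imaginary part increases strictly until
  \<open>turn_minus\<close>.\<close>

lemma A_less_height: "A_strip < height"
proof -
  define g where "g s = sep_time (of_real (2 * pi) + of_real s * (- \<i>))" for s
  have cont: "continuous_on {0..y_turn} g" unfolding g_def
    by (rule continuous_on_sep_time_line, rule right_edge_in) auto
  have "Im (g 0) < Im (g y_turn)"
  proof (rule DERIV_pos_imp_increasing_open[where f = "\<lambda>s. Im (g s)"])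
    show "continuous_on {0..y_turn} (\<lambda>s. Im (g s))" by (intro continuous_intros cont)
    show "\<exists>y. ((\<lambda>s. Im (g s)) has_real_derivative y) (at u) \<and> 0 < y" if "0 < u" "u < y_turn" for u
    proof (intro exI conjI)
      show "((\<lambda>s. Im (g s)) has_real_derivative
         Im (- \<i> * dtime (of_real (2 * pi) + of_real u * (- \<i>)))) (at u)"
        unfolding g_def using DERIV_sep_time_line(2)[of 0 y_turn "of_real (2 * pi)" "- \<i>" u]
          right_edge_in of_real_ne_turns[of u] that by auto
      show "0 < Im (- \<i> * dtime (of_real (2 * pi) + of_real u * (- \<i>)))"
        using dtime_right_1(2)[OF that] by simp
    qed
  qed (rule y_turn_pos)
  moreover have "Im (g 0) = A_strip" using sep_time_real_3(1)[of "2 * pi"] by (simp add: g_def sep_time_pi)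
  ultimately show ?thesis by (simp add: g_def height_def turn_minus_eq)
qed

lemma sep_time_right_2:
  assumes "y_turn \<le> s"
  shows "Im (sep_time (of_real (2 * pi) + of_real s * (- \<i>))) = height"
proof -
  define g where "g s = sep_time (of_real (2 * pi) + of_real s * (- \<i>))" for s
  have cont: "continuous_on {y_turn..s} g" unfolding g_def
    by (rule continuous_on_sep_time_line, rule right_edge_in) (use y_turn_pos in auto)
  have "Im (g s) = Im (g y_turn)" if "y_turn < s"
  proof (rule DERIV_isconst_end[where f = "\<lambda>s. Im (g s)"])
    show "continuous_on {y_turn..s} (\<lambda>s. Im (g s))" by (intro continuous_intros cont)
    show "((\<lambda>s. Im (g s)) has_real_derivative 0) (at u)" if "y_turn < u" "u < s" for u
      using DERIV_sep_time_line(2)[of y_turn s "of_real (2 * pi)" "- \<i>" u] right_edge_in of_real_ne_turns[of u]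
        dtime_right_2[of u] that y_turn_pos by (auto simp: g_def)
  qed fact
  then have "Im (g s) = Im (g y_turn)" using assms by (cases "s = y_turn") auto
  then show ?thesis by (simp add: g_def height_def turn_minus_eq)
qed

lemma sep_time_left_const:
  assumes "0 < s" "s < u"
  shows "Im (sep_time (0 + of_real s * (- \<i>))) = Im (sep_time (0 + of_real u * (- \<i>)))"
proof -
  define g where "g s = sep_time (0 + of_real s * (- \<i>))" for s
  have cont: "continuous_on {s..u} g" unfolding g_def
    by (rule continuous_on_sep_time_line, rule left_edge_in) (use assms in auto)
  have "Im (g u) = Im (g s)"
  proof (rule DERIV_isconst_end[where f = "\<lambda>s. Im (g s)"])
    show "continuous_on {s..u} (\<lambda>s. Im (g s))" by (intro continuous_intros cont)
    show "((\<lambda>s. Im (g s)) has_real_derivative 0) (at v)" if "s < v" "v < u" for v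
      using DERIV_sep_time_line(2)[of s u 0 "- \<i>" v] left_edge_in of_real_ne_turns(3,4)[of v]
        dtime_left[of v] that assms by (auto simp: g_def)
  qed fact
  then show ?thesis by (simp add: g_def)
qed

section \<open>Decay of the integrand far down the half-strip\<close>

lemma half_le_sinh: "0 \<le> x \<Longrightarrow> x / 2 \<le> sinh x" for x :: real
proof -
  assume "0 \<le> x"
  then have "exp (- x) \<le> 1" by simp
  then have "x \<le> exp x - exp (- x)" using exp_ge_add_one_self[of x] by linarith
  then show ?thesis by (simp add: sinh_def)
qed

lemma norm_ge_sinh:
  assumes "0 \<le> s" "w = Complex (a * cosh s) (b * sinh s)" "a\<^sup>2 + b\<^sup>2 = 1"
  shows "sinh s \<le> cmod w"
proof -
  have "(sinh s)\<^sup>2 \<le> a\<^sup>2 * (cosh s)\<^sup>2 + b\<^sup>2 * (sinh s)\<^sup>2"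
  proof -
    have "(sinh s)\<^sup>2 \<le> (a\<^sup>2 + b\<^sup>2) * (sinh s)\<^sup>2 + a\<^sup>2" using assms(3) by simp
    also have "\<dots> = a\<^sup>2 * (cosh s)\<^sup>2 + b\<^sup>2 * (sinh s)\<^sup>2" by (simp add: cosh_square_eq algebra_simps)
    finally show ?thesis .
  qed
  then show ?thesis using assms(2) by (simp add: cmod_def power_mult_distrib real_le_rsqrt)
qed

lemma norm_hcos_ge:
  assumes "Im z \<le> 0" shows "sinh (- Im z / 2) \<le> cmod (hcos z)"
  by (rule norm_ge_sinh[where a = "cos (Re z / 2)" and b = "sin (Re z / 2)"])
     (use assms in \<open>auto simp: complex_eq_iff Re_hcos Im_hcos\<close>)

lemma norm_sin_quarter_ge:
  assumes "Im z \<le> 0" shows "sinh (- Im z / 4) \<le> cmod (sin (z / 4))"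
  by (rule norm_ge_sinh[where a = "sin (Re z / 4)" and b = "- cos (Re z / 4)"])
     (use assms in \<open>auto simp: complex_eq_iff Re_sin_quarter Im_sin_quarter\<close>)

text \<open>The true decay is exponential; this crude bound still tends to 0. Depth 16 guarantees
  \<open>4 \<le> cmod (hcos z)\<close>, hence \<open>cmod (hcos z - a)\<close> is at least half of
  \<open>cmod (hcos z)\<close> for both roots, and
  \<open>2 \<le> cmod (sin (z / 4))\<close>.\<close>

lemma norm_dtime_le:
  assumes "Im z \<le> -16" shows "cmod (dtime z) \<le> 1 / sqrt (- Im z)" "dtime z \<noteq> 0"
proof -
  define Y where "Y = - Im z"
  define N where "N = cmod (hcos z)"
  have Y: "16 \<le> Y" using assms by (simp add: Y_def)
  have "Y / 4 \<le> sinh (Y / 2)" using half_le_sinh[of "Y / 2"] Y by simp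
  then have N: "Y / 4 \<le> N" using norm_hcos_ge[of z] Y by (simp add: N_def Y_def)
  have "Y / 8 \<le> sinh (Y / 4)" using half_le_sinh[of "Y / 4"] Y by simp
  then have S: "2 \<le> cmod (sin (z / 4))" using norm_sin_quarter_ge[of z] Y by (simp add: Y_def)
  have N4: "4 \<le> N" using N Y by simp
  have P: "N / 2 \<le> cmod (hcos z - of_real a)" if "\<bar>a\<bar> \<le> 2" for a
    using norm_triangle_ineq2[of "hcos z" "of_real a"] that N4 by (simp add: N_def)
  have D: "2 * sqrt 6 * 2 * sqrt (N / 2) * sqrt (N / 2) \<le> 2 * sqrt 6 * cmod (sin (z / 4)) *
     sqrt (cmod (hcos z - of_real a_plus)) * sqrt (cmod (hcos z - of_real a_minus))"
    using S N4 a_plus_bounds a_minus_bounds by (intro mult_mono real_sqrt_le_mono P) auto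
  have "sqrt 6 \<ge> 2" by (rule real_le_rsqrt) simp
  then have "2 * N \<le> sqrt 6 * N" using N4 by (intro mult_right_mono) auto
  then have "4 * N \<le> 2 * sqrt 6 * 2 * (N / 2)" by (simp add: mult.commute)
  also have "\<dots> = 2 * sqrt 6 * 2 * sqrt (N / 2) * sqrt (N / 2)" using N4 by simp
  also note D
  finally have D2: "4 * N \<le> 2 * sqrt 6 * cmod (sin (z / 4)) *
     sqrt (cmod (hcos z - of_real a_plus)) * sqrt (cmod (hcos z - of_real a_minus))" .
  have e: "cmod (dtime z) = sqrt N / (2 * sqrt 6 * cmod (sin (z / 4)) *
     sqrt (cmod (hcos z - of_real a_plus)) * sqrt (cmod (hcos z - of_real a_minus)))"
    by (simp add: dtime_def norm_divide norm_mult norm_usqrt N_def)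
  also have "\<dots> \<le> sqrt N / (4 * N)" using D2 N4 by (intro divide_left_mono mult_pos_pos) auto
  also have "\<dots> = 1 / (4 * sqrt N)" using N4 real_sqrt_mult_self[of N] by (simp add: field_simps)
  also have "\<dots> \<le> 1 / (2 * sqrt Y)"
  proof -
    have "sqrt (Y / 4) \<le> sqrt N" using N by simp
    then have "2 * sqrt Y \<le> 4 * sqrt N" by (simp add: real_sqrt_divide)
    then show ?thesis using Y N4 by (intro divide_left_mono mult_pos_pos) auto
  qed
  also have "\<dots> \<le> 1 / sqrt Y" using Y by (simp add: field_simps)
  finally show "cmod (dtime z) \<le> 1 / sqrt (- Im z)" by (simp add: Y_def)
  have "0 < sqrt N / (2 * sqrt 6 * cmod (sin (z / 4)) *
     sqrt (cmod (hcos z - of_real a_plus)) * sqrt (cmod (hcos z - of_real a_minus)))"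
    using D2 N4 by (intro divide_pos_pos) auto
  then show "dtime z \<noteq> 0" using e by auto
qed

text \<open>An artefact of division by 0 at the two singular points. It turns any estimate that
  keeps \<open>dtime z\<close> away from 0 into a proof that \<open>z\<close> is not a turning
  point.\<close>

lemma dtime_turn [simp]: "dtime turn_plus = 0" "dtime turn_minus = 0"
  by (simp_all add: dtime_def hcos_turn_plus hcos_turn_minus)

lemma sep_time_horizontal:
  assumes z: "z \<in> half_strip" and w: "w \<in> half_strip" and Im: "Im w = Im z" "Im z \<le> -16"
  shows "cmod (sep_time z - sep_time w) \<le> 2 * pi / sqrt (- Im z)"
proof -
  define S where "S = half_strip \<inter> {v. Im v = Im z}"
  have "convex S" unfolding S_def
    using convex_hyperplane[of \<i> "Im z"] by (intro convex_Int convex_half_strip) (simp add: inner_complex_def)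
  moreover have "(sep_time has_field_derivative dtime v) (at v within S)" "cmod (dtime v) \<le> 1 / sqrt (- Im z)" if "v \<in> S" for v
    using norm_dtime_le[of v] that Im by (auto simp: S_def intro!: DERIV_subset[OF DERIV_sep_time])
  ultimately have "cmod (sep_time z - sep_time w) \<le> 1 / sqrt (- Im z) * cmod (z - w)"
    by (rule field_differentiable_bound) (use z w Im in \<open>auto simp: S_def\<close>)
  also have "cmod (z - w) \<le> 2 * pi"
  proof -
    have "cmod (z - w) = \<bar>Re z - Re w\<bar>" using Im by (simp add: cmod_eq_Re)
    then show ?thesis using z w by (auto simp: half_strip_def)
  qed
  then have "1 / sqrt (- Im z) * cmod (z - w) \<le> 1 / sqrt (- Im z) * (2 * pi)"
    using Im by (intro mult_left_mono) auto
  finally show ?thesis by simp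
qed

lemma Im_sep_time_bottom:
  assumes z: "z \<in> half_strip" and Im: "Im z \<le> - 16 - y_turn"
  shows "\<bar>Im (sep_time z) - height\<bar> \<le> 2 * pi / sqrt (- Im z)"
proof -
  let ?w = "of_real (2 * pi) + of_real (- Im z) * (- \<i>)"
  have h: "Im (sep_time ?w) = height" using Im y_turn_pos by (intro sep_time_right_2) auto
  have "cmod (sep_time z - sep_time ?w) \<le> 2 * pi / sqrt (- Im z)"
    using Im y_turn_pos by (intro sep_time_horizontal z right_edge_in) auto
  moreover have "\<bar>Im (sep_time z - sep_time ?w)\<bar> \<le> cmod (sep_time z - sep_time ?w)" by (rule abs_Im_le_cmod)
  ultimately show ?thesis using h by simp
qed

lemma tendsto_2pi_sqrt: "((\<lambda>x. 2 * pi / sqrt x) \<longlongrightarrow> 0) at_top"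
  by (intro tendsto_divide_0[OF tendsto_const] filterlim_at_top_imp_at_infinity sqrt_at_top)

text \<open>The left edge does not meet the right edge, but at depth \<open>u\<close> a horizontal
  step between them changes \<open>T\<close> by at most \<open>2 * pi / sqrt u\<close>. Letting
  \<open>u\<close> grow identifies the constant imaginary part on the left with the one on the
  right.\<close>

lemma sep_time_left:
  assumes "0 < s" shows "Im (sep_time (0 + of_real s * (- \<i>))) = height"
proof -
  have "\<forall>\<^sub>F u in at_top. \<bar>Im (sep_time (0 + of_real s * (- \<i>))) - height\<bar> \<le> 2 * pi / sqrt u"
    using eventually_ge_at_top[of "16 + y_turn + s"]
  proof eventually_elim
    case (elim u)
    then have "Im (sep_time (0 + of_real s * (- \<i>))) = Im (sep_time (0 + of_real u * (- \<i>)))"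
      using assms y_turn_pos by (intro sep_time_left_const) auto
    then show ?case
      using Im_sep_time_bottom[OF left_edge_in[of u]] elim assms y_turn_pos by auto
  qed
  then have "\<bar>Im (sep_time (0 + of_real s * (- \<i>))) - height\<bar> \<le> 0"
    using tendsto_lowerbound[OF tendsto_2pi_sqrt] trivial_limit_at_top_linorder by blast
  then show ?thesis by simp
qed

section \<open>The inverse of the time function\<close>

text \<open>At the saddle \<open>dtime\<close> has a simple pole with negative residue. Its modulus
  is the reciprocal of the exponent sqrt (21 / 8) of the linearised flow; the bound uses half of
  it.\<close>

lemma dtime_pole: "\<exists>d>0. \<exists>m>0. \<forall>z. z \<noteq> 0 \<longrightarrow> cmod z < d \<longrightarrow> Re (z * dtime z) < - m"
proof -
  define m where "m = 2 / (sqrt 6 * sqrt (1 - a_plus) * sqrt (1 - a_minus))"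
  have m: "0 < m" unfolding m_def using a_plus_bounds a_minus_bounds by (intro divide_pos_pos mult_pos_pos) auto
  have q: "hcos \<midarrow>0\<rightarrow> 1" using isContD[OF DERIV_isCont[OF DERIV_hcos[of 0]]] by (simp add: hcos_def)
  have u: "(\<lambda>z. usqrt (hcos z - of_real a)) \<midarrow>0\<rightarrow> of_real (sqrt (1 - a))" if "a < 1" for a
  proof -
    have "isCont usqrt (of_real (1 - a))" using that by (intro DERIV_isCont[OF DERIV_usqrt]) auto
    moreover have "(\<lambda>z. hcos z - of_real a) \<midarrow>0\<rightarrow> of_real (1 - a)" using tendsto_diff[OF q tendsto_const] by simp
    ultimately have "(\<lambda>z. usqrt (hcos z - of_real a)) \<midarrow>0\<rightarrow> usqrt (of_real (1 - a))" by (rule isCont_tendsto_compose)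
    then show ?thesis using that usqrt_of_real_nonneg[of "1 - a"] by simp
  qed
  have s: "(\<lambda>z. sin (z / 4) / z) \<midarrow>0\<rightarrow> (1 / 4 :: complex)"
  proof -
    have "((\<lambda>z. sin (z / 4)) has_field_derivative (1 / 4 :: complex)) (at 0)"
      by (auto intro!: derivative_eq_intros)
    then show ?thesis by (simp add: has_field_derivative_iff)
  qed
  have "(\<lambda>z. - usqrt (hcos z - of_real 0) / (2 * of_real (sqrt 6) * (sin (z / 4) / z) * usqrt (hcos z - of_real a_plus)
       * usqrt (hcos z - of_real a_minus)))
     \<midarrow>0\<rightarrow> - of_real (sqrt (1 - 0)) / (2 * of_real (sqrt 6) * (1 / 4) * of_real (sqrt (1 - a_plus)) * of_real (sqrt (1 - a_minus)))"
    using a_plus_bounds a_minus_bounds by (intro tendsto_intros u s) auto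
  also have "- of_real (sqrt (1 - 0)) / (2 * of_real (sqrt 6) * (1 / 4) * of_real (sqrt (1 - a_plus)) * of_real (sqrt (1 - a_minus)))
     = complex_of_real (- m)" by (simp add: m_def)
  also have "(\<lambda>z. - usqrt (hcos z - of_real 0) / (2 * of_real (sqrt 6) * (sin (z / 4) / z) * usqrt (hcos z - of_real a_plus)
       * usqrt (hcos z - of_real a_minus))) = (\<lambda>z. z * dtime z)"
    by (rule ext) (simp add: dtime_def)
  finally have "(\<lambda>z. Re (z * dtime z)) \<midarrow>0\<rightarrow> Re (complex_of_real (- m))" by (rule tendsto_Re)
  then have "\<forall>\<^sub>F z in at 0. Re (z * dtime z) < - (m / 2)"
    by (rule order_tendstoD) (use m in simp)
  then obtain d where "d > 0" "\<forall>z. z \<noteq> 0 \<longrightarrow> cmod z < d \<longrightarrow> Re (z * dtime z) < - (m / 2)"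
    unfolding eventually_at by (auto simp: dist_norm)
  then show ?thesis using m by (intro exI[of _ d] conjI exI[of _ "m / 2"]) auto
qed

text \<open>Integrate the bound of the preceding lemma along a ray.\<close>

lemma sep_time_pole: "\<exists>r>0. \<forall>z\<in>half_strip. cmod z < r \<longrightarrow> B < Re (sep_time z)"
proof -
  obtain d m where d: "0 < d" "0 < m" and dm: "\<And>z. z \<noteq> 0 \<Longrightarrow> cmod z < d \<Longrightarrow> Re (z * dtime z) < - m"
    using dtime_pole by blast
  define \<rho> where "\<rho> = min 1 (d / 2)"
  have \<rho>: "0 < \<rho>" "\<rho> \<le> 1" "\<rho> < d" using d by (auto simp: \<rho>_def)
  define C where "C = half_strip \<inter> sphere 0 \<rho>"
  have "C = {z. 0 \<le> Re z} \<inter> {z. Re z \<le> 2 * pi} \<inter> {z. Im z \<le> 0} \<inter> sphere 0 \<rho>"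
    using \<rho> by (auto simp: C_def half_strip_def)
  moreover have "compact \<dots>"
    by (intro closed_Int_compact closed_Int closed_halfspace_Re_ge closed_halfspace_Re_le closed_halfspace_Im_le compact_sphere)
  ultimately have "compact C" by simp
  moreover have "continuous_on C (\<lambda>z. Re (sep_time z))"
    by (intro continuous_intros continuous_on_subset[OF continuous_on_sep_time]) (auto simp: C_def)
  ultimately have "bounded ((\<lambda>z. Re (sep_time z)) ` C)"
    by (intro compact_imp_bounded compact_continuous_image)
  then obtain M where M: "\<And>z. z \<in> C \<Longrightarrow> \<bar>Re (sep_time z)\<bar> \<le> M" by (auto simp: bounded_iff)
  have main: "Re (sep_time z) \<ge> - M + m * ln (\<rho> / cmod z)" if z: "z \<in> half_strip" "cmod z < \<rho>" for z
  proof -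
    have z0: "z \<noteq> 0" using z by (auto simp: half_strip_def)
    define b where "b = \<rho> / cmod z"
    have b: "1 < b" using z z0 by (simp add: b_def)
    have in_K: "0 + of_real s * z \<in> half_strip" if "1 \<le> s" "s \<le> b" for s
    proof -
      have "cmod (of_real s * z) \<le> \<rho>"
        using that z0 b by (simp add: norm_mult b_def pos_le_divide_eq)
      moreover have "Re (of_real s * z) \<le> cmod (of_real s * z)" by (rule complex_Re_le_cmod)
      ultimately have "Re (of_real s * z) \<le> 2 * pi" using \<rho> pi_gt3 by linarith
      then show ?thesis using z that z0 by (auto simp: half_strip_def mult_nonneg_nonpos)
    qed
    \<comment> \<open>Along the ray the real part of \<open>T\<close> has derivative below
      \<open>- m / s\<close>, so it remains decreasing after \<open>m * ln s\<close> is added. The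
      end \<open>b\<close> puts \<open>b * z\<close> on the circle of radius \<open>\<rho>\<close>,
      where \<open>T\<close> is bounded.\<close>
    define G where "G s = Re (sep_time (0 + of_real s * z)) + m * ln s" for s
    have "G b < G 1"
    proof (rule DERIV_neg_imp_decreasing_open[where f = G])
      show "continuous_on {1..b} G" unfolding G_def
        by (intro continuous_intros continuous_on_sep_time_line in_K) auto
      fix s assume s: "1 < s" "s < b"
      let ?w = "0 + of_real s * z"
      have w0: "?w \<noteq> 0" using s z0 by simp
      have "cmod ?w < \<rho>"
        using s z0 b by (simp add: norm_mult b_def pos_less_divide_eq)
      then have "cmod ?w < d" using \<rho> by linarith
      from dm[OF w0 this] have lt: "Re (?w * dtime ?w) < - m" .
      then have ne: "?w \<noteq> turn_plus" "?w \<noteq> turn_minus" using d by auto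
      have "(G has_real_derivative Re (z * dtime ?w) + m * (1 / s)) (at s)"
        unfolding G_def using s in_K ne
        by (intro DERIV_add DERIV_cmult DERIV_sep_time_line(1)[of 1 b]) (auto intro!: derivative_eq_intros)
      moreover have "Re (z * dtime ?w) + m * (1 / s) < 0"
      proof -
        have "Re (?w * dtime ?w) = s * Re (z * dtime ?w)" by (simp add: algebra_simps)
        then have "s * Re (z * dtime ?w) < - m" using lt by simp
        then show ?thesis using s by (simp add: field_simps)
      qed
      ultimately show "\<exists>y. (G has_real_derivative y) (at s) \<and> y < 0" by blast
    qed fact
    moreover have "0 + of_real b * z \<in> C"
      using in_K[of b] b z0 \<rho> unfolding C_def by (simp add: norm_mult norm_divide b_def)
    then have "- M \<le> Re (sep_time (0 + of_real b * z))" using M by force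
    ultimately show ?thesis by (simp add: G_def b_def)
  qed
  define E where "E = (\<bar>B\<bar> + M + 1) / m"
  define r where "r = \<rho> * exp (- E)"
  show ?thesis
  proof (intro exI[of _ "min \<rho> r"] conjI ballI impI)
    show "0 < min \<rho> r" using \<rho> by (simp add: r_def)
    fix z assume z: "z \<in> half_strip" "cmod z < min \<rho> r"
    have z0: "0 < cmod z" using z by (auto simp: half_strip_def)
    have "exp E < \<rho> / cmod z"
      using z z0 by (simp add: r_def exp_minus field_simps)
    then have "E < ln (\<rho> / cmod z)"
      using z0 \<rho> by (subst exp_less_cancel_iff[symmetric]) simp
    then have "\<bar>B\<bar> + M + 1 < m * ln (\<rho> / cmod z)" using d by (simp add: E_def field_simps)
    then show "B < Re (sep_time z)" using main[of z] z by auto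
  qed
qed

text \<open>Properness below the level \<open>height\<close>. A sequence can leave every compact
  part of \<open>half_strip\<close> only towards the saddle, where the real part of \<open>T\<close>
  tends to infinity, or downwards, where the imaginary part tends to \<open>height\<close>.\<close>

lemma compact_preimage_sep_time:
  assumes "compact C" "\<And>t. t \<in> C \<Longrightarrow> Im t < height"
  shows "compact (half_strip \<inter> sep_time -` C)"
proof (cases "C = {}")
  case False
  obtain M where M: "\<And>t. t \<in> C \<Longrightarrow> cmod t \<le> M" using compact_imp_bounded[OF assms(1)] by (auto simp: bounded_iff)
  \<comment> \<open>The highest point of \<open>C\<close> leaves a positive gap below
    \<open>height\<close>, which bounds the depth of the preimage.\<close>
  obtain t0 where t0: "t0 \<in> C" "\<And>t. t \<in> C \<Longrightarrow> Im t \<le> Im t0"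
    using continuous_attains_sup[OF assms(1) False, of Im] continuous_on_Im[OF continuous_on_id, of C] by auto
  have "\<forall>\<^sub>F x in at_top. 2 * pi / sqrt x < height - Im t0"
    using order_tendstoD(2)[OF tendsto_2pi_sqrt] assms(2)[OF t0(1)] by simp
  then obtain Y0 where Y0: "\<And>x. Y0 \<le> x \<Longrightarrow> 2 * pi / sqrt x < height - Im t0" by (auto simp: eventually_at_top_linorder)
  define Y where "Y = max Y0 (16 + y_turn)"
  obtain r where r: "0 < r" "\<And>z. z \<in> half_strip \<Longrightarrow> cmod z < r \<Longrightarrow> M < Re (sep_time z)" using sep_time_pole by blast
  define K where "K = {z. 0 \<le> Re z} \<inter> {z. Re z \<le> 2 * pi} \<inter> {z. Im z \<le> 0} \<inter> {z. - Y \<le> Im z} \<inter> - ball 0 r"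
  have closed: "closed K" unfolding K_def
    by (intro closed_Int closed_halfspace_Re_ge closed_halfspace_Re_le closed_halfspace_Im_le
        closed_halfspace_Im_ge closed_Compl open_ball)
  have sub: "K \<subseteq> half_strip" using r by (auto simp: K_def half_strip_def)
  have "K \<subseteq> cball 0 (2 * pi + Y)"
  proof
    fix z assume "z \<in> K"
    then have "\<bar>Re z\<bar> \<le> 2 * pi" "\<bar>Im z\<bar> \<le> Y" by (auto simp: K_def)
    then show "z \<in> cball 0 (2 * pi + Y)" using cmod_le[of z] by simp
  qed
  then have bK: "bounded K" using bounded_cball bounded_subset by blast
  have "half_strip \<inter> sep_time -` C = K \<inter> sep_time -` C"
  proof (rule antisym; rule subsetI)
    fix z assume z: "z \<in> half_strip \<inter> sep_time -` C"
    have "\<not> cmod z < r" using r(2)[of z] z M[of "sep_time z"] complex_Re_le_cmod[of "sep_time z"] by auto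
    moreover have "- Y \<le> Im z"
    proof (rule ccontr)
      assume "\<not> - Y \<le> Im z"
      then have "Y0 \<le> - Im z" "Im z \<le> - 16 - y_turn" by (auto simp: Y_def)
      then have "\<bar>Im (sep_time z) - height\<bar> < height - Im t0"
        using Y0[of "- Im z"] Im_sep_time_bottom[of z] z by auto
      then show False using t0(2)[of "sep_time z"] z by auto
    qed
    ultimately show "z \<in> K \<inter> sep_time -` C" using z by (auto simp: K_def half_strip_def)
  qed (use sub in auto)
  moreover have "closed (K \<inter> sep_time -` C)"
    by (intro continuous_closed_preimage continuous_on_subset[OF continuous_on_sep_time sub] closed compact_imp_closed assms)
  ultimately show ?thesis using bK by (auto simp: compact_eq_bounded_closed intro: bounded_subset)
qed simp

text \<open>By elimination of edges: beyond \<open>pi\<close> on the real edge and on the upper part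
  of the right edge the real part of \<open>T\<close> is negative; on the rest of the right edge and
  on the left edge \<open>T\<close> is at level \<open>height\<close>.\<close>

lemma sep_time_preimage:
  assumes z: "z \<in> half_strip" and t: "0 \<le> Re (sep_time z)" "0 \<le> Im (sep_time z)" "Im (sep_time z) < height"
  shows "z \<in> half_strip_int \<or> (Im z = 0 \<and> 0 < Re z \<and> Re z \<le> pi)"
proof (rule ccontr)
  assume neg: "\<not> ?thesis"
  then consider "Im z = 0" "pi < Re z" | "Re z = 0" "Im z < 0" | "Re z = 2 * pi"
    using z by (force simp: half_strip_def half_strip_int_def complex_eq_iff)
  then show False
  proof cases
    case 1
    then have "z = of_real (Re z)" by (simp add: complex_eq_iff)
    then show False using sep_time_real_3(2)[of "Re z"] 1 z t by (auto simp: half_strip_def)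
  next
    case 2
    then have "z = 0 + of_real (- Im z) * (- \<i>)" by (simp add: complex_eq_iff)
    then show False using sep_time_left[of "- Im z"] 2 t by simp
  next
    case 3
    then have e: "z = of_real (2 * pi) + of_real (- Im z) * (- \<i>)" by (simp add: complex_eq_iff)
    have "0 \<le> - Im z" using z by (simp add: half_strip_def)
    then show False using sep_time_right_1[of "- Im z"] sep_time_right_2[of "- Im z"] t unfolding e[symmetric]
      by (cases "- Im z \<le> y_turn") auto
  qed
qed

lemma sep_time_preimage_int:
  assumes z: "z \<in> half_strip" and t: "0 < Re (sep_time z)" "0 < Im (sep_time z)" "Im (sep_time z) < height"
  shows "z \<in> half_strip_int"
proof (rule ccontr)
  assume "z \<notin> half_strip_int"
  then have *: "Im z = 0" "0 < Re z" "Re z \<le> pi" using sep_time_preimage[OF z] t by auto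
  then have "z = of_real (Re z)" by (simp add: complex_eq_iff)
  then show False using sep_time_real_1(1)[of "Re z"] sep_time_real_2(1)[of "Re z"] * t
    by (cases "Re z \<le> lam_turn") auto
qed

section \<open>Surjectivity onto the part of the region in the first quadrant\<close>

definition quarter :: "complex set" where "quarter = {t. 0 \<le> Re t \<and> 0 \<le> Im t \<and> Im t < height}"
definition quarter_int :: "complex set" where "quarter_int = {t. 0 < Re t \<and> 0 < Im t \<and> Im t < height}"

lemma quarter_int_subset: "quarter_int \<subseteq> quarter" by (auto simp: quarter_def quarter_int_def)

lemma open_quarter_int: "open quarter_int"
  unfolding quarter_int_def by (intro open_Collect_conj open_Collect_less continuous_intros)

lemma convex_quarter_int: "convex quarter_int"
proof -
  have "quarter_int = {z. 0 < Re z} \<inter> {z. 0 < Im z} \<inter> {z. Im z < height}" by (auto simp: quarter_int_def)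
  moreover have "convex \<dots>"
    by (intro convex_Int convex_halfspace_Re_gt convex_halfspace_Im_lt convex_halfspace_Im_gt)
  ultimately show ?thesis by simp
qed

lemma holomorphic_sep_time: "sep_time holomorphic_on half_strip_int"
  using DERIV_sep_time_int open_half_strip_int by (auto simp: holomorphic_on_open)

lemma inj_on_sep_time_int: "inj_on sep_time half_strip_int"
  using sep_time_inj_int half_strip_int_subset by (auto intro!: inj_onI)

text \<open>Start at a real point before the turning point, where \<open>T\<close> is real and
  positive, and step slightly down. Since \<open>dtime\<close> has negative real part, the imaginary
  part of \<open>T\<close> increases strictly.\<close>

lemma quarter_int_meets: "\<exists>z\<in>half_strip_int. sep_time z \<in> quarter_int"
proof -
  define x where "x = lam_turn / 2"
  have x: "0 < x" "x < lam_turn" using lam_turn_bounds by (auto simp: x_def)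
  have inK: "of_real x + of_real s * (- \<i>) \<in> half_strip" if "0 \<le> s" for s
    using x lam_turn_bounds that by (intro half_strip_I) auto
  have inS: "of_real x + of_real s * (- \<i>) \<in> half_strip_int" if "0 < s" for s
    using x lam_turn_bounds that by (auto simp: half_strip_int_def)
  define g where "g s = sep_time (of_real x + of_real s * (- \<i>))" for s
  have cont: "continuous_on {0..} g" unfolding g_def by (rule continuous_on_sep_time_line, rule inK) auto
  have pos: "0 < Im (g s)" if "0 < s" for s
  proof -
    have "Im (g 0) < Im (g s)"
    proof (rule DERIV_pos_imp_increasing_open[where f = "\<lambda>s. Im (g s)"])
      show "continuous_on {0..s} (\<lambda>s. Im (g s))"
        by (intro continuous_intros continuous_on_subset[OF cont]) auto
      show "\<exists>y. ((\<lambda>s. Im (g s)) has_real_derivative y) (at u) \<and> 0 < y" if "0 < u" "u < s" for u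
      proof (intro exI conjI)
        have "of_real x + of_real u * (- \<i>) \<noteq> turn_plus" "of_real x + of_real u * (- \<i>) \<noteq> turn_minus"
          using inS[of u] turn_notin_int that by metis+
        then show "((\<lambda>s. Im (g s)) has_real_derivative Im (- \<i> * dtime (of_real x + of_real u * (- \<i>)))) (at u)"
          unfolding g_def using inK that by (intro DERIV_sep_time_line(2)[of 0 s]) auto
        show "0 < Im (- \<i> * dtime (of_real x + of_real u * (- \<i>)))"
          using Re_dtime_neg[OF inS[of u]] that by simp
      qed
    qed fact
    moreover have "Im (g 0) = 0" using sep_time_real_1(1)[of x] x by (simp add: g_def)
    ultimately show ?thesis by simp
  qed
  have "(g \<longlongrightarrow> g 0) (at 0 within {0..})" using cont by (simp add: continuous_on)
  then have "(g \<longlongrightarrow> g 0) (at_right 0)" by (rule tendsto_within_subset) auto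
  moreover have "0 < Re (g 0)" "Im (g 0) < height"
    using Re_sep_time_real_pos[OF x] sep_time_real_1(1)[of x] x A_strip_pos A_less_height by (auto simp: g_def)
  ultimately have "\<forall>\<^sub>F s in at_right 0. 0 < Re (g s)" "\<forall>\<^sub>F s in at_right 0. Im (g s) < height"
    by (metis order_tendstoD(1) tendsto_Re, metis order_tendstoD(2) tendsto_Im)
  then have "\<forall>\<^sub>F s in at_right 0. 0 < s \<and> 0 < Re (g s) \<and> Im (g s) < height"
    by (intro eventually_conj eventually_at_right_less)
  then obtain s where "0 < s" "0 < Re (g s)" "Im (g s) < height"
    using eventually_happens[of _ "at_right (0::real)"] trivial_limit_at_right_real by blast
  then show ?thesis using pos[of s] inS[of s] by (auto simp: quarter_int_def g_def)
qed

lemma closed_image_sep_time: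
  assumes "\<And>t. t \<in> C \<Longrightarrow> Im t < height" "compact C"
  shows "closed (sep_time ` (half_strip \<inter> sep_time -` C))"
  by (intro compact_imp_closed compact_continuous_image compact_preimage_sep_time assms
        continuous_on_subset[OF continuous_on_sep_time]) auto

text \<open>The image is open by the open mapping theorem, and properness makes its complement in
  the connected set \<open>quarter_int\<close> open too.\<close>

lemma quarter_int_subset_image: "quarter_int \<subseteq> sep_time ` half_strip_int"
proof -
  let ?V = "quarter_int - sep_time ` half_strip_int"
  have op: "open (sep_time ` half_strip_int)"
    by (rule open_mapping_thm3[OF holomorphic_sep_time open_half_strip_int inj_on_sep_time_int])
  have "open ?V"
    unfolding open_contains_ball
  proof
    fix t assume t: "t \<in> ?V"
    then obtain e where e: "0 < e" "cball t e \<subseteq> quarter_int" using open_quarter_int open_contains_cball by blast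
    let ?P = "sep_time ` (half_strip \<inter> sep_time -` cball t e)"
    have "closed ?P" using e by (intro closed_image_sep_time) (auto simp: quarter_int_def)
    \<comment> \<open>Points of \<open>quarter_int\<close> have no preimage on an edge, so near
      \<open>t\<close> the image of the open half-strip coincides with the closed set
      \<open>?P\<close>.\<close>
    moreover have "?P \<subseteq> sep_time ` half_strip_int"
      using e by (auto simp: quarter_int_def intro!: imageI sep_time_preimage_int)
    ultimately obtain d where d: "0 < d" "ball t d \<subseteq> - ?P" using t open_contains_ball[of "- ?P"] by blast
    have "ball t (min d e) \<subseteq> ?V"
    proof
      fix w assume w: "w \<in> ball t (min d e)"
      then have "w \<in> cball t e" "w \<notin> ?P" using d by auto
      then show "w \<in> ?V" using e half_strip_int_subset by auto
    qed
    then show "\<exists>d>0. ball t d \<subseteq> ?V" using d e by (intro exI[of _ "min d e"]) auto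
  qed
  then have "sep_time ` half_strip_int \<inter> quarter_int = {} \<or> ?V \<inter> quarter_int = {}"
    by (intro connectedD[OF convex_connected[OF convex_quarter_int] op]) auto
  then show ?thesis using quarter_int_meets by auto
qed

text \<open>A point on an axis is approximated by its translates along the diagonal, which lie in
  \<open>quarter_int\<close>; the image of a compact preimage is closed, so the limit belongs to
  it.\<close>

lemma quarter_subset_image: "quarter \<subseteq> sep_time ` half_strip"
proof
  fix t assume t: "t \<in> quarter"
  define C where "C = cball t ((height - Im t) / 2)"
  have h: "0 < height - Im t" using t by (simp add: quarter_def)
  let ?P = "sep_time ` (half_strip \<inter> sep_time -` C)"
  have Im: "Im w < height" if "w \<in> C" for w
    using that h abs_Im_le_cmod[of "w - t"] by (simp add: C_def dist_norm norm_minus_commute field_simps)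
  have cl: "closed ?P" by (rule closed_image_sep_time) (auto simp: Im C_def)
  have "t \<in> ?P"
  proof (rule ccontr)
    assume "t \<notin> ?P"
    then obtain e where e: "0 < e" "ball t e \<subseteq> - ?P" using cl open_contains_ball[of "- ?P"] by blast
    define d where "d = min (e / 4) ((height - Im t) / 4)"
    have d: "0 < d" "2 * d < e" "2 * d \<le> (height - Im t) / 2" using e h by (simp_all add: d_def min_def)
    define w where "w = t + Complex d d"
    have "cmod (Complex d d) \<le> 2 * d" using cmod_le[of "Complex d d"] d by simp
    then have w: "w \<in> ball t e" "w \<in> C" using d by (auto simp: w_def C_def dist_norm)
    have "w \<in> quarter_int" using t d Im[OF w(2)] by (auto simp: quarter_def quarter_int_def w_def)
    then obtain z where "z \<in> half_strip_int" "w = sep_time z" using quarter_int_subset_image by blast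
    then have "w \<in> ?P" using w(2) half_strip_int_subset by blast
    then show False using e w by auto
  qed
  then show "t \<in> sep_time ` half_strip" by auto
qed

definition sep_dom :: "complex set" where "sep_dom = half_strip \<inter> sep_time -` quarter"

text \<open>The convexity argument settles every pair with an interior point. Two boundary points
  both lie on the real edge up to \<open>pi\<close>, where \<open>T\<close> descends strictly along
  the real axis and then climbs strictly along the imaginary one.\<close>

lemma inj_on_sep_dom: "inj_on sep_time sep_dom"
proof (rule inj_onI)
  fix z w assume z: "z \<in> sep_dom" and w: "w \<in> sep_dom" and eq: "sep_time z = sep_time w"
  have zK: "z \<in> half_strip" "w \<in> half_strip" using z w by (auto simp: sep_dom_def)
  show "z = w"
  proof (cases "z \<in> half_strip_int \<or> w \<in> half_strip_int")
    case True
    then show ?thesis using sep_time_inj_int zK eq by metis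
  next
    case False
    then have *: "Im z = 0" "0 < Re z" "Re z \<le> pi" "Im w = 0" "0 < Re w" "Re w \<le> pi"
      using sep_time_preimage[of z] sep_time_preimage[of w] z w by (auto simp: sep_dom_def quarter_def)
    have real: "x = y" if "0 < x" "x \<le> pi" "0 < y" "y \<le> pi" "sep_time (of_real x) = sep_time (of_real y)" "x \<le> y" for x y
    proof (rule ccontr)
      assume "x \<noteq> y"
      then have "x < y" using that by simp
      consider "y \<le> lam_turn" | "x < lam_turn" "lam_turn < y" | "lam_turn \<le> x" by linarith
      then show False
      proof cases
        case 1
        then show False using sep_time_real_1(2)[of x y] \<open>x < y\<close> that by auto
      next
        case 2
        then show False using Re_sep_time_real_pos[of x] sep_time_real_2(1)[of y] that by auto
      next
        case 3
        then show False using sep_time_real_2(2)[of x y] \<open>x < y\<close> that by auto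
      qed
    qed
    have e: "z = of_real (Re z)" "w = of_real (Re w)" using * by (simp_all add: complex_eq_iff)
    have "Re z = Re w" using real[of "Re z" "Re w"] real[of "Re w" "Re z"] * eq e by (metis linear)
    then show ?thesis using * by (simp add: complex_eq_iff)
  qed
qed

lemma sep_time_image_dom: "sep_time ` sep_dom = quarter"
  using quarter_subset_image by (auto simp: sep_dom_def)

section \<open>The inverse, continuous up to the axes\<close>

definition sep_inv :: "complex \<Rightarrow> complex" where "sep_inv = inv_into sep_dom sep_time"

lemma sep_inv_in: "t \<in> quarter \<Longrightarrow> sep_inv t \<in> sep_dom"
  unfolding sep_inv_def by (rule inv_into_into) (simp add: sep_time_image_dom)

lemma sep_time_sep_inv: "t \<in> quarter \<Longrightarrow> sep_time (sep_inv t) = t"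
  unfolding sep_inv_def by (rule f_inv_into_f) (simp add: sep_time_image_dom)

lemma sep_inv_eqI: "z \<in> half_strip \<Longrightarrow> sep_time z = t \<Longrightarrow> t \<in> quarter \<Longrightarrow> sep_inv t = z"
  unfolding sep_inv_def by (rule inv_into_f_eq[OF inj_on_sep_dom]) (auto simp: sep_dom_def)

lemma sep_inv_int:
  assumes "t \<in> quarter_int" shows "sep_inv t \<in> half_strip_int"
  using sep_inv_in[of t] sep_time_sep_inv[of t] assms quarter_int_subset
  by (intro sep_time_preimage_int) (auto simp: sep_dom_def quarter_int_def)

lemma holomorphic_sep_inv: "sep_inv holomorphic_on quarter_int"
proof -
  obtain g where g: "g holomorphic_on (sep_time ` half_strip_int)" "\<And>z. z \<in> half_strip_int \<Longrightarrow> g (sep_time z) = z"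
    using holomorphic_has_inverse[OF holomorphic_sep_time open_half_strip_int inj_on_sep_time_int] by metis
  have "g holomorphic_on quarter_int" using g(1) quarter_int_subset_image by (rule holomorphic_on_subset)
  moreover have "g t = sep_inv t" if "t \<in> quarter_int" for t
    using g(2)[OF sep_inv_int[OF that]] sep_time_sep_inv[of t] that quarter_int_subset by auto
  ultimately show ?thesis by (rule holomorphic_transform)
qed

text \<open>Locally \<open>sep_inv\<close> inverts a continuous injection on a compact set, namely
  the preimage of a small closed ball cut down to the first quadrant.\<close>

lemma continuous_on_sep_inv: "continuous_on quarter sep_inv"
  unfolding continuous_on_eq_continuous_within
proof
  fix t assume t: "t \<in> quarter"
  define e where "e = (height - Im t) / 2"
  have e: "0 < e" using t by (simp add: e_def quarter_def)
  define C where "C = {w. 0 \<le> Re w} \<inter> {w. 0 \<le> Im w} \<inter> cball t e"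
  have "compact C" unfolding C_def
    by (intro closed_Int_compact closed_Int closed_halfspace_Re_ge closed_halfspace_Im_ge compact_cball)
  moreover have Im: "Im w < height" if "w \<in> cball t e" for w
    using that e abs_Im_le_cmod[of "w - t"] by (simp add: e_def dist_norm norm_minus_commute field_simps)
  ultimately have P: "compact (half_strip \<inter> sep_time -` C)" by (intro compact_preimage_sep_time) (auto simp: C_def)
  have CQ: "C = quarter \<inter> cball t e" using Im by (auto simp: C_def quarter_def)
  have "continuous_on (sep_time ` (half_strip \<inter> sep_time -` C)) sep_inv"
    by (rule continuous_on_inv[OF continuous_on_subset[OF continuous_on_sep_time] P])
       (auto intro!: sep_inv_eqI simp: CQ)
  moreover have "sep_time ` (half_strip \<inter> sep_time -` C) = C"
    using quarter_subset_image by (auto simp: CQ)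
  ultimately have "continuous_on (quarter \<inter> cball t e) sep_inv" by (simp add: CQ)
  then have "continuous (at t within (quarter \<inter> cball t e)) sep_inv"
    using t e by (simp add: continuous_on_eq_continuous_within)
  moreover have "at t within (quarter \<inter> cball t e) = at t within quarter"
    by (rule at_within_nhd[of t "ball t e"]) (use e in auto)
  ultimately show "continuous (at t within quarter) sep_inv" by simp
qed

section \<open>The separatrix and the reflected extension\<close>

text \<open>The left side is \<open>6 * V_pend l + 3\<close> with \<open>c = cos (l / 2)\<close>,
  that is \<open>(3 * L)\<^sup>2\<close> at energy -1/2. The factor \<open>1 - c\<close> belongs to
  the saddle, the other two to the turning points.\<close>

lemma kinetic_factor: "c \<noteq> 0 \<Longrightarrow> 15 - 12 * c\<^sup>2 - 3 / c = 12 * (1 - c) * (c - a_plus) * (c - a_minus) / c"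
proof -
  assume "c \<noteq> 0"
  have "(c - a_plus) * (c - a_minus) = c\<^sup>2 - (a_plus + a_minus) * c + a_plus * a_minus"
    by (simp add: algebra_simps power2_eq_square)
  then have "12 * (1 - c) * ((c - a_plus) * (c - a_minus)) / c = 12 * (1 - c) * (c\<^sup>2 + c - 1 / 4) / c"
    by (simp add: a_plus_minus)
  also have "\<dots> = 15 - 12 * c\<^sup>2 - 3 / c" using \<open>c \<noteq> 0\<close> by (simp add: field_simps power2_eq_square)
  finally show ?thesis by (simp only: mult.assoc)
qed

lemma cos_half_pos: "0 < l \<Longrightarrow> l < pi \<Longrightarrow> 0 < cos (l / 2)"
  by (intro cos_gt_zero_pi) auto

lemma V_pend_eq:
  assumes "0 < l" "l < pi"
  shows "V_pend l = 2 - 2 * (cos (l / 2))\<^sup>2 - 1 / (2 * cos (l / 2))"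
proof -
  have "cos l = 2 * (cos (l / 2))\<^sup>2 - 1" using cos_double_cos[of "l / 2"] by simp
  moreover from this have "sqrt (2 + 2 * cos l) = 2 * cos (l / 2)"
    using cos_half_pos[OF assms] by (simp add: real_sqrt_mult)
  ultimately show ?thesis by (simp add: V_pend_def)
qed

lemma energy_cos_half:
  assumes "0 < l" "l < pi" "H_pend l L = - 1 / 2"
  shows "(3 * L)\<^sup>2 = 12 * (1 - cos (l / 2)) * (cos (l / 2) - a_plus) * (cos (l / 2) - a_minus) / cos (l / 2)"
proof -
  have "(3 * L)\<^sup>2 = 15 - 12 * (cos (l / 2))\<^sup>2 - 3 / cos (l / 2)"
    using assms(3) unfolding H_pend_def V_pend_eq[OF assms(1,2)] by (simp add: power2_eq_square)
  then show ?thesis using cos_half_pos[OF assms(1,2)] by (subst kinetic_factor[symmetric]) auto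
qed

lemma energy_turning:
  assumes "0 < l" "l < pi" "H_pend l L = - 1 / 2"
  shows "l \<le> lam_turn" and "L = 0 \<longleftrightarrow> l = lam_turn"
proof -
  define c where "c = cos (l / 2)"
  have c: "0 < c" "c < 1" "a_minus < c"
    using cos_half_pos[OF assms(1,2)] cos_half_mono[of 0 l] assms a_minus_bounds by (auto simp: c_def)
  have e: "(3 * L)\<^sup>2 = 12 * (1 - c) * (c - a_plus) * (c - a_minus) / c"
    using energy_cos_half[OF assms] by (simp add: c_def)
  have "0 \<le> 12 * (1 - c) * (c - a_plus) * (c - a_minus) / c" unfolding e[symmetric] by simp
  then have ac: "a_plus \<le> c" using c by (simp add: zero_le_divide_iff zero_le_mult_iff)
  show "l \<le> lam_turn"
  proof (rule ccontr)
    assume "\<not> l \<le> lam_turn"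
    then have "c < a_plus" using cos_half_mono[of lam_turn l] assms lam_turn_bounds by (auto simp: c_def cos_half_lam_turn)
    then show False using ac by simp
  qed
  moreover have "l < lam_turn \<Longrightarrow> c > a_plus"
    using cos_half_mono[of l lam_turn] assms lam_turn_bounds by (auto simp: c_def cos_half_lam_turn)
  moreover have "L = 0 \<longleftrightarrow> c = a_plus"
  proof -
    have "L = 0 \<longleftrightarrow> (3 * L)\<^sup>2 = 0" by simp
    also have "\<dots> \<longleftrightarrow> c = a_plus" unfolding e using c by simp
    finally show ?thesis .
  qed
  ultimately show "L = 0 \<longleftrightarrow> l = lam_turn" by (cases "l < lam_turn") (auto simp: c_def cos_half_lam_turn)
qed

text \<open>The turning point is not an equilibrium: \<open>2 + 2 * cos lam_turn\<close> is the
  square of \<open>2 * a_plus\<close>, which is below 1, so its negative power exceeds 1. A solution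
  therefore cannot rest there.\<close>

lemma force_turn_nz: "- sin lam_turn * (1 - (2 + 2 * cos lam_turn) powr (- 3 / 2)) \<noteq> 0"
proof -
  have "cos lam_turn = 2 * a_plus\<^sup>2 - 1" using cos_double_cos[of "lam_turn / 2"] by (simp add: cos_half_lam_turn)
  then have e: "2 + 2 * cos lam_turn = (2 * a_plus)\<^sup>2" by (simp add: power2_eq_square)
  have "(2 * a_plus)\<^sup>2 < 1\<^sup>2" using a_plus_bounds by (intro power_strict_mono) auto
  moreover have "0 < (2 * a_plus)\<^sup>2" using a_plus_bounds by (intro zero_less_power) auto
  ultimately have "1 powr (- 3 / 2) < (2 + 2 * cos lam_turn) powr (- 3 / 2)"
    unfolding e by (intro powr_less_mono2_neg) auto
  moreover have "0 < sin lam_turn" using lam_turn_bounds by (intro sin_gt_zero) auto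
  ultimately show ?thesis by auto
qed

text \<open>In the half angle the root in \<open>V_pend\<close> becomes
  \<open>2 * cos (lam t / 2)\<close> and the \<open>powr\<close> term the inverse cube of it, so the
  derivative of the energy is rational in sine and cosine and cancels algebraically.\<close>

lemma separatrix_energy:
  fixes lam Lam :: "real \<Rightarrow> real"
  assumes ode_lam: "\<And>t. (lam has_real_derivative (- 3 * Lam t)) (at t)"
    and ode_Lam: "\<And>t. (Lam has_real_derivative
          (- sin (lam t) * (1 - (2 + 2 * cos (lam t)) powr (- 3 / 2)))) (at t)"
    and right_sep: "\<And>t. 0 < lam t \<and> lam t < pi"
  shows "H_pend (lam t) (Lam t) = H_pend (lam 0) (Lam 0)"
proof -
  define E where "E t = - (3 / 2) * (Lam t)\<^sup>2 + (2 - 2 * (cos (lam t / 2))\<^sup>2 - 1 / (2 * cos (lam t / 2)))" for t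
  have E: "H_pend (lam t) (Lam t) = E t" for t using right_sep by (simp add: H_pend_def E_def V_pend_eq)
  have "(E has_real_derivative 0) (at t)" for t
  proof -
    define c s where "c = cos (lam t / 2)" and "s = sin (lam t / 2)"
    have c: "0 < c" using cos_half_pos right_sep by (simp add: c_def)
    have "cos (lam t) = 2 * c\<^sup>2 - 1" using cos_double_cos[of "lam t / 2"] by (simp add: c_def)
    then have "2 + 2 * cos (lam t) = (2 * c) powr 2" using c by (simp add: powr_numeral power2_eq_square)
    then have "(2 + 2 * cos (lam t)) powr (- 3 / 2) = (2 * c) powr (- 3)" by (simp add: powr_powr)
    also have "\<dots> = 1 / (2 * c) ^ 3" using c by (simp add: powr_minus inverse_eq_divide)
    finally have p: "(2 + 2 * cos (lam t)) powr (- 3 / 2) = 1 / (2 * c) ^ 3" .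
    have sn: "sin (lam t) = 2 * s * c" using sin_double[of "lam t / 2"] by (simp add: c_def s_def)
    have "(E has_real_derivative - (3 / 2) * (2 * Lam t * (- sin (lam t) * (1 - (2 + 2 * cos (lam t)) powr (- 3 / 2))))
       + (0 - 2 * (2 * c * (- s * (- 3 * Lam t / 2))) - (- (2 * (- s * (- 3 * Lam t / 2))) / (2 * c)\<^sup>2))) (at t)"
      unfolding E_def using c
      by (auto intro!: derivative_eq_intros ode_lam ode_Lam simp: c_def s_def power2_eq_square)
    moreover have "- (3 / 2) * (2 * Lam t * (- sin (lam t) * (1 - (2 + 2 * cos (lam t)) powr (- 3 / 2))))
       + (0 - 2 * (2 * c * (- s * (- 3 * Lam t / 2))) - (- (2 * (- s * (- 3 * Lam t / 2))) / (2 * c)\<^sup>2)) = 0"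
      unfolding p sn using c by (simp add: field_simps power2_eq_square power3_eq_cube)
    ultimately show ?thesis by simp
  qed
  then have "E t = E 0" by (meson DERIV_const_average DERIV_isconst_all)
  then show ?thesis by (simp add: E)
qed

text \<open>Energy determines only the square of the momentum. The work lies in showing
  \<open>Lam > 0\<close> at positive times; after that \<open>T\<close> composed with
  \<open>lam\<close> has derivative 1.\<close>

lemma separatrix_time:
  fixes lam Lam :: "real \<Rightarrow> real"
  assumes ode_lam: "\<And>t. (lam has_real_derivative (- 3 * Lam t)) (at t)"
    and ode_Lam: "\<And>t. (Lam has_real_derivative
          (- sin (lam t) * (1 - (2 + 2 * cos (lam t)) powr (- 3 / 2)))) (at t)"
    and right_sep: "\<And>t. 0 < lam t \<and> lam t < pi"
    and init: "Lam 0 = 0" "H_pend (lam 0) (Lam 0) = - 1 / 2"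
    and t: "0 \<le> t"
  shows "sep_time (of_real (lam t)) = of_real t"
proof -
  have en: "H_pend (lam t) (Lam t) = - 1 / 2" for t
    using separatrix_energy[of lam Lam, OF ode_lam ode_Lam right_sep] init(2) by simp
  have le: "lam t \<le> lam_turn" and zero: "Lam t = 0 \<longleftrightarrow> lam t = lam_turn" for t
    using energy_turning[of "lam t" "Lam t"] en right_sep by auto
  have lam0: "lam 0 = lam_turn" using zero[of 0] init by simp
  have contl: "continuous_on S lam" for S
    using ode_lam DERIV_isCont continuous_at_imp_continuous_on by blast
  have contL: "continuous_on S Lam" for S
    using ode_Lam DERIV_isCont continuous_at_imp_continuous_on by blast
  \<comment> \<open>Otherwise \<open>lam\<close> starts and ends on \<open>{0..b}\<close> at its
    upper bound \<open>lam_turn\<close>. At an interior minimum \<open>Lam\<close> vanishes, which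
    forces the value \<open>lam_turn\<close> again; hence \<open>lam\<close> is constant, against
    the nonzero force.\<close>
  have ne: "lam b \<noteq> lam_turn" if "0 < b" for b
  proof
    assume b: "lam b = lam_turn"
    have "\<exists>m\<in>{0..b}. \<forall>s\<in>{0..b}. lam m \<le> lam s"
      by (rule continuous_attains_inf) (use that contl in auto)
    then obtain m where m: "m \<in> {0..b}" "\<And>s. s \<in> {0..b} \<Longrightarrow> lam m \<le> lam s" by blast
    show False
    proof (cases "lam m = lam_turn")
      case True
      then have "lam s = lam_turn" if "s \<in> {0..b}" for s using m(2)[OF that] le[of s] by simp
      then have z: "Lam s = 0" if "s \<in> {0<..<b}" for s using zero that by simp
      have h: "b / 2 \<in> {0<..<b}" using that by simp
      have "(Lam has_real_derivative 0) (at (b / 2))"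
        by (rule has_field_derivative_transform_within_open[of "\<lambda>_. 0" _ _ "{0<..<b}"]) (use z h in auto)
      then have "- sin (lam (b / 2)) * (1 - (2 + 2 * cos (lam (b / 2))) powr (- 3 / 2)) = 0"
        using ode_Lam DERIV_unique by blast
      moreover have "lam (b / 2) = lam_turn" using z[OF h] zero by simp
      ultimately show False using force_turn_nz by simp
    next
      case False
      then have "m \<noteq> 0" "m \<noteq> b" using lam0 b by auto
      then have mm: "0 < m" "m < b" using m by auto
      have "- 3 * Lam m = 0"
      proof (rule DERIV_local_min[OF ode_lam])
        show "0 < min m (b - m)" using mm by simp
        show "\<forall>y. \<bar>m - y\<bar> < min m (b - m) \<longrightarrow> lam m \<le> lam y"
        proof (intro allI impI m(2))
          fix y assume "\<bar>m - y\<bar> < min m (b - m)"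
          then show "y \<in> {0..b}" by (auto simp: abs_if split: if_splits)
        qed
      qed
      then show False using zero False by simp
    qed
  qed
  \<comment> \<open>The mean value theorem gives one earlier positive time with
    \<open>Lam > 0\<close>; a change of sign after it would produce a zero of \<open>Lam\<close>,
    excluded by \<open>ne\<close>.\<close>
  have pos: "0 < Lam b" if b0: "0 < b" for b
  proof -
    obtain x where x: "0 < x" "x < b" "lam b - lam 0 = (b - 0) * (- 3 * Lam x)"
      using MVT2[OF b0, of lam "\<lambda>t. - 3 * Lam t"] ode_lam by auto
    have "lam b < lam 0" using le[of b] ne[OF that] lam0 by simp
    then have "0 < b * (3 * Lam x)" using x by simp
    then have Lx: "0 < Lam x" using that by (simp add: zero_less_mult_iff)
    show ?thesis
    proof (rule ccontr)
      assume "\<not> 0 < Lam b"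
      then obtain y where "x \<le> y" "y \<le> b" "Lam y = 0"
        using IVT2'[of Lam b 0 x] Lx x contL by auto
      then show False using zero[of y] ne[of y] x by simp
    qed
  qed
  define G where "G s = Re (sep_time (of_real (lam s))) - s" for s
  have "G t = G 0" if "0 < t"
  proof (rule DERIV_isconst_end[where f = G])
    have lt: "lam s \<le> 2 * pi" for s using right_sep[of s] pi_gt_zero by linarith
    have "continuous_on {0..t} (\<lambda>s. sep_time (of_real (lam s)))"
      by (rule continuous_on_compose2[OF continuous_on_sep_time_real[OF order_refl] contl])
         (use right_sep lt in auto)
    then show "continuous_on {0..t} G" unfolding G_def by (intro continuous_intros)
    fix s assume s: "0 < s" "s < t"
    define c where "c = cos (lam s / 2)"
    have l: "0 < lam s" "lam s < lam_turn" using right_sep le[of s] ne[OF s(1)] by auto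
    have c: "a_plus < c" "a_minus < c" "0 < c"
      using cos_half_mono[of "lam s" lam_turn] l lam_turn_bounds a_plus_bounds a_minus_bounds
      by (auto simp: c_def cos_half_lam_turn)
    define D where "D = sqrt c / (2 * sqrt 6 * sin (lam s / 4) * sqrt (c - a_plus) * sqrt (c - a_minus))"
    have sp: "0 < sin (lam s / 4)" using l lam_turn_bounds by (intro sin_quarter_pos) auto
    have D0: "0 < D" unfolding D_def using c sp by (intro divide_pos_pos mult_pos_pos) auto
    have dt: "dtime (of_real (lam s)) = of_real (- D)"
      using dtime_real_1[of "lam s"] c by (simp add: c_def D_def)
    have sc: "2 * (sin (lam s / 4))\<^sup>2 = 1 - c" using cos_double_sin[of "lam s / 4"] by (simp add: c_def)
    have D2: "D\<^sup>2 = c / (12 * (1 - c) * (c - a_plus) * (c - a_minus))"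
      using c unfolding D_def sc[symmetric] by (simp add: power_divide power_mult_distrib)
    have "1 - c \<noteq> 0" using sc sp by auto
    then have "(D * (3 * Lam s))\<^sup>2 = 1"
      using energy_cos_half[of "lam s" "Lam s"] en right_sep c
      by (simp add: power_mult_distrib D2 c_def[symmetric])
    moreover have "0 < D * (3 * Lam s)" using D0 pos[OF s(1)] by simp
    ultimately have D1: "D * (3 * Lam s) = 1" by (simp add: power2_eq_1_iff)
    have "((\<lambda>s. Re (sep_time (of_real (lam s)))) has_real_derivative Re (dtime (of_real (lam s))) * (- 3 * Lam s)) (at s)"
      by (rule DERIV_chain2[OF DERIV_sep_time_real(1) ode_lam]) (use l lam_turn_bounds in auto)
    then have "((\<lambda>s. Re (sep_time (of_real (lam s)))) has_real_derivative 1) (at s)" using D1 by (simp add: dt)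
    then show "(G has_real_derivative 0) (at s)" unfolding G_def using DERIV_diff[OF _ DERIV_ident] by fastforce
  qed fact
  then have "G t = G 0" using t by (cases "t = 0") auto
  moreover have "G 0 = 0" by (simp add: G_def lam0 flip: turn_plus_eq)
  moreover have "Im (sep_time (of_real (lam t))) = 0" using sep_time_real_1(1)[of "lam t"] right_sep le by auto
  ultimately show ?thesis by (simp add: complex_eq_iff G_def)
qed

text \<open>Together with its counterpart on the imaginary segment this supplies the real boundary
  values on which the reflections rest.\<close>

lemma sep_inv_real:
  assumes "0 \<le> x" shows "\<exists>s. 0 < s \<and> s \<le> lam_turn \<and> sep_inv (of_real x) = of_real s"
proof -
  obtain r where r: "0 < r" "\<And>z. z \<in> half_strip \<Longrightarrow> cmod z < r \<Longrightarrow> x < Re (sep_time z)" using sep_time_pole by blast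
  define a where "a = min (r / 2) lam_turn"
  have a: "0 < a" "a < r" "a \<le> lam_turn" using r lam_turn_bounds by (auto simp: a_def)
  have "x < Re (sep_time (of_real a))"
    using a lam_turn_bounds by (intro r(2) real_in_half_strip) auto
  moreover have "continuous_on {a..lam_turn} (\<lambda>s. Re (sep_time (of_real s)))"
    using a lam_turn_bounds by (intro continuous_intros continuous_on_sep_time_real) auto
  moreover have "Re (sep_time (of_real lam_turn)) = 0" by (simp flip: turn_plus_eq)
  ultimately obtain s where s: "a \<le> s" "s \<le> lam_turn" "Re (sep_time (of_real s)) = x"
    using IVT2'[of "\<lambda>s. Re (sep_time (of_real s))" lam_turn x a] a assms by auto
  moreover have "Im (sep_time (of_real s)) = 0" using sep_time_real_1(1)[of s] s a by auto
  ultimately have "sep_inv (of_real x) = of_real s"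
    using a lam_turn_bounds assms A_strip_pos A_less_height
    by (intro sep_inv_eqI real_in_half_strip) (auto simp: complex_eq_iff quarter_def)
  then show ?thesis using s a by auto
qed

lemma sep_inv_imag:
  assumes "0 \<le> y" "y \<le> A_strip" shows "\<exists>s. lam_turn \<le> s \<and> s \<le> pi \<and> sep_inv (\<i> * of_real y) = of_real s"
proof -
  have "continuous_on {lam_turn..pi} (\<lambda>s. Im (sep_time (of_real s)))"
    using lam_turn_bounds by (intro continuous_intros continuous_on_sep_time_real) auto
  moreover have "Im (sep_time (of_real lam_turn)) = 0" by (simp flip: turn_plus_eq)
  ultimately obtain s where s: "lam_turn \<le> s" "s \<le> pi" "Im (sep_time (of_real s)) = y"
    using IVT'[of "\<lambda>s. Im (sep_time (of_real s))" lam_turn y pi] lam_turn_bounds assms by (auto simp: sep_time_pi)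
  moreover have "Re (sep_time (of_real s)) = 0" using sep_time_real_2(1)[of s] s by auto
  ultimately have "sep_inv (\<i> * of_real y) = of_real s"
    using lam_turn_bounds assms A_less_height
    by (intro sep_inv_eqI real_in_half_strip) (auto simp: complex_eq_iff quarter_def)
  then show ?thesis using s by auto
qed

section \<open>Extension by reflection to the slit strip\<close>

definition sep_ext_right :: "complex \<Rightarrow> complex" where
  "sep_ext_right t = (if 0 \<le> Im t then sep_inv t else cnj (sep_inv (cnj t)))"

text \<open>The left half is defined by evenness in \<open>t\<close>, the reversibility of the flow.
  As \<open>sep_ext_right\<close> commutes with conjugation, this is the same as Schwarz reflection
  in the imaginary axis.\<close>

definition sep_ext :: "complex \<Rightarrow> complex" where
  "sep_ext t = (if 0 \<le> Re t then sep_ext_right t else sep_ext_right (- t))"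

text \<open>Above \<open>A_strip\<close> on the imaginary axis \<open>sep_inv\<close> leaves the
  real line and enters \<open>half_strip_int\<close>, so the two reflected halves no longer match
  there; hence the slits.\<close>

definition slit_strip :: "complex set" where
  "slit_strip = {t. \<bar>Im t\<bar> < height \<and> (Re t = 0 \<longrightarrow> \<bar>Im t\<bar> < A_strip)}"

lemma cnj_sep_inv_real: "Im t = 0 \<Longrightarrow> 0 \<le> Re t \<Longrightarrow> cnj (sep_inv t) = sep_inv t"
proof -
  assume t: "Im t = 0" "0 \<le> Re t"
  then have "t = of_real (Re t)" by (simp add: complex_eq_iff)
  then show ?thesis using sep_inv_real[of "Re t"] t by (metis complex_cnj_complex_of_real)
qed

lemma cnj_sep_inv_imag: "Re t = 0 \<Longrightarrow> 0 \<le> Im t \<Longrightarrow> Im t \<le> A_strip \<Longrightarrow> cnj (sep_inv t) = sep_inv t"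
proof -
  assume t: "Re t = 0" "0 \<le> Im t" "Im t \<le> A_strip"
  then have "t = \<i> * of_real (Im t)" by (simp add: complex_eq_iff)
  then show ?thesis using sep_inv_imag[of "Im t"] t by (metis complex_cnj_complex_of_real)
qed

lemma open_slit_strip: "open slit_strip"
proof -
  have "slit_strip = {t. \<bar>Im t\<bar> < height} \<inter> ({t. Re t \<noteq> 0} \<union> {t. \<bar>Im t\<bar> < A_strip})"
    by (auto simp: slit_strip_def)
  moreover have "open \<dots>"
    by (intro open_Int open_Un open_Collect_less open_Collect_neq continuous_intros)
  ultimately show ?thesis by simp
qed

lemma sep_ext_right_cnj:
  assumes "0 \<le> Re t" shows "sep_ext_right (cnj t) = cnj (sep_ext_right t)"
proof (cases "Im t = 0")
  case True
  then have "cnj t = t" by (simp add: complex_eq_iff)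
  then show ?thesis using True assms cnj_sep_inv_real[of t] by (simp add: sep_ext_right_def)
qed (auto simp: sep_ext_right_def)

lemma sep_ext_right_minus:
  assumes "Re t = 0" "\<bar>Im t\<bar> \<le> A_strip" shows "sep_ext_right (- t) = sep_ext_right t"
proof -
  have e: "- t = cnj t" using assms by (simp add: complex_eq_iff)
  have "cnj (sep_ext_right t) = sep_ext_right t"
    using cnj_sep_inv_imag[of t] cnj_sep_inv_imag[of "cnj t"] assms by (auto simp: sep_ext_right_def)
  then show ?thesis using sep_ext_right_cnj[of t] assms e by simp
qed

lemma holomorphic_sep_ext_right: "sep_ext_right holomorphic_on {t. 0 < Re t \<and> \<bar>Im t\<bar> < height}"
  (is "_ holomorphic_on ?S")
proof -
  have "(\<lambda>z. if 0 \<le> Im z then sep_inv z else cnj (sep_inv (cnj z))) holomorphic_on ?S"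
  proof (rule Schwarz_reflection)
    show "open ?S" by (intro open_Collect_conj open_Collect_less continuous_intros)
    show "cnj ` ?S \<subseteq> ?S" by auto
    show "sep_inv holomorphic_on ?S \<inter> {z. 0 < Im z}"
      by (rule holomorphic_on_subset[OF holomorphic_sep_inv]) (auto simp: quarter_int_def)
    show "continuous_on (?S \<inter> {z. 0 \<le> Im z}) sep_inv"
      by (rule continuous_on_subset[OF continuous_on_sep_inv]) (auto simp: quarter_def)
    show "sep_inv z \<in> \<real>" if "z \<in> ?S" "z \<in> \<real>" for z
      using cnj_sep_inv_real[of z] that unfolding Reals_cnj_iff[of "sep_inv z"]
      by (simp add: complex_is_Real_iff)
  qed
  then show ?thesis unfolding sep_ext_right_def[abs_def] .
qed

lemma continuous_on_sep_ext_right: "continuous_on {t. 0 \<le> Re t \<and> \<bar>Im t\<bar> < height} sep_ext_right"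
  (is "continuous_on ?S _")
proof -
  have "continuous_on ?S (\<lambda>t. if - Im t \<le> 0 then sep_inv t else cnj (sep_inv (cnj t)))"
  proof (rule continuous_on_cases_le)
    show "continuous_on {t \<in> ?S. - Im t \<le> 0} sep_inv"
      by (rule continuous_on_subset[OF continuous_on_sep_inv]) (auto simp: quarter_def)
    show "continuous_on {t \<in> ?S. 0 \<le> - Im t} (\<lambda>t. cnj (sep_inv (cnj t)))"
      by (intro continuous_on_cnj continuous_on_compose2[OF continuous_on_sep_inv] continuous_on_id) (auto simp: quarter_def)
    show "sep_inv t = cnj (sep_inv (cnj t))" if "t \<in> ?S" "- Im t = 0" for t
    proof -
      have "cnj t = t" using that by (simp add: complex_eq_iff)
      then show ?thesis using cnj_sep_inv_real[of t] that by simp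
    qed
  qed (intro continuous_intros)
  then show ?thesis unfolding sep_ext_right_def[abs_def] by simp
qed

lemma holomorphic_sep_ext: "sep_ext holomorphic_on slit_strip"
proof (rule holomorphic_on_paste_across_line[where d = 1 and k = 0])
  have "continuous_on slit_strip (\<lambda>t. if - Re t \<le> 0 then sep_ext_right t else sep_ext_right (- t))"
  proof (rule continuous_on_cases_le)
    show "continuous_on {t \<in> slit_strip. - Re t \<le> 0} sep_ext_right"
      by (rule continuous_on_subset[OF continuous_on_sep_ext_right]) (auto simp: slit_strip_def)
    show "continuous_on {t \<in> slit_strip. 0 \<le> - Re t} (\<lambda>t. sep_ext_right (- t))"
      by (intro continuous_on_compose2[OF continuous_on_sep_ext_right] continuous_intros) (auto simp: slit_strip_def)
    show "sep_ext_right t = sep_ext_right (- t)" if "t \<in> slit_strip" "- Re t = 0" for t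
      using sep_ext_right_minus[of t] that by (auto simp: slit_strip_def)
  qed (intro continuous_intros)
  then show "continuous_on slit_strip sep_ext" unfolding sep_ext_def[abs_def] by simp
  have "sep_ext_right holomorphic_on slit_strip \<inter> {z. 0 < 1 \<bullet> z}"
    by (rule holomorphic_on_subset[OF holomorphic_sep_ext_right]) (auto simp: slit_strip_def inner_complex_def)
  then show "sep_ext holomorphic_on slit_strip \<inter> {z. 0 < 1 \<bullet> z}"
    by (rule holomorphic_transform) (auto simp: sep_ext_def inner_complex_def)
  have "(sep_ext_right \<circ> uminus) holomorphic_on slit_strip \<inter> {z. 1 \<bullet> z < 0}"
    by (rule holomorphic_on_compose_gen[OF _ holomorphic_sep_ext_right])
       (auto simp: slit_strip_def inner_complex_def intro!: holomorphic_intros)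
  then show "sep_ext holomorphic_on slit_strip \<inter> {z. 1 \<bullet> z < 0}"
    by (rule holomorphic_transform) (auto simp: sep_ext_def inner_complex_def)
qed (simp_all add: open_slit_strip)

lemma sep_ext_cnj: "sep_ext (cnj t) = cnj (sep_ext t)"
  using sep_ext_right_cnj[of t] sep_ext_right_cnj[of "- t"] by (auto simp: sep_ext_def)

lemma sep_ext_minus:
  assumes "t \<in> slit_strip" shows "sep_ext (- t) = sep_ext t"
  using sep_ext_right_minus[of t] assms by (auto simp: sep_ext_def slit_strip_def)

lemma sep_ext_quarter: "t \<in> quarter \<Longrightarrow> sep_ext t = sep_inv t"
  by (auto simp: sep_ext_def sep_ext_right_def quarter_def)

lemma of_real_in_slit_strip: "of_real x \<in> slit_strip"
  using A_strip_pos A_less_height by (simp add: slit_strip_def)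

lemma sep_ext_separatrix:
  fixes lam Lam :: "real \<Rightarrow> real"
  assumes ode_lam: "\<And>t. (lam has_real_derivative (- 3 * Lam t)) (at t)"
    and ode_Lam: "\<And>t. (Lam has_real_derivative
          (- sin (lam t) * (1 - (2 + 2 * cos (lam t)) powr (- 3 / 2)))) (at t)"
    and right_sep: "\<And>t. 0 < lam t \<and> lam t < pi"
    and init: "Lam 0 = 0" "H_pend (lam 0) (Lam 0) = - 1 / 2"
  shows "sep_ext (of_real t) = of_real (lam t)"
proof -
  have q: "of_real s \<in> quarter" if "0 \<le> s" for s :: real
    using that A_strip_pos A_less_height by (simp add: quarter_def)
  have lt: "lam s \<le> 2 * pi" for s using right_sep[of s] pi_gt_zero by linarith
  show ?thesis
  proof (cases "0 \<le> t")
    case True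
    have "sep_time (of_real (lam t)) = of_real t"
      by (rule separatrix_time[of lam Lam, OF ode_lam ode_Lam right_sep init True])
    then show ?thesis using sep_inv_eqI[of "of_real (lam t)"] q[OF True] sep_ext_quarter right_sep[of t] lt
      by (simp add: real_in_half_strip)
  next
    case False
    \<comment> \<open>Time reversal: \<open>lam (- t)\<close> and \<open>- Lam (- t)\<close> solve
      the same system with the same initial values.\<close>
    have "sep_time (of_real (lam (- (- t)))) = of_real (- t)"
    proof (rule separatrix_time[of "\<lambda>t. lam (- t)" "\<lambda>t. - Lam (- t)"])
      show "((\<lambda>t. lam (- t)) has_real_derivative - 3 * - Lam (- s)) (at s)" for s
        using DERIV_chain2[OF ode_lam DERIV_minus[OF DERIV_ident], of s] by simp
      show "((\<lambda>t. - Lam (- t)) has_real_derivative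
          - sin (lam (- s)) * (1 - (2 + 2 * cos (lam (- s))) powr (- 3 / 2))) (at s)" for s
        using DERIV_minus[OF DERIV_chain2[OF ode_Lam DERIV_minus[OF DERIV_ident], of s]] by simp
    qed (use False right_sep init in auto)
    then have "sep_inv (of_real (- t)) = of_real (lam t)"
      using False q[of "- t"] right_sep[of t] lt by (intro sep_inv_eqI) (auto simp: real_in_half_strip)
    then show ?thesis using False sep_ext_minus[OF of_real_in_slit_strip, of t] sep_ext_quarter[OF q, of "- t"] by simp
  qed
qed

section \<open>Branches of the argument and the corner\<close>

lemma br_arg_eqI:
  assumes "a \<le> \<theta>" "\<theta> < a + 2 * pi" "cis \<theta> = sgn w"
  shows "br_arg a w = \<theta>"
  unfolding br_arg_def
proof (rule the_equality)
  fix \<phi> assume \<phi>: "a \<le> \<phi> \<and> \<phi> < a + 2 * pi \<and> cis \<phi> = sgn w"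
  then have "exp (\<i> * of_real \<phi>) = exp (\<i> * of_real \<theta>)" using assms by (simp add: cis_conv_exp)
  moreover have "\<bar>Im (\<i> * of_real \<phi>) - Im (\<i> * of_real \<theta>)\<bar> < 2 * pi" using \<phi> assms by auto
  ultimately have "\<i> * complex_of_real \<phi> = \<i> * of_real \<theta>" by (rule exp_complex_eqI[rotated])
  then show "\<phi> = \<theta>" by simp
qed (use assms in auto)

lemma i_times_nonpos_Reals_iff: "\<i> * w \<in> \<real>\<^sub>\<le>\<^sub>0 \<longleftrightarrow> Re w = 0 \<and> 0 \<le> Im w"
  by (auto simp: complex_nonpos_Reals_iff)

text \<open>Multiplication by \<open>\<i>\<close> turns the positive imaginary axis, the slit of
  this branch, into the cut of \<open>Ln\<close>; the shift by \<open>pi / 2\<close> undoes the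
  rotation.\<close>

lemma br_arg_upper:
  assumes "\<i> * w \<notin> \<real>\<^sub>\<le>\<^sub>0"
  shows "br_arg (- 3 * pi / 2) w = Im (Ln (\<i> * w)) - pi / 2"
proof (rule br_arg_eqI)
  have w: "w \<noteq> 0" using assms by auto
  then have "- pi < Im (Ln (\<i> * w))" "Im (Ln (\<i> * w)) \<le> pi" by (auto simp: mpi_less_Im_Ln Im_Ln_le_pi)
  then show "- 3 * pi / 2 \<le> Im (Ln (\<i> * w)) - pi / 2" "Im (Ln (\<i> * w)) - pi / 2 < - 3 * pi / 2 + 2 * pi"
    using assms w Im_Ln_eq_pi[of "\<i> * w"] by (auto simp: i_times_nonpos_Reals_iff order_less_le)
  have "exp (Ln (\<i> * w)) = \<i> * w" using w by simp
  then have "of_real (cmod w) * cis (Im (Ln (\<i> * w))) = \<i> * w" using w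
    by (simp add: exp_eq_polar Re_Ln norm_mult exp_of_real)
  then have "cis (Im (Ln (\<i> * w))) = \<i> * sgn w" using w by (simp add: sgn_eq field_simps)
  then show "cis (Im (Ln (\<i> * w)) - pi / 2) = sgn w" by (simp add: cis_divide[symmetric])
qed

text \<open>On the slit the argument takes the included lower end of its range, so the strict
  inequality in \<open>slit_disc\<close> removes exactly the slit.\<close>

lemma br_arg_upper_slit:
  assumes "\<i> * w \<in> \<real>\<^sub>\<le>\<^sub>0" "w \<noteq> 0"
  shows "br_arg (- 3 * pi / 2) w = - 3 * pi / 2"
proof (rule br_arg_eqI)
  have "w = \<i> * of_real (cmod w)"
    using assms by (auto simp: i_times_nonpos_Reals_iff complex_eq_iff cmod_def)
  then have "sgn w = \<i>" using assms(2) by (metis nonzero_mult_div_cancel_right norm_eq_zero of_real_eq_0_iff sgn_eq)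
  moreover have "cis (- 3 * pi / 2) = \<i>"
  proof -
    have "cis (- 3 * pi / 2) = cis (pi / 2 + - (2 * pi))" by (rule arg_cong[where f = cis]) simp
    also have "\<dots> = cis (pi / 2) * cis (- (2 * pi))" by (simp only: cis_mult)
    also have "cis (- (2 * pi)) = 1" by (simp add: complex_eq_iff)
    finally show ?thesis by simp
  qed
  ultimately show "cis (- 3 * pi / 2) = sgn w" by simp
qed auto

lemma slit_disc_upper: "slit_disc z r (- 3 * pi / 2) = {t. cmod (t - z) < r \<and> \<i> * (t - z) \<notin> \<real>\<^sub>\<le>\<^sub>0}"
proof -
  have "t \<noteq> z \<and> - 3 * pi / 2 < br_arg (- 3 * pi / 2) (t - z) \<longleftrightarrow> \<i> * (t - z) \<notin> \<real>\<^sub>\<le>\<^sub>0" for t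
  proof (cases "\<i> * (t - z) \<in> \<real>\<^sub>\<le>\<^sub>0")
    case True
    then show ?thesis using br_arg_upper_slit[of "t - z"] by (cases "t = z") auto
  next
    case False
    then have "t \<noteq> z" by auto
    then show ?thesis using br_arg_upper[OF False] False mpi_less_Im_Ln[of "\<i> * (t - z)"] by auto
  qed
  then show ?thesis unfolding slit_disc_def by blast
qed

lemma br_pow_upper:
  assumes "\<i> * w \<notin> \<real>\<^sub>\<le>\<^sub>0"
  shows "br_pow (- 3 * pi / 2) w p = exp (of_real p * (Ln (\<i> * w) - \<i> * of_real (pi / 2)))"
proof -
  have w: "w \<noteq> 0" using assms by auto
  then have "Re (Ln (\<i> * w)) = ln (cmod w)" by (simp add: norm_mult)
  then have "Ln (\<i> * w) = of_real (ln (cmod w)) + \<i> * of_real (Im (Ln (\<i> * w)))"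
    by (simp add: complex_eq_iff)
  then show ?thesis using w unfolding br_pow_def br_arg_upper[OF assms] by (simp add: algebra_simps)
qed

text \<open>Conjugation negates arguments and carries the open window from -3 pi / 2 to pi / 2 onto
  the one from - pi / 2 to 3 pi / 2; off the slit the endpoints do not occur.\<close>

lemma br_arg_cnj:
  assumes "\<i> * w \<notin> \<real>\<^sub>\<le>\<^sub>0"
  shows "br_arg (- pi / 2) (cnj w) = - br_arg (- 3 * pi / 2) w"
proof (rule br_arg_eqI)
  have w: "w \<noteq> 0" using assms by auto
  have "- pi < Im (Ln (\<i> * w))" "Im (Ln (\<i> * w)) \<le> pi" using w by (auto simp: mpi_less_Im_Ln Im_Ln_le_pi)
  then show "- pi / 2 \<le> - br_arg (- 3 * pi / 2) w" "- br_arg (- 3 * pi / 2) w < - pi / 2 + 2 * pi"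
    unfolding br_arg_upper[OF assms] by auto
  have "exp (Ln (\<i> * w)) = \<i> * w" using w by simp
  then have "of_real (cmod w) * cis (Im (Ln (\<i> * w))) = \<i> * w" using w
    by (simp add: exp_eq_polar Re_Ln norm_mult exp_of_real)
  then have "cis (Im (Ln (\<i> * w))) = \<i> * sgn w" using w by (simp add: sgn_eq field_simps)
  then have "cis (br_arg (- 3 * pi / 2) w) = sgn w" unfolding br_arg_upper[OF assms] by (simp add: cis_divide[symmetric])
  then show "cis (- br_arg (- 3 * pi / 2) w) = sgn (cnj w)" by (simp add: cis_cnj[symmetric] sgn_eq)
qed

lemma br_pow_cnj:
  assumes "\<i> * w \<notin> \<real>\<^sub>\<le>\<^sub>0"
  shows "br_pow (- pi / 2) (cnj w) p = cnj (br_pow (- 3 * pi / 2) w p)"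
  unfolding br_pow_def br_arg_cnj[OF assms] by (simp add: exp_cnj)

lemma slit_disc_lower:
  assumes "t \<in> slit_disc (cnj z) r (- pi / 2)" shows "cnj t \<in> slit_disc z r (- 3 * pi / 2)"
proof -
  have t: "t \<noteq> cnj z" "cmod (t - cnj z) < r" "- pi / 2 < br_arg (- pi / 2) (t - cnj z)"
    using assms by (auto simp: slit_disc_def)
  have "\<i> * (cnj t - z) \<notin> \<real>\<^sub>\<le>\<^sub>0"
  proof
    assume "\<i> * (cnj t - z) \<in> \<real>\<^sub>\<le>\<^sub>0"
    then have *: "Re (t - cnj z) = 0" "Im (t - cnj z) \<le> 0" by (auto simp: i_times_nonpos_Reals_iff)
    then have "t - cnj z = - \<i> * of_real (cmod (t - cnj z))" by (auto simp: complex_eq_iff cmod_def)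
    then have "sgn (t - cnj z) = - \<i>" using t(1)
      by (metis nonzero_mult_div_cancel_right norm_eq_zero of_real_eq_0_iff right_minus_eq sgn_eq)
    then have "br_arg (- pi / 2) (t - cnj z) = - pi / 2"
      by (intro br_arg_eqI) (auto simp: complex_eq_iff)
    then show False using t by simp
  qed
  moreover have "cmod (cnj t - z) = cmod (t - cnj z)" by (metis complex_cnj_cnj complex_cnj_diff complex_mod_cnj)
  ultimately show ?thesis using t unfolding slit_disc_upper by simp
qed

lemma slit_disc_upper_lower:
  assumes "t \<in> slit_disc z r (- 3 * pi / 2)" shows "cnj t \<in> slit_disc (cnj z) r (- pi / 2)"
proof -
  have t: "cmod (t - z) < r" "\<i> * (t - z) \<notin> \<real>\<^sub>\<le>\<^sub>0" using assms unfolding slit_disc_upper by auto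
  have "t \<noteq> z" using t by auto
  moreover have "- pi / 2 < br_arg (- pi / 2) (cnj (t - z))"
    using br_arg_cnj[OF t(2)] br_arg_upper[OF t(2)] t(2) \<open>t \<noteq> z\<close> Im_Ln_le_pi[of "\<i> * (t - z)"] Im_Ln_eq_pi[of "\<i> * (t - z)"]
    by (auto simp: i_times_nonpos_Reals_iff order_less_le)
  moreover have "cmod (cnj t - cnj z) = cmod (t - z)" by (metis complex_cnj_diff complex_mod_cnj)
  ultimately show ?thesis using t by (simp add: slit_disc_def)
qed

lemma open_slit_disc_upper: "open (slit_disc z r (- 3 * pi / 2))"
proof -
  have "slit_disc z r (- 3 * pi / 2) = ball z r \<inter> (\<lambda>t. \<i> * (t - z)) -` (- \<real>\<^sub>\<le>\<^sub>0)"
    unfolding slit_disc_upper by (auto simp: dist_norm norm_minus_commute)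
  moreover have "open ((\<lambda>t. \<i> * (t - z)) -` (- \<real>\<^sub>\<le>\<^sub>0))"
    by (intro continuous_open_vimage open_Compl closed_nonpos_Reals_complex) (auto intro!: continuous_intros)
  ultimately show ?thesis by auto
qed

text \<open>In logarithmic polar coordinates around \<open>z\<close> the slit disc is a convex
  half-strip.\<close>

lemma connected_slit_disc_upper: "connected (slit_disc z r (- 3 * pi / 2))"
proof (cases "r > 0")
  case True
  let ?R = "{s. Re s < ln r} \<inter> {s. - pi < Im s} \<inter> {s. Im s < pi}"
  have "slit_disc z r (- 3 * pi / 2) = (\<lambda>s. z - \<i> * exp s) ` ?R"
  proof (intro set_eqI iffI)
    fix t assume "t \<in> slit_disc z r (- 3 * pi / 2)"
    then have t: "cmod (t - z) < r" "\<i> * (t - z) \<notin> \<real>\<^sub>\<le>\<^sub>0" unfolding slit_disc_upper by auto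
    then have tz: "t \<noteq> z" by auto
    let ?s = "Ln (\<i> * (t - z))"
    have "Im ?s \<noteq> pi" using Im_Ln_eq_pi[of "\<i> * (t - z)"] t tz by (auto simp: complex_nonpos_Reals_iff)
    then have "?s \<in> ?R" using t tz mpi_less_Im_Ln[of "\<i> * (t - z)"] Im_Ln_le_pi[of "\<i> * (t - z)"] True
      by (auto simp: Re_Ln norm_mult)
    moreover have "t = z - \<i> * exp ?s" using tz by (simp add: algebra_simps)
    ultimately show "t \<in> (\<lambda>s. z - \<i> * exp s) ` ?R" by blast
  next
    fix t assume "t \<in> (\<lambda>s. z - \<i> * exp s) ` ?R"
    then obtain s where s: "s \<in> ?R" "t = z - \<i> * exp s" by blast
    then have "t - z = - (\<i> * exp s)" by simp
    then have e: "\<i> * (t - z) = exp s" by (simp only: mult_minus_right mult.assoc[symmetric] i_squared) simp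
    have "exp s \<notin> \<real>\<^sub>\<le>\<^sub>0"
    proof
      define v where "v = exp s"
      assume "exp s \<in> \<real>\<^sub>\<le>\<^sub>0"
      then have "Re v \<le> 0" "Im v = 0" by (simp_all only: v_def complex_nonpos_Reals_iff)
      moreover have v0: "v \<noteq> 0" by (simp add: v_def)
      ultimately have "Re v < 0 \<and> Im v = 0" by (auto simp: complex_eq_iff order_less_le)
      then have "Im (Ln v) = pi" using Im_Ln_eq_pi[OF v0] by blast
      moreover have "Ln v = s" unfolding v_def using s by (intro Ln_exp) auto
      ultimately show False using s by auto
    qed
    moreover have "cmod (t - z) < r"
    proof -
      have "cmod (t - z) = exp (Re s)" using s by (simp add: norm_mult)
      also have "\<dots> < exp (ln r)" using s by (simp only: exp_less_cancel_iff) simp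
      finally show ?thesis using True by simp
    qed
    ultimately show "t \<in> slit_disc z r (- 3 * pi / 2)" unfolding slit_disc_upper by (simp add: e)
  qed
  moreover have "convex ?R"
    by (intro convex_Int convex_halfspace_Re_lt convex_halfspace_Im_lt convex_halfspace_Im_gt)
  then have "connected ((\<lambda>s. z - \<i> * exp s) ` ?R)"
    by (intro connected_continuous_image continuous_intros convex_connected)
  ultimately show ?thesis by simp
next
  case False
  then have "\<not> cmod (t - z) < r" for t using norm_ge_zero[of "t - z"] by linarith
  then have "slit_disc z r (- 3 * pi / 2) = {}" by (simp add: slit_disc_def)
  then show ?thesis by simp
qed

text \<open>If the exponents differed, cancelling the smaller power would leave a positive power of
  \<open>z\<close> on one side, so one of the nonzero limits would be 0.\<close>

lemma power_factor_unique:
  fixes P Q :: "complex \<Rightarrow> complex"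
  assumes ev: "\<forall>\<^sub>F z in at 0. z ^ a * P z = z ^ b * Q z"
    and P: "P \<midarrow>0\<rightarrow> p" "p \<noteq> 0" and Q: "Q \<midarrow>0\<rightarrow> q" "q \<noteq> 0"
  shows "a = b" "p = q"
proof -
  have aux: "d = 0" if "\<forall>\<^sub>F z in at 0. F z = z ^ d * G z" "F \<midarrow>0\<rightarrow> f" "f \<noteq> 0" "G \<midarrow>0\<rightarrow> g"
    for F G :: "complex \<Rightarrow> complex" and f g d
  proof (rule ccontr)
    assume d: "d \<noteq> 0"
    have "(\<lambda>z. z ^ d * G z) \<midarrow>0\<rightarrow> 0 ^ d * g" by (intro tendsto_intros that)
    moreover have "(\<lambda>z. z ^ d * G z) \<midarrow>0\<rightarrow> f" using Lim_transform_eventually[OF that(2,1)] .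
    ultimately have "f = 0 ^ d * g" by (meson LIM_unique)
    then show False using d that by simp
  qed
  have ne: "\<forall>\<^sub>F z::complex in at 0. z \<noteq> 0" by (simp add: eventually_at_filter)
  show ab: "a = b"
  proof (cases "a \<le> b")
    case True
    have "\<forall>\<^sub>F z in at 0. P z = z ^ (b - a) * Q z"
      using ev ne
    proof eventually_elim
      case (elim z)
      have "z ^ b = z ^ a * z ^ (b - a)" using True by (simp flip: power_add)
      then have "z ^ a * P z = z ^ a * (z ^ (b - a) * Q z)" by (metis elim(1) mult.assoc)
      then show ?case using elim(2) by (simp only: mult_cancel_left power_eq_0_iff) simp
    qed
    from aux[OF this P Q(1)] show ?thesis using True by simp
  next
    case False
    have "\<forall>\<^sub>F z in at 0. Q z = z ^ (a - b) * P z"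
      using ev ne
    proof eventually_elim
      case (elim z)
      have "z ^ a = z ^ b * z ^ (a - b)" using False by (simp flip: power_add)
      then have "z ^ b * Q z = z ^ b * (z ^ (a - b) * P z)" by (metis elim(1) mult.assoc)
      then show ?case using elim(2) by (simp only: mult_cancel_left power_eq_0_iff) simp
    qed
    from aux[OF this Q P(1)] show ?thesis using False by simp
  qed
  have "\<forall>\<^sub>F z in at 0. P z = Q z" using ev ne by eventually_elim (simp add: ab)
  from Lim_transform_eventually[OF P(1) this] Q(1) show "p = q" by (meson LIM_unique)
qed

section \<open>The squared time at the reentrant corner\<close>

definition corner_rad :: real where "corner_rad = pi - lam_turn"

lemma corner_rad_pos: "0 < corner_rad" using lam_turn_bounds by (simp add: corner_rad_def)

definition corner_sq :: "complex \<Rightarrow> complex" where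
  "corner_sq \<zeta> = (sep_time (of_real pi - \<zeta>) - \<i> * of_real A_strip)\<^sup>2"

definition corner_fun :: "complex \<Rightarrow> complex" where
  "corner_fun \<zeta> = (if 0 \<le> Im \<zeta> then corner_sq \<zeta> else cnj (corner_sq (cnj \<zeta>)))"

lemma corner_in:
  assumes "cmod \<zeta> < corner_rad" "0 \<le> Im \<zeta>"
  shows "of_real pi - \<zeta> \<in> half_strip" "0 < Im \<zeta> \<Longrightarrow> of_real pi - \<zeta> \<in> half_strip_int"
  using assms abs_Re_le_cmod[of \<zeta>] lam_turn_bounds
  by (auto simp: half_strip_int_def corner_rad_def intro!: half_strip_I)

text \<open>The radius keeps \<open>pi - \<zeta>\<close> above \<open>lam_turn\<close>. On this
  range \<open>T - \<i> * A_strip\<close> is imaginary up to \<open>pi\<close> and real beyond it,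
  so in both cases its square is real.\<close>

lemma corner_sq_real:
  assumes "cmod \<zeta> < corner_rad" "Im \<zeta> = 0"
  shows "cnj (corner_sq \<zeta>) = corner_sq \<zeta>"
proof -
  define x where "x = pi - Re \<zeta>"
  have e: "of_real pi - \<zeta> = of_real x" using assms by (simp add: x_def complex_eq_iff)
  have x: "lam_turn \<le> x" "x \<le> 2 * pi"
    using assms abs_Re_le_cmod[of \<zeta>] lam_turn_bounds by (auto simp: x_def corner_rad_def)
  have "Re (sep_time (of_real x)) = 0 \<or> Im (sep_time (of_real x)) = A_strip"
    using sep_time_real_2(1)[of x] sep_time_real_3(1)[of x] x by (cases "x \<le> pi") (auto simp: sep_time_pi)
  then show ?thesis unfolding corner_sq_def e by (auto simp: complex_eq_iff power2_eq_square algebra_simps)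
qed

lemma corner_fun_cnj:
  assumes "cmod \<zeta> < corner_rad" shows "corner_fun (cnj \<zeta>) = cnj (corner_fun \<zeta>)"
proof (cases "Im \<zeta> = 0")
  case True
  then have "cnj \<zeta> = \<zeta>" by (simp add: complex_eq_iff)
  then show ?thesis using corner_sq_real[OF assms True] True by (simp add: corner_fun_def)
qed (auto simp: corner_fun_def)

lemma DERIV_corner_sq:
  assumes "cmod \<zeta> < corner_rad" "0 < Im \<zeta>"
  shows "(corner_sq has_field_derivative
     - 2 * (sep_time (of_real pi - \<zeta>) - \<i> * of_real A_strip) * dtime (of_real pi - \<zeta>)) (at \<zeta>)"
proof -
  have "((\<lambda>\<zeta>. of_real pi - \<zeta>) has_field_derivative - 1) (at \<zeta>)"
    by (auto intro!: derivative_eq_intros)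
  from DERIV_chain2[OF DERIV_sep_time_int[OF corner_in(2)[OF assms(1) less_imp_le[OF assms(2)] assms(2)]] this]
  have "((\<lambda>\<zeta>. sep_time (of_real pi - \<zeta>)) has_field_derivative dtime (of_real pi - \<zeta>) * - 1) (at \<zeta>)" .
  then show ?thesis unfolding corner_sq_def[abs_def]
    by (auto intro!: derivative_eq_intros simp: algebra_simps)
qed

lemma holomorphic_corner_fun: "corner_fun holomorphic_on ball 0 corner_rad"
proof -
  have "(\<lambda>z. if 0 \<le> Im z then corner_sq z else cnj (corner_sq (cnj z))) holomorphic_on ball 0 corner_rad"
  proof (rule Schwarz_reflection)
    show "cnj ` ball 0 corner_rad \<subseteq> ball 0 corner_rad" by auto
    have "open (ball 0 corner_rad \<inter> {z. 0 < Im z})"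
      by (intro open_Int open_ball open_halfspace_Im_gt)
    then show "corner_sq holomorphic_on ball 0 corner_rad \<inter> {z. 0 < Im z}"
      by (subst holomorphic_on_open) (auto intro!: exI DERIV_corner_sq)
    show "continuous_on (ball 0 corner_rad \<inter> {z. 0 \<le> Im z}) corner_sq"
      unfolding corner_sq_def[abs_def]
      by (intro continuous_intros continuous_on_compose2[OF continuous_on_sep_time]) (auto intro: corner_in)
    show "corner_sq z \<in> \<real>" if "z \<in> ball 0 corner_rad" "z \<in> \<real>" for z
      using corner_sq_real[of z] that unfolding Reals_cnj_iff[of "corner_sq z"]
      by (auto simp: complex_is_Real_iff)
  qed auto
  then show ?thesis unfolding corner_fun_def[abs_def] .
qed

lemma corner_fun_0: "corner_fun 0 = 0"
  by (simp add: corner_fun_def corner_sq_def sep_time_pi)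

text \<open>A constant would have to be 0, but \<open>T\<close> moves strictly along the imaginary
  axis just before \<open>pi\<close>.\<close>

lemma corner_fun_nonconst: "\<not> corner_fun constant_on ball 0 corner_rad"
proof
  assume "corner_fun constant_on ball 0 corner_rad"
  then have "corner_fun (of_real (corner_rad / 2)) = corner_fun 0"
    using corner_rad_pos by (auto simp: constant_on_def)
  then have "sep_time (of_real pi - of_real (corner_rad / 2)) = \<i> * of_real A_strip"
    by (simp add: corner_fun_0) (simp add: corner_fun_def corner_sq_def)
  then have "sep_time (of_real (pi - corner_rad / 2)) = sep_time (of_real pi)" by (simp add: sep_time_pi)
  moreover have "Im (sep_time (of_real (pi - corner_rad / 2))) < Im (sep_time (of_real pi))"
    using corner_rad_pos lam_turn_bounds by (intro sep_time_real_2(2)) (auto simp: corner_rad_def field_simps)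
  ultimately show False by simp
qed

definition corner_den :: "complex \<Rightarrow> complex" where
  "corner_den \<zeta> = 24 * (sin ((of_real pi - \<zeta>) / 4))\<^sup>2 * (sin (\<zeta> / 2) - of_real a_plus) * (sin (\<zeta> / 2) - of_real a_minus)"

text \<open>Squaring removes every choice of branch and leaves an expression that is meromorphic on
  both sides of the real axis. The zero at the collision comes from
  \<open>q = sin (\<zeta> / 2)\<close>.\<close>

lemma dtime_corner_sq: "(dtime (of_real pi - \<zeta>))\<^sup>2 = sin (\<zeta> / 2) / corner_den \<zeta>"
proof -
  have "hcos (of_real pi - \<zeta>) = sin (\<zeta> / 2)"
    using cos_sin_eq[of "\<zeta> / 2"] sin_cos_eq[of "\<zeta> / 2"] by (simp add: hcos_def diff_divide_distrib)
  then show ?thesis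
    by (simp add: dtime_def corner_den_def power_divide power_mult_distrib flip: of_real_power)
qed

lemma corner_den_0: "corner_den 0 = - 3"
proof -
  have "sin (complex_of_real pi / 4) = of_real (sqrt 2 / 2)"
    using sin_of_real[of "pi / 4", where 'a = complex] by (simp add: sin_45)
  then have "(sin (complex_of_real pi / 4))\<^sup>2 = of_real ((sqrt 2 / 2)\<^sup>2)" by (simp only: of_real_power)
  then have "(sin (complex_of_real pi / 4))\<^sup>2 = 1 / 2" by (simp add: power_divide)
  moreover have "corner_den 0 = 24 * (sin (complex_of_real pi / 4))\<^sup>2 * of_real (a_plus * a_minus)"
    by (simp add: corner_den_def)
  ultimately show ?thesis by (simp only: a_plus_minus) simp
qed

lemma holomorphic_corner_den: "corner_den holomorphic_on S"
  unfolding corner_den_def[abs_def] by (intro holomorphic_intros) auto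

text \<open>In the upper half of the disc the chain rule gives
  \<open>F' = - 2 * (T - \<i> * A) * dtime\<close>. Squared, this involves only functions
  holomorphic on a whole disc, and the identity theorem carries it over.\<close>

lemma corner_fun_ode:
  "\<exists>r>0. r \<le> corner_rad \<and> (\<forall>\<zeta>\<in>ball 0 r. corner_den \<zeta> \<noteq> 0 \<and>
     (deriv corner_fun \<zeta>)\<^sup>2 = 4 * corner_fun \<zeta> * (sin (\<zeta> / 2) / corner_den \<zeta>))"
proof -
  have "continuous_on UNIV corner_den" by (intro holomorphic_on_imp_continuous_on holomorphic_corner_den)
  then have "isCont corner_den 0" by (simp add: continuous_on_eq_continuous_at)
  then have "\<exists>e>0. \<forall>y. dist 0 y < e \<longrightarrow> corner_den y \<noteq> 0" by (intro continuous_at_avoid) (auto simp: corner_den_0)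
  then obtain e where e: "0 < e" "\<And>\<zeta>. cmod \<zeta> < e \<Longrightarrow> corner_den \<zeta> \<noteq> 0" by auto
  define r where "r = min e corner_rad"
  have r: "0 < r" "r \<le> corner_rad" "\<And>\<zeta>. cmod \<zeta> < r \<Longrightarrow> corner_den \<zeta> \<noteq> 0"
    using e corner_rad_pos by (auto simp: r_def)
  have "(deriv corner_fun \<zeta>)\<^sup>2 = 4 * corner_fun \<zeta> * (sin (\<zeta> / 2) / corner_den \<zeta>)" if z: "\<zeta> \<in> ball 0 r" for \<zeta>
  proof (rule analytic_continuation_open[where s = "ball 0 r \<inter> {z. 0 < Im z}" and s' = "ball 0 r"
        and f = "\<lambda>\<zeta>. (deriv corner_fun \<zeta>)\<^sup>2" and g = "\<lambda>\<zeta>. 4 * corner_fun \<zeta> * (sin (\<zeta> / 2) / corner_den \<zeta>)"])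
    show op: "open (ball 0 r \<inter> {z. 0 < Im z})" by (intro open_Int open_ball open_halfspace_Im_gt)
    have "\<i> * of_real (r / 2) \<in> ball 0 r \<inter> {z. 0 < Im z}" using r by (simp add: norm_mult)
    then show "ball 0 r \<inter> {z. 0 < Im z} \<noteq> {}" by blast
    have hF: "corner_fun holomorphic_on ball 0 r" using r by (intro holomorphic_on_subset[OF holomorphic_corner_fun]) auto
    then show "(\<lambda>\<zeta>. (deriv corner_fun \<zeta>)\<^sup>2) holomorphic_on ball 0 r"
      by (intro holomorphic_intros holomorphic_deriv) auto
    show "(\<lambda>\<zeta>. 4 * corner_fun \<zeta> * (sin (\<zeta> / 2) / corner_den \<zeta>)) holomorphic_on ball 0 r"
      using r by (intro holomorphic_intros hF holomorphic_corner_den) auto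
    fix w assume w: "w \<in> ball 0 r \<inter> {z. 0 < Im z}"
    then have w': "cmod w < corner_rad" "0 < Im w" using r by auto
    have "(corner_fun has_field_derivative
       - 2 * (sep_time (of_real pi - w) - \<i> * of_real A_strip) * dtime (of_real pi - w)) (at w)"
      by (rule has_field_derivative_transform_within_open[OF DERIV_corner_sq[OF w'] op w]) (auto simp: corner_fun_def)
    then have "deriv corner_fun w = - 2 * (sep_time (of_real pi - w) - \<i> * of_real A_strip) * dtime (of_real pi - w)"
      by (rule DERIV_imp_deriv)
    then have "(deriv corner_fun w)\<^sup>2 = 4 * corner_sq w * (dtime (of_real pi - w))\<^sup>2"
      by (simp only: power_mult_distrib corner_sq_def) simp
    then show "(deriv corner_fun w)\<^sup>2 = 4 * corner_fun w * (sin (w / 2) / corner_den w)"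
      using w' by (simp add: dtime_corner_sq corner_fun_def)
  qed (use z in auto)
  then show ?thesis using r by (intro exI[of _ r]) auto
qed

text \<open>The order of vanishing and the leading coefficient are forced by the equation
  \<open>F'\<^sup>2 = 4 * F * k\<close>, where \<open>k\<close> has a simple zero at 0 with slope \<open>- 1 / 6\<close>.\<close>

lemma corner_fun_factor:
  "\<exists>r>0. \<exists>g. r \<le> corner_rad \<and> g holomorphic_on ball 0 r \<and> g 0 = - (2 / 27) \<and>
     (\<forall>\<zeta>\<in>ball 0 r. corner_fun \<zeta> = \<zeta> ^ 3 * g \<zeta> \<and> g \<zeta> \<noteq> 0)"
proof -
  have 0: "0 \<in> ball 0 corner_rad" using corner_rad_pos by simp
  obtain g r n where n: "0 < n" and r: "0 < r" "ball (0 :: complex) r \<subseteq> ball 0 corner_rad"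
    and g: "g holomorphic_on ball 0 r" "\<And>w. w \<in> ball 0 r \<Longrightarrow> corner_fun w = (w - 0) ^ n * g w"
      "\<And>w. w \<in> ball 0 r \<Longrightarrow> g w \<noteq> 0"
    by (rule holomorphic_factor_zero_nonconstant[OF holomorphic_corner_fun open_ball connected_ball 0
          corner_fun_0 corner_fun_nonconst]) (rule that; assumption)
  obtain r1 where r1: "0 < r1" and ode: "\<And>\<zeta>. \<zeta> \<in> ball 0 r1 \<Longrightarrow> corner_den \<zeta> \<noteq> 0 \<and>
     (deriv corner_fun \<zeta>)\<^sup>2 = 4 * corner_fun \<zeta> * (sin (\<zeta> / 2) / corner_den \<zeta>)"
    using corner_fun_ode by auto
  have dg: "(g has_field_derivative deriv g w) (at w)" if "w \<in> ball 0 r" for w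
    using g(1) that by (simp add: holomorphic_derivI)
  have dF: "deriv corner_fun w = w ^ (n - 1) * (of_nat n * g w + w * deriv g w)" if "w \<in> ball 0 r" for w
  proof (rule DERIV_imp_deriv, rule has_field_derivative_transform_within_open[of "\<lambda>w. w ^ n * g w" _ _ "ball 0 r"])
    have "w ^ n = w ^ (n - 1) * w" using n by (cases n) auto
    then show "((\<lambda>w. w ^ n * g w) has_field_derivative w ^ (n - 1) * (of_nat n * g w + w * deriv g w)) (at w)"
      by (auto intro!: derivative_eq_intros dg[OF that] simp: algebra_simps)
  qed (use that g in auto)
  define P where "P w = (of_nat n * g w + w * deriv g w)\<^sup>2" for w
  define Q where "Q w = 4 * g w * ((sin (w / 2) / w) / corner_den w)" for w
  have ev: "\<forall>\<^sub>F w in at 0. w ^ (2 * (n - 1)) * P w = w ^ (n + 1) * Q w"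
    unfolding eventually_at
  proof (intro exI[of _ "min r r1"] conjI ballI impI)
    fix w :: complex assume w: "w \<noteq> 0 \<and> dist w 0 < min r r1"
    then have "(deriv corner_fun w)\<^sup>2 = 4 * corner_fun w * (sin (w / 2) / corner_den w)" using ode[of w] by auto
    then show "w ^ (2 * (n - 1)) * P w = w ^ (n + 1) * Q w"
      using w by (simp add: dF g(2) P_def Q_def power_mult_distrib power_even_eq)
  qed (use r r1 in auto)
  have c: "g \<midarrow>0\<rightarrow> g 0" "deriv g \<midarrow>0\<rightarrow> deriv g 0"
  proof -
    have "isCont f 0" if "f holomorphic_on ball 0 r" for f :: "complex \<Rightarrow> complex"
      using holomorphic_on_imp_continuous_on[OF that] r by (simp add: continuous_on_eq_continuous_at)
    then show "g \<midarrow>0\<rightarrow> g 0" "deriv g \<midarrow>0\<rightarrow> deriv g 0"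
      using g(1) holomorphic_deriv[OF g(1) open_ball] by (auto intro: isContD)
  qed
  have d: "corner_den \<midarrow>0\<rightarrow> - 3"
    using holomorphic_on_imp_continuous_on[OF holomorphic_corner_den[of UNIV]] corner_den_0
    by (metis UNIV_I continuous_on_eq_continuous_at isContD open_UNIV)
  have s: "(\<lambda>w. sin (w / 2) / w) \<midarrow>0\<rightarrow> (1 / 2 :: complex)"
  proof -
    have "((\<lambda>w. sin (w / 2)) has_field_derivative (1 / 2 :: complex)) (at 0)"
      by (auto intro!: derivative_eq_intros)
    then show ?thesis by (simp add: has_field_derivative_iff)
  qed
  have P: "P \<midarrow>0\<rightarrow> (of_nat n * g 0 + 0 * deriv g 0)\<^sup>2" unfolding P_def by (intro tendsto_intros c)
  have Q: "Q \<midarrow>0\<rightarrow> 4 * g 0 * (1 / 2 / - 3)" unfolding Q_def by (intro tendsto_intros c s d) simp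
  have g0: "g 0 \<noteq> 0" using g(3) r by simp
  \<comment> \<open>Comparing orders gives \<open>n = 3\<close>, comparing leading coefficients
    \<open>9 * g 0 = - 2 / 3\<close>.\<close>
  have "2 * (n - 1) = n + 1" "(of_nat n * g 0 + 0 * deriv g 0)\<^sup>2 = 4 * g 0 * (1 / 2 / - 3)"
    using power_factor_unique[OF ev P _ Q] g0 n by auto
  moreover from this have n3: "n = 3" by simp
  ultimately have "(3 * g 0)\<^sup>2 = 4 * g 0 * (1 / 2 / - 3)" by simp
  then have "g 0 * (9 * g 0 + 2 / 3) = 0" by (simp add: power2_eq_square algebra_simps)
  then have eq: "9 * g 0 + 2 / 3 = 0" using g0 mult_eq_0_iff by blast
  have "g 0 = (9 * g 0 + 2 / 3) / 9 - 2 / 27" by (simp add: field_simps)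
  then have "g 0 = - (2 / 27)" unfolding eq by simp
  then show ?thesis using r g n3 corner_rad_pos by (intro exI[of _ r] exI[of _ g]) (auto simp: ball_subset_ball_iff)
qed

section \<open>Local inversion and the expansions\<close>

lemma holomorphic_second_order:
  assumes V: "V holomorphic_on ball 0 e" and e: "0 < e"
  obtains C where "0 \<le> C"
    "\<And>x. cmod x \<le> e / 2 \<Longrightarrow> cmod (deriv V x - deriv V 0) \<le> C * cmod x"
    "\<And>x. cmod x \<le> e / 2 \<Longrightarrow> cmod (V x - V 0 - deriv V 0 * x) \<le> C * (cmod x)\<^sup>2"
proof -
  have V': "deriv V holomorphic_on ball 0 e" by (intro holomorphic_deriv V open_ball)
  have V'': "deriv (deriv V) holomorphic_on ball 0 e" by (intro holomorphic_deriv V' open_ball)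
  \<comment> \<open>One bound for the second derivative serves both estimates: the mean value
    inequality is applied to \<open>deriv V\<close>, and then to \<open>V\<close> minus its linear
    part.\<close>
  have "bounded (deriv (deriv V) ` cball 0 (e / 2))"
    using e by (intro compact_imp_bounded compact_continuous_image compact_cball
      continuous_on_subset[OF holomorphic_on_imp_continuous_on[OF V'']]) auto
  then obtain C where "0 < C" "\<forall>y \<in> deriv (deriv V) ` cball 0 (e / 2). cmod y \<le> C"
    unfolding bounded_pos by blast
  then have C: "0 < C" "\<And>x. cmod x \<le> e / 2 \<Longrightarrow> cmod (deriv (deriv V) x) \<le> C" by simp_all
  have 1: "cmod (deriv V x - deriv V 0) \<le> C * cmod x" if x: "cmod x \<le> e / 2" for x
  proof -
    have "cmod (deriv V x - deriv V 0) \<le> C * cmod (x - 0)"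
    proof (rule field_differentiable_bound)
      fix z :: complex assume "z \<in> cball 0 (e / 2)"
      then show "(deriv V has_field_derivative deriv (deriv V) z) (at z within cball 0 (e / 2))"
        using e by (intro has_field_derivative_at_within[OF holomorphic_derivI[OF V' open_ball]]) auto
      show "cmod (deriv (deriv V) z) \<le> C" using C(2)[of z] \<open>z \<in> cball 0 (e / 2)\<close> by simp
    qed (use x e in auto)
    then show ?thesis by simp
  qed
  have 2: "cmod (V x - V 0 - deriv V 0 * x) \<le> C * (cmod x)\<^sup>2" if x: "cmod x \<le> e / 2" for x
  proof -
    define G where "G z = V z - deriv V 0 * z" for z
    have "cmod (G x - G 0) \<le> (C * cmod x) * cmod (x - 0)"
    proof (rule field_differentiable_bound)
      fix z :: complex assume z: "z \<in> cball 0 (cmod x)"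
      have "(V has_field_derivative deriv V z) (at z)"
        using z x e by (intro holomorphic_derivI[OF V open_ball]) auto
      then have "(G has_field_derivative deriv V z - deriv V 0) (at z)"
        unfolding G_def by (auto intro!: derivative_eq_intros)
      then show "(G has_field_derivative deriv V z - deriv V 0) (at z within cball 0 (cmod x))"
        by (rule has_field_derivative_at_within)
      have "cmod (deriv V z - deriv V 0) \<le> C * cmod z" using z x by (intro 1) auto
      also have "\<dots> \<le> C * cmod x" using z C by (intro mult_left_mono) auto
      finally show "cmod (deriv V z - deriv V 0) \<le> C * cmod x" .
    qed auto
    then show ?thesis by (simp add: G_def power2_eq_square algebra_simps)
  qed
  show thesis by (rule that[of C]) (use C 1 2 in auto)
qed

text \<open>Since \<open>g\<close> has no zeros on a disc it has a holomorphic cube root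
  \<open>j\<close>, and \<open>W = \<zeta> * j\<close> is a local coordinate with
  \<open>W ^ 3 = F\<close>. Its inverse satisfies \<open>V' = 1 / j\<close> at 0, whose cube is
  \<open>1 / g 0 = - 27 / 2\<close>.\<close>

lemma corner_inverse:
  obtains r W V e C where "0 < r" "r \<le> corner_rad" "0 < e" "0 \<le> C"
    "W holomorphic_on ball 0 r" "V holomorphic_on ball 0 e"
    "\<And>\<zeta>. \<zeta> \<in> ball 0 r \<Longrightarrow> (W \<zeta>) ^ 3 = corner_fun \<zeta>"
    "\<And>\<zeta>. \<zeta> \<in> ball 0 r \<Longrightarrow> V (W \<zeta>) = \<zeta>"
    "V 0 = 0" "(deriv V 0) ^ 3 = - (27 / 2)"
    "\<And>x. cmod x \<le> e / 2 \<Longrightarrow> cmod (deriv V x - deriv V 0) \<le> C * cmod x"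
    "\<And>x. cmod x \<le> e / 2 \<Longrightarrow> cmod (V x - deriv V 0 * x) \<le> C * (cmod x)\<^sup>2"
proof -
  obtain r g where r: "0 < r" "r \<le> corner_rad" and g: "g holomorphic_on ball 0 r" "g 0 = - (2 / 27)"
    and gF: "\<And>\<zeta>. \<zeta> \<in> ball 0 r \<Longrightarrow> corner_fun \<zeta> = \<zeta> ^ 3 * g \<zeta>" "\<And>\<zeta>. \<zeta> \<in> ball 0 r \<Longrightarrow> g \<zeta> \<noteq> 0"
    using corner_fun_factor by blast
  obtain l where l: "l holomorphic_on ball 0 r" "\<And>\<zeta>. \<zeta> \<in> ball 0 r \<Longrightarrow> g \<zeta> = exp (l \<zeta>)"
    using contractible_imp_holomorphic_log[OF g(1) convex_imp_contractible[OF convex_ball] gF(2)] by blast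
  define j where "j \<zeta> = exp (l \<zeta> / 3)" for \<zeta>
  have j3: "j \<zeta> ^ 3 = g \<zeta>" if "\<zeta> \<in> ball 0 r" for \<zeta>
    using l(2)[OF that] by (simp add: j_def flip: exp_of_nat_mult)
  have jh: "j holomorphic_on ball 0 r" unfolding j_def[abs_def] by (intro holomorphic_intros l) auto
  define W where "W \<zeta> = \<zeta> * j \<zeta>" for \<zeta>
  have Wh: "W holomorphic_on ball 0 r" unfolding W_def[abs_def] by (intro holomorphic_intros jh)
  have W3: "W \<zeta> ^ 3 = corner_fun \<zeta>" if "\<zeta> \<in> ball 0 r" for \<zeta>
    using that by (simp add: W_def power_mult_distrib j3 gF)
  have 0: "0 \<in> ball (0::complex) r" using r by simp
  have dj: "(j has_field_derivative deriv j 0) (at 0)" by (rule holomorphic_derivI[OF jh open_ball 0])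
  have "(W has_field_derivative j 0) (at 0)"
    unfolding W_def[abs_def] by (auto intro!: derivative_eq_intros dj)
  then have dW: "deriv W 0 = j 0" by (rule DERIV_imp_deriv)
  have j0: "j 0 \<noteq> 0" by (simp add: j_def)
  obtain r2 where r2: "0 < r2" "ball (0 :: complex) r2 \<subseteq> ball 0 r" "inj_on W (ball 0 r2)"
    using has_complex_derivative_locally_injective[OF Wh 0 open_ball] dW j0 by metis
  have Wh2: "W holomorphic_on ball 0 r2" using Wh r2(2) by (rule holomorphic_on_subset)
  obtain V where V: "V holomorphic_on (W ` ball 0 r2)" "\<And>z. z \<in> ball 0 r2 \<Longrightarrow> deriv W z * deriv V (W z) = 1"
    "\<And>z. z \<in> ball 0 r2 \<Longrightarrow> V (W z) = z"
    using holomorphic_has_inverse[OF Wh2 open_ball r2(3)] by metis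
  have W0: "W 0 = 0" by (simp add: W_def)
  have V0: "V 0 = 0" using V(3)[of 0] W0 r2 by simp
  have dV: "deriv V 0 = 1 / j 0" using V(2)[of 0] W0 r2 dW j0 by (simp add: field_simps)
  have "open (W ` ball 0 r2)" by (rule open_mapping_thm3[OF Wh2 open_ball r2(3)])
  moreover have "0 \<in> W ` ball 0 r2" using W0 r2 by (metis centre_in_ball imageI)
  ultimately obtain e where e: "0 < e" "ball 0 e \<subseteq> W ` ball 0 r2" by (meson open_contains_ball)
  have Vh: "V holomorphic_on ball 0 e" using V(1) e(2) by (rule holomorphic_on_subset)
  obtain C where C: "0 \<le> C"
    "\<And>x. cmod x \<le> e / 2 \<Longrightarrow> cmod (deriv V x - deriv V 0) \<le> C * cmod x"
    "\<And>x. cmod x \<le> e / 2 \<Longrightarrow> cmod (V x - V 0 - deriv V 0 * x) \<le> C * (cmod x)\<^sup>2"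
    using holomorphic_second_order[OF Vh e(1)] by metis
  have "(deriv V 0) ^ 3 = 1 / g 0" using j3[OF 0] by (simp add: dV power_divide)
  then have "(deriv V 0) ^ 3 = - (27 / 2)" by (simp add: g(2))
  moreover have "r2 \<le> corner_rad" using r2 r by (auto simp: ball_subset_ball_iff)
  ultimately show thesis
    using C V0 V(3) r2 e Vh Wh2 W3 by (intro that[of r2 e C W V]) auto
qed

lemma slit_strip_subsets:
  "Pi_strip A_strip \<subseteq> slit_strip"
  "r \<le> height - A_strip \<Longrightarrow> r \<le> A_strip \<Longrightarrow> slit_disc (\<i> * of_real A_strip) r (- 3 * pi / 2) \<subseteq> slit_strip"
  "r \<le> height - A_strip \<Longrightarrow> r \<le> A_strip \<Longrightarrow> slit_disc (- \<i> * of_real A_strip) r (- pi / 2) \<subseteq> slit_strip"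
proof -
  show "Pi_strip A_strip \<subseteq> slit_strip" using A_less_height by (auto simp: Pi_strip_def slit_strip_def)
  have up: "t \<in> slit_strip" if r: "r \<le> height - A_strip" "r \<le> A_strip"
    and t: "t \<in> slit_disc (\<i> * of_real A_strip) r (- 3 * pi / 2)" for t
  proof -
    have t': "cmod (t - \<i> * of_real A_strip) < r" "\<not> (Re t = 0 \<and> A_strip \<le> Im t)"
      using t unfolding slit_disc_upper i_times_nonpos_Reals_iff by auto
    have "\<bar>Im t - A_strip\<bar> < r" using abs_Im_le_cmod[of "t - \<i> * of_real A_strip"] t' by simp
    then show ?thesis using t'(2) r by (auto simp: slit_strip_def)
  qed
  show "slit_disc (\<i> * of_real A_strip) r (- 3 * pi / 2) \<subseteq> slit_strip" if "r \<le> height - A_strip" "r \<le> A_strip"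
    using up[OF that] by blast
  show "slit_disc (- \<i> * of_real A_strip) r (- pi / 2) \<subseteq> slit_strip" if "r \<le> height - A_strip" "r \<le> A_strip"
  proof
    fix t assume "t \<in> slit_disc (- \<i> * of_real A_strip) r (- pi / 2)"
    then have "cnj t \<in> slit_strip" using slit_disc_lower[of t "\<i> * of_real A_strip" r] up[OF that] by simp
    then show "t \<in> slit_strip" by (simp add: slit_strip_def)
  qed
qed

lemma sep_ext_corner_real:
  assumes "t \<in> quarter" "cmod (of_real pi - sep_inv t) < corner_rad"
  shows "corner_fun (of_real pi - sep_ext t) = (t - \<i> * of_real A_strip)\<^sup>2"
proof -
  have "Im (sep_inv t) \<le> 0" using sep_inv_in[OF assms(1)] by (auto simp: sep_dom_def half_strip_def)
  then show ?thesis
    by (simp add: corner_fun_def corner_sq_def sep_ext_quarter[OF assms(1)] sep_time_sep_inv[OF assms(1)])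
qed

text \<open>For \<open>0 \<le> Re t\<close> this is continuity of \<open>sep_inv\<close> at the
  corner. The left half follows through \<open>- cnj t\<close>: both \<open>pi - sep_ext t\<close>
  and \<open>(t - \<i> * A_strip)\<^sup>2\<close> are conjugated under this reflection.\<close>

lemma sep_ext_corner:
  assumes r: "0 < r" "r \<le> corner_rad"
  obtains \<nu> where "0 < \<nu>" "\<nu> \<le> A_strip" "\<nu> \<le> height - A_strip"
    "\<And>t. t \<in> slit_disc (\<i> * of_real A_strip) \<nu> (- 3 * pi / 2) \<Longrightarrow> cmod (of_real pi - sep_ext t) < r \<and>
       corner_fun (of_real pi - sep_ext t) = (t - \<i> * of_real A_strip)\<^sup>2"
proof -
  let ?p = "\<i> * complex_of_real A_strip"
  have pq: "?p \<in> quarter" using A_strip_pos A_less_height by (simp add: quarter_def)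
  have pi_in: "of_real pi \<in> half_strip" by (intro real_in_half_strip) auto
  have "sep_inv ?p = of_real pi" by (rule sep_inv_eqI[OF pi_in sep_time_pi pq])
  then obtain d where d: "0 < d" "\<And>t. t \<in> quarter \<Longrightarrow> dist t ?p < d \<Longrightarrow> dist (sep_inv t) (of_real pi) < r"
    using continuous_on_sep_inv pq r(1) unfolding continuous_on_iff by metis
  define \<nu> where "\<nu> = min d (min A_strip (height - A_strip))"
  have \<nu>: "0 < \<nu>" "\<nu> \<le> d" "\<nu> \<le> A_strip" "\<nu> \<le> height - A_strip"
    using d A_strip_pos A_less_height by (auto simp: \<nu>_def)
  have main: "cmod (of_real pi - sep_ext t) < r \<and> corner_fun (of_real pi - sep_ext t) = (t - ?p)\<^sup>2"
    if "0 \<le> Re t" "cmod (t - ?p) < \<nu>" for t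
  proof -
    have "\<bar>Im t - A_strip\<bar> < \<nu>" using abs_Im_le_cmod[of "t - ?p"] that by simp
    then have q: "t \<in> quarter" using that \<nu> by (auto simp: quarter_def)
    have "cmod (of_real pi - sep_inv t) < r"
      using d(2)[OF q] that \<nu> by (simp add: dist_norm norm_minus_commute)
    then show ?thesis using sep_ext_corner_real[OF q] sep_ext_quarter[OF q] r by simp
  qed
  have "cmod (of_real pi - sep_ext t) < r \<and> corner_fun (of_real pi - sep_ext t) = (t - ?p)\<^sup>2"
    if "t \<in> slit_disc ?p \<nu> (- 3 * pi / 2)" for t
  proof (cases "0 \<le> Re t")
    case True
    then show ?thesis using main[OF True] that unfolding slit_disc_upper by simp
  next
    case False
    have e: "- cnj t - ?p = - cnj (t - ?p)" by simp
    have t1: "cmod (t - ?p) < \<nu>" using that unfolding slit_disc_upper by simp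
    then have "cmod (- cnj t - ?p) < \<nu>" unfolding e by (simp only: norm_minus_cancel complex_mod_cnj)
    then have m: "cmod (of_real pi - sep_ext (- cnj t)) < r" "corner_fun (of_real pi - sep_ext (- cnj t)) = (- cnj t - ?p)\<^sup>2"
      using main[of "- cnj t"] False by auto
    have "t \<in> slit_strip" using that \<nu> slit_strip_subsets(2) by blast
    then have "sep_ext t = cnj (sep_ext (- cnj t))"
      using sep_ext_minus[of t] sep_ext_cnj[of "- cnj t"] by simp
    then have z: "of_real pi - sep_ext t = cnj (of_real pi - sep_ext (- cnj t))" by simp
    have "corner_fun (of_real pi - sep_ext t) = cnj (corner_fun (of_real pi - sep_ext (- cnj t)))"
      unfolding z using m(1) r by (intro corner_fun_cnj) simp
    also have "\<dots> = (t - ?p)\<^sup>2" unfolding m(2) e by (simp add: power2_eq_square algebra_simps)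
    finally show ?thesis using m(1) unfolding z complex_mod_cnj by simp
  qed
  then show thesis using \<nu> by (intro that[of \<nu>]) auto
qed

definition sep_mom :: "complex \<Rightarrow> complex" where "sep_mom t = - deriv sep_ext t / 3"

text \<open>With \<open>v\<close> the branch of the cube root of \<open>t - \<i> * A_strip\<close>,
  the cube of \<open>W (pi - sep_ext t)\<close> equals that of \<open>v\<^sup>2\<close>. So the two
  agree up to a cube root of unity, and inverting \<open>W\<close> expresses \<open>sep_ext\<close>
  as a holomorphic function of \<open>v\<^sup>2\<close>.\<close>

lemma corner_expansion:
  obtains \<nu> \<alpha> C where "0 < \<nu>" "\<nu> \<le> A_strip" "\<nu> \<le> height - A_strip" "\<alpha> ^ 3 = 1 / 2"
    "\<And>t. t \<in> slit_disc (\<i> * of_real A_strip) \<nu> (- 3 * pi / 2) \<Longrightarrow>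
       cmod (sep_ext t - pi - 3 * \<alpha> * br_pow (- 3 * pi / 2) (t - \<i> * of_real A_strip) (2/3))
            \<le> C * cmod (t - \<i> * of_real A_strip) powr (4/3) \<and>
       cmod (sep_mom t + (2 * \<alpha> / 3) / br_pow (- 3 * pi / 2) (t - \<i> * of_real A_strip) (1/3))
            \<le> C * cmod (t - \<i> * of_real A_strip) powr (1/3)"
proof -
  let ?p = "\<i> * complex_of_real A_strip"
  obtain r W V e C where r: "0 < r" "r \<le> corner_rad" and e: "0 < e" and C: "0 \<le> C"
    and Wh: "W holomorphic_on ball 0 r" and Vh: "V holomorphic_on ball 0 e"
    and W3: "\<And>\<zeta>. \<zeta> \<in> ball 0 r \<Longrightarrow> (W \<zeta>) ^ 3 = corner_fun \<zeta>"
    and VW: "\<And>\<zeta>. \<zeta> \<in> ball 0 r \<Longrightarrow> V (W \<zeta>) = \<zeta>"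
    and V0: "V 0 = 0" "(deriv V 0) ^ 3 = - (27 / 2)"
    and V1: "\<And>x. cmod x \<le> e / 2 \<Longrightarrow> cmod (deriv V x - deriv V 0) \<le> C * cmod x"
    and V2: "\<And>x. cmod x \<le> e / 2 \<Longrightarrow> cmod (V x - deriv V 0 * x) \<le> C * (cmod x)\<^sup>2"
    using corner_inverse by metis
  obtain \<nu>1 where \<nu>1: "0 < \<nu>1" "\<nu>1 \<le> A_strip" "\<nu>1 \<le> height - A_strip"
    "\<And>t. t \<in> slit_disc ?p \<nu>1 (- 3 * pi / 2) \<Longrightarrow> cmod (of_real pi - sep_ext t) < r \<and>
       corner_fun (of_real pi - sep_ext t) = (t - ?p)\<^sup>2"
    using sep_ext_corner[OF r] by metis
  \<comment> \<open>The power 3/2 ensures \<open>(cmod (v t))\<^sup>2 < e / 2\<close>, the range in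
    which the estimates for \<open>V\<close> hold.\<close>
  define \<nu> where "\<nu> = min \<nu>1 ((e / 2) powr (3 / 2))"
  have \<nu>: "0 < \<nu>" "\<nu> \<le> \<nu>1" "\<nu> \<le> (e / 2) powr (3 / 2)" using \<nu>1 e by (auto simp: \<nu>_def)
  define D where "D = slit_disc ?p \<nu> (- 3 * pi / 2)"
  have Dsub: "D \<subseteq> slit_disc ?p \<nu>1 (- 3 * pi / 2)" using \<nu>(2) by (auto simp: D_def slit_disc_def)
  have Dstrip: "D \<subseteq> slit_strip" using Dsub slit_strip_subsets(2)[OF \<nu>1(3,2)] by blast
  have Dopen: "open D" and Dconn: "connected D" unfolding D_def by (rule open_slit_disc_upper connected_slit_disc_upper)+
  define \<zeta> where "\<zeta> t = of_real pi - sep_ext t" for t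
  have \<zeta>: "\<zeta> t \<in> ball 0 r" "corner_fun (\<zeta> t) = (t - ?p)\<^sup>2" if "t \<in> D" for t
    using \<nu>1(4)[of t] that Dsub by (auto simp: \<zeta>_def)
  have nR: "\<i> * (t - ?p) \<notin> \<real>\<^sub>\<le>\<^sub>0" "cmod (t - ?p) < \<nu>" if "t \<in> D" for t
    using that unfolding D_def slit_disc_upper by auto
  have nz: "t \<noteq> ?p" if "t \<in> D" for t using nR(1)[OF that] by auto
  define v where "v t = exp (of_real (1/3) * (Ln (\<i> * (t - ?p)) - \<i> * of_real (pi / 2)))" for t
  have vb: "br_pow (- 3 * pi / 2) (t - ?p) (1/3) = v t" if "t \<in> D" for t
    using br_pow_upper[OF nR(1)[OF that]] by (simp only: v_def)
  have vb2: "br_pow (- 3 * pi / 2) (t - ?p) (2/3) = (v t)\<^sup>2" if "t \<in> D" for t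
  proof -
    have "(v t)\<^sup>2 = exp (of_real (2/3) * (Ln (\<i> * (t - ?p)) - \<i> * of_real (pi / 2)))"
      by (simp add: v_def flip: exp_of_nat_mult)
    then show ?thesis using br_pow_upper[OF nR(1)[OF that]] by (simp only:)
  qed
  have v3: "(v t) ^ 3 = t - ?p" if "t \<in> D" for t
  proof -
    have third: "of_nat 3 * (complex_of_real (1 / 3) * X) = X" for X by simp
    have "(v t) ^ 3 = exp (of_nat 3 * (of_real (1/3) * (Ln (\<i> * (t - ?p)) - \<i> * of_real (pi / 2))))"
      unfolding v_def by (rule exp_of_nat_mult[symmetric])
    also have "\<dots> = exp (Ln (\<i> * (t - ?p)) - \<i> * of_real (pi / 2))" by (simp only: third)
    also have "\<dots> = exp (Ln (\<i> * (t - ?p))) / exp (\<i> * of_real (pi / 2))" by (rule exp_diff)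
    also have "exp (\<i> * complex_of_real (pi / 2)) = \<i>" using cis_conv_exp[of "pi / 2"] by simp
    also have "exp (Ln (\<i> * (t - ?p))) = \<i> * (t - ?p)" using nz[OF that] by (intro exp_Ln) auto
    finally show ?thesis by simp
  qed
  have v0: "v t \<noteq> 0" for t by (simp add: v_def)
  have dv: "(v has_field_derivative v t / (3 * (t - ?p))) (at t)" if "t \<in> D" for t
  proof -
    have L: "((\<lambda>t. Ln (\<i> * (t - ?p))) has_field_derivative 1 / (t - ?p)) (at t)"
    proof -
      have "((\<lambda>t. Ln (\<i> * (t - ?p))) has_field_derivative inverse (\<i> * (t - ?p)) * \<i>) (at t)"
        by (rule DERIV_chain2[where f = Ln and g = "\<lambda>t. \<i> * (t - ?p)", OF has_field_derivative_Ln[OF nR(1)[OF that]]]) (auto intro!: derivative_eq_intros)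
      moreover have "inverse (\<i> * X) * \<i> = 1 / X" for X
        by (cases "X = 0") (auto simp: field_simps)
      ultimately show ?thesis by (simp only:)
    qed
    let ?g = "\<lambda>t. of_real (1/3) * (Ln (\<i> * (t - ?p)) - \<i> * of_real (pi / 2))"
    have "(?g has_field_derivative of_real (1/3) * (1 / (t - ?p) - 0)) (at t)"
      by (intro DERIV_cmult DERIV_diff L DERIV_const)
    from DERIV_chain2[where f = exp and g = ?g, OF DERIV_exp this]
    have "(v has_field_derivative v t * (of_real (1/3) * (1 / (t - ?p) - 0))) (at t)"
      unfolding v_def[abs_def] .
    moreover have "v t * (of_real (1/3) * (1 / (t - ?p) - 0)) = v t / (3 * (t - ?p))" by simp
    ultimately show ?thesis by (simp only:)
  qed
  have "v holomorphic_on D" using dv by (auto simp: holomorphic_on_open[OF Dopen])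
  then have cv: "continuous_on D v" by (rule holomorphic_on_imp_continuous_on)
  have \<zeta>c: "continuous_on D \<zeta>" unfolding \<zeta>_def[abs_def]
    by (intro continuous_intros continuous_on_subset[OF holomorphic_on_imp_continuous_on[OF holomorphic_sep_ext] Dstrip])
  \<comment> \<open>A continuous function with values among the three cube roots of unity;
    connectedness of the slit disc makes it a constant \<open>\<omega>\<close>.\<close>
  define f where "f t = W (\<zeta> t) / (v t)\<^sup>2" for t
  have f3: "(f t) ^ 3 = 1" if "t \<in> D" for t
  proof -
    have "(W (\<zeta> t)) ^ 3 = ((v t) ^ 3)\<^sup>2" by (simp only: W3[OF \<zeta>(1)[OF that]] \<zeta>(2)[OF that] v3[OF that])
    also have "\<dots> = ((v t)\<^sup>2) ^ 3" by (simp flip: power_mult)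
    finally show ?thesis using v0[of t] by (simp add: f_def power_divide)
  qed
  have "f constant_on D"
  proof (rule continuous_finite_range_constant[OF Dconn])
    have "continuous_on D (\<lambda>t. W (\<zeta> t))"
      by (rule continuous_on_compose2[OF holomorphic_on_imp_continuous_on[OF Wh] \<zeta>c]) (use \<zeta> in auto)
    then show "continuous_on D f" unfolding f_def using v0 by (intro continuous_intros cv) auto
    have "finite {z :: complex. z ^ 3 = 1}" by (rule finite_nth_roots) simp
    then show "finite (f ` D)" by (rule finite_subset[rotated]) (use f3 in auto)
  qed
  then obtain \<omega> where \<omega>: "\<And>t. t \<in> D \<Longrightarrow> f t = \<omega>" by (auto simp: constant_on_def)
  have "?p - \<i> * of_real (\<nu> / 2) \<in> D"
    using \<nu>(1) unfolding D_def slit_disc_upper by (simp add: norm_mult i_times_nonpos_Reals_iff)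
  then have \<omega>3: "\<omega> ^ 3 = 1" using f3 \<omega> by metis
  have \<omega>n: "cmod \<omega> = 1"
  proof -
    have "cmod \<omega> ^ 3 = 1 ^ 3" using \<omega>3 by (metis norm_one norm_power power_one)
    then show ?thesis by (rule power_eq_imp_eq_base) auto
  qed
  have \<zeta>V: "\<zeta> t = V (\<omega> * (v t)\<^sup>2)" if "t \<in> D" for t
  proof -
    have "W (\<zeta> t) = \<omega> * (v t)\<^sup>2" using \<omega>[OF that] v0[of t] by (simp add: f_def field_simps)
    then show ?thesis using VW[OF \<zeta>(1)[OF that]] by simp
  qed
  define b where "b = deriv V 0"
  \<comment> \<open>Read off from \<open>sep_ext t = pi - V (\<omega> * (v t)\<^sup>2)\<close>,
    whose linear part is \<open>pi - b * \<omega> * (v t)\<^sup>2\<close>. As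
    \<open>b ^ 3 = - 27 / 2\<close>, the cube of \<open>\<alpha>\<close> does not depend on
    \<open>\<omega>\<close>.\<close>
  define \<alpha> where "\<alpha> = - (\<omega> * b) / 3"
  have "\<alpha> ^ 3 = - (\<omega> ^ 3 * b ^ 3) / 27"
    by (simp add: \<alpha>_def power3_eq_cube)
  then have \<alpha>3: "\<alpha> ^ 3 = 1 / 2" by (simp add: \<omega>3 V0 b_def)
  have nv: "cmod (t - ?p) = cmod (v t) ^ 3" if "t \<in> D" for t
    using v3[OF that] by (metis norm_power)
  have pw: "(cmod (v t) ^ 3) powr (real n / 3) = cmod (v t) ^ n" for t n
  proof -
    have x: "0 < cmod (v t)" using v0[of t] by simp
    have "cmod (v t) ^ 3 = cmod (v t) powr real 3" by (rule powr_realpow[OF x, symmetric])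
    then have "(cmod (v t) ^ 3) powr (real n / 3) = cmod (v t) powr real n" by (simp only: powr_powr) simp
    then show ?thesis by (simp only: powr_realpow[OF x])
  qed
  have small: "cmod (\<omega> * (v t)\<^sup>2) < e / 2" "cmod (\<omega> * (v t)\<^sup>2) = (cmod (v t))\<^sup>2" if "t \<in> D" for t
  proof -
    show "cmod (\<omega> * (v t)\<^sup>2) = (cmod (v t))\<^sup>2" by (simp add: norm_mult norm_power \<omega>n)
    have "(cmod (v t))\<^sup>2 = (cmod (t - ?p)) powr (2/3)" using pw[of t 2] nv[OF that] by simp
    also have "\<dots> < ((e / 2) powr (3 / 2)) powr (2/3)"
      using nR(2)[OF that] \<nu>(3) by (intro powr_less_mono2) auto
    also have "\<dots> = e / 2" using e by (simp add: powr_powr)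
    finally show "cmod (\<omega> * (v t)\<^sup>2) < e / 2" by (simp add: norm_mult norm_power \<omega>n)
  qed
  have main: "cmod (sep_ext t - pi - 3 * \<alpha> * br_pow (- 3 * pi / 2) (t - ?p) (2/3)) \<le> C * cmod (t - ?p) powr (4/3) \<and>
       cmod (sep_mom t + (2 * \<alpha> / 3) / br_pow (- 3 * pi / 2) (t - ?p) (1/3)) \<le> C * cmod (t - ?p) powr (1/3)"
    if t: "t \<in> D" for t
  proof
    define x where "x = \<omega> * (v t)\<^sup>2"
    have x: "cmod x \<le> e / 2" "cmod x = (cmod (v t))\<^sup>2" using small[OF t] by (auto simp: x_def)
    have "sep_ext t - pi - 3 * \<alpha> * (v t)\<^sup>2 = - (V x - b * x)"
      using \<zeta>V[OF t] by (simp add: \<zeta>_def \<alpha>_def x_def algebra_simps)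
    then have "cmod (sep_ext t - pi - 3 * \<alpha> * (v t)\<^sup>2) = cmod (V x - b * x)" by (simp only: norm_minus_cancel)
    also have "\<dots> \<le> C * ((cmod (v t))\<^sup>2)\<^sup>2" using V2[OF x(1)] by (simp add: x(2) b_def)
    also have "((cmod (v t))\<^sup>2)\<^sup>2 = cmod (t - ?p) powr (4/3)" using pw[of t 4] nv[OF t] by (simp flip: power_mult)
    finally show "cmod (sep_ext t - pi - 3 * \<alpha> * br_pow (- 3 * pi / 2) (t - ?p) (2/3)) \<le> C * cmod (t - ?p) powr (4/3)"
      unfolding vb2[OF t] .
    have "((\<lambda>t. \<omega> * (v t)\<^sup>2) has_field_derivative \<omega> * (2 * v t * (v t / (3 * (t - ?p))))) (at t)"
      by (auto intro!: derivative_eq_intros dv[OF t])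
    also have "\<omega> * (2 * v t * (v t / (3 * (t - ?p)))) = 2 * \<omega> / (3 * v t)"
      unfolding v3[OF t, symmetric] using v0[of t] by (simp add: field_simps power2_eq_square power3_eq_cube)
    finally have dx: "((\<lambda>t. \<omega> * (v t)\<^sup>2) has_field_derivative 2 * \<omega> / (3 * v t)) (at t)" .
    have "(V has_field_derivative deriv V x) (at (\<omega> * (v t)\<^sup>2))"
      using x(1) e by (simp add: x_def[symmetric]) (intro holomorphic_derivI[OF Vh open_ball], auto)
    from DERIV_chain2[OF this dx]
    have "((\<lambda>t. of_real pi - V (\<omega> * (v t)\<^sup>2)) has_field_derivative 0 - deriv V x * (2 * \<omega> / (3 * v t))) (at t)"
      by (intro DERIV_diff DERIV_const)
    then have "(sep_ext has_field_derivative 0 - deriv V x * (2 * \<omega> / (3 * v t))) (at t)"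
      by (rule has_field_derivative_transform_within_open[OF _ Dopen t]) (simp add: \<zeta>V[symmetric] \<zeta>_def)
    then have "deriv sep_ext t = 0 - deriv V x * (2 * \<omega> / (3 * v t))" by (rule DERIV_imp_deriv)
    \<comment> \<open>The bracket is of order \<open>(v t)\<^sup>2\<close>, so dividing by
      \<open>v t\<close> leaves order \<open>v t\<close>, the power 1/3 of the distance to the
      corner.\<close>
    then have "sep_mom t + (2 * \<alpha> / 3) / v t = (2 * \<omega> / (9 * v t)) * (deriv V x - b)"
      using v0[of t] by (simp add: sep_mom_def \<alpha>_def field_simps)
    then have "cmod (sep_mom t + (2 * \<alpha> / 3) / v t) = 2 / (9 * cmod (v t)) * cmod (deriv V x - b)"
      by (simp add: norm_mult norm_divide \<omega>n)
    also have "\<dots> \<le> 2 / (9 * cmod (v t)) * (C * (cmod (v t))\<^sup>2)"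
      using V1[OF x(1)] by (intro mult_left_mono) (auto simp: x(2) b_def)
    also have "\<dots> = (2 / 9) * (C * cmod (v t))" using v0[of t] by (simp add: power2_eq_square)
    also have "\<dots> \<le> 1 * (C * cmod (v t))" using C by (intro mult_right_mono) auto
    also have "\<dots> = C * cmod (t - ?p) powr (1/3)" using pw[of t 1] nv[OF t] by simp
    finally show "cmod (sep_mom t + (2 * \<alpha> / 3) / br_pow (- 3 * pi / 2) (t - ?p) (1/3)) \<le> C * cmod (t - ?p) powr (1/3)"
      unfolding vb[OF t] .
  qed
  show thesis
    by (rule that[of \<nu> \<alpha> C]) (use \<nu> \<nu>1 \<alpha>3 main[unfolded D_def] in auto)
qed

section \<open>The momentum: symmetry and singularity at the corners\<close>

lemma sep_mom_cnj: "t \<in> slit_strip \<Longrightarrow> sep_mom (cnj t) = cnj (sep_mom t)"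
proof -
  assume t: "t \<in> slit_strip"
  have "(sep_ext has_field_derivative deriv sep_ext t) (at (cnj (cnj t)))"
    using holomorphic_derivI[OF holomorphic_sep_ext open_slit_strip t] by simp
  then have "((cnj \<circ> sep_ext \<circ> cnj) has_field_derivative cnj (deriv sep_ext t)) (at (cnj t))"
    by (rule has_field_derivative_cnj_cnj)
  moreover have "cnj \<circ> sep_ext \<circ> cnj = sep_ext" by (rule ext) (simp add: sep_ext_cnj)
  ultimately have "deriv sep_ext (cnj t) = cnj (deriv sep_ext t)" by (simp add: DERIV_imp_deriv)
  then show ?thesis by (simp add: sep_mom_def)
qed

lemma holomorphic_sep_mom: "sep_mom holomorphic_on slit_strip"
  unfolding sep_mom_def[abs_def]
  by (intro holomorphic_intros holomorphic_deriv holomorphic_sep_ext open_slit_strip) auto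

text \<open>If the momentum extended to the corner it would be bounded there.\<close>

lemma not_extends_corner:
  fixes F :: "complex \<Rightarrow> complex"
  assumes d: "cmod d = 1" and a: "a \<noteq> 0" and \<nu>: "0 < \<nu>"
    and S: "\<And>s. 0 < s \<Longrightarrow> s < \<nu> \<Longrightarrow> p + of_real s * d \<in> S"
    and B: "\<And>s. 0 < s \<Longrightarrow> s < \<nu> \<Longrightarrow> \<exists>b. cmod b = s powr (1/3) \<and> cmod (F (p + of_real s * d) + a / b) \<le> C * s powr (1/3)"
  shows "\<not> extends_holo_at F S p"
proof
  assume "extends_holo_at F S p"
  then obtain e g where e: "0 < e" and g: "g holomorphic_on ball p e" "\<And>w. w \<in> ball p e \<inter> S \<Longrightarrow> g w = F w"
    by (auto simp: extends_holo_at_def)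
  have "isCont g p" using holomorphic_on_imp_continuous_on[OF g(1)] e by (simp add: continuous_on_eq_continuous_at)
  moreover have "((\<lambda>s. p + of_real s * d) \<longlongrightarrow> p + of_real 0 * d) (at_right 0)" by (intro tendsto_intros)
  ultimately have "((\<lambda>s. g (p + of_real s * d)) \<longlongrightarrow> g p) (at_right 0)"
    by (intro isCont_tendsto_compose[of p g]) auto
  \<comment> \<open>Multiplying the expansion by \<open>s powr (1/3)\<close> gives an upper bound
    for \<open>cmod a\<close> that tends to 0 if \<open>F\<close> has a continuous extension
    \<open>g\<close> to the corner.\<close>
  then have "((\<lambda>s. s powr (1/3) * cmod (g (p + of_real s * d)) + C * s powr (1/3) * s powr (1/3)) \<longlongrightarrow>
     0 powr (1/3) * cmod (g p) + C * 0 powr (1/3) * 0 powr (1/3)) (at_right 0)"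
    by (intro tendsto_intros tendsto_powr2) (auto simp: eventually_at_filter)
  moreover have "\<forall>\<^sub>F s in at_right 0. cmod a \<le> s powr (1/3) * cmod (g (p + of_real s * d)) + C * s powr (1/3) * s powr (1/3)"
    unfolding eventually_at_right_field
  proof (intro exI[of _ "min \<nu> e"] conjI allI impI)
    fix s :: real assume s: "0 < s" "s < min \<nu> e"
    have "p + of_real s * d \<in> ball p e" using s d by (simp add: dist_norm norm_mult)
    then have ge: "g (p + of_real s * d) = F (p + of_real s * d)" using g(2) S s by auto
    obtain b where b: "cmod b = s powr (1/3)" "cmod (F (p + of_real s * d) + a / b) \<le> C * s powr (1/3)"
      using B s by auto
    have "cmod (a / b) \<le> cmod (F (p + of_real s * d)) + cmod (F (p + of_real s * d) + a / b)"
      using norm_triangle_ineq4[of "F (p + of_real s * d) + a / b" "F (p + of_real s * d)"] by simp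
    then have "cmod a / s powr (1/3) \<le> cmod (F (p + of_real s * d)) + C * s powr (1/3)"
      using b by (simp add: norm_divide)
    then show "cmod a \<le> s powr (1/3) * cmod (g (p + of_real s * d)) + C * s powr (1/3) * s powr (1/3)"
      unfolding ge using s by (simp add: field_simps)
  qed (use \<nu> e in auto)
  ultimately have "cmod a \<le> 0 powr (1/3) * cmod (g p) + C * 0 powr (1/3) * 0 powr (1/3)"
    by (intro tendsto_lowerbound) auto
  then show False using a by simp
qed

lemma norm_br_pow: "w \<noteq> 0 \<Longrightarrow> cmod (br_pow a w p) = cmod w powr p"
  by (simp add: br_pow_def powr_def)

theorem theorem2p2:
  fixes lam Lam :: "real \<Rightarrow> real" and l0 :: real
  assumes ode_lam: "\<And>t. (lam has_real_derivative (- 3 * Lam t)) (at t)"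
    and ode_Lam: "\<And>t. (Lam has_real_derivative
          (- sin (lam t) * (1 - (2 + 2 * cos (lam t)) powr (- 3 / 2)))) (at t)"
    and init: "lam 0 = l0" "Lam 0 = 0"
    and l0_range: "2/3 * pi < l0" "l0 < pi"
    and energy: "H_pend l0 0 = - 1/2"
    and right_sep: "\<And>t. 0 < lam t \<and> lam t < pi"
    and to_saddle_top: "((\<lambda>t. (lam t, Lam t)) \<longlongrightarrow> (0, 0)) at_top"
    and to_saddle_bot: "((\<lambda>t. (lam t, Lam t)) \<longlongrightarrow> (0, 0)) at_bot"
  shows "\<exists>\<nu>>0. \<exists>\<alpha>::complex. \<alpha> ^ 3 = 1/2 \<and>
    (\<exists>lamC LamC :: complex \<Rightarrow> complex.
      \<comment> \<open>(i) analytic extension to the strip (and to the slit discs of (iii))\<close>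
      lamC holomorphic_on
        (Pi_strip A_strip \<union> slit_disc (\<i> * A_strip) \<nu> (- 3 * pi / 2)
                           \<union> slit_disc (- \<i> * A_strip) \<nu> (- pi / 2)) \<and>
      LamC holomorphic_on
        (Pi_strip A_strip \<union> slit_disc (\<i> * A_strip) \<nu> (- 3 * pi / 2)
                           \<union> slit_disc (- \<i> * A_strip) \<nu> (- pi / 2)) \<and>
      (\<forall>x::real. lamC (complex_of_real x) = complex_of_real (lam x)
                \<and> LamC (complex_of_real x) = complex_of_real (Lam x)) \<and>
      \<comment> \<open>(ii) the only boundary singularities are at \<pm> iA\<close>
      (\<forall>z. \<bar>Im z\<bar> = A_strip \<longrightarrow> z \<noteq> \<i> * A_strip \<longrightarrow> z \<noteq> - \<i> * A_strip \<longrightarrow>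
          extends_holo_at lamC (Pi_strip A_strip) z \<and> extends_holo_at LamC (Pi_strip A_strip) z) \<and>
      \<not> (extends_holo_at lamC (Pi_strip A_strip) (\<i> * A_strip)
           \<and> extends_holo_at LamC (Pi_strip A_strip) (\<i> * A_strip)) \<and>
      \<not> (extends_holo_at lamC (Pi_strip A_strip) (- \<i> * A_strip)
           \<and> extends_holo_at LamC (Pi_strip A_strip) (- \<i> * A_strip)) \<and>
      \<comment> \<open>(iii) local expansions near \<pm> iA\<close>
      (\<exists>C. \<forall>t \<in> slit_disc (\<i> * A_strip) \<nu> (- 3 * pi / 2).
          cmod (lamC t - pi - 3 * \<alpha> * br_pow (- 3 * pi / 2) (t - \<i> * A_strip) (2/3))
            \<le> C * cmod (t - \<i> * A_strip) powr (4/3) \<and>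
          cmod (LamC t + (2 * \<alpha> / 3) / br_pow (- 3 * pi / 2) (t - \<i> * A_strip) (1/3))
            \<le> C * cmod (t - \<i> * A_strip) powr (1/3)) \<and>
      (\<exists>C. \<forall>t \<in> slit_disc (- \<i> * A_strip) \<nu> (- pi / 2).
          cmod (lamC t - pi - 3 * cnj \<alpha> * br_pow (- pi / 2) (t + \<i> * A_strip) (2/3))
            \<le> C * cmod (t + \<i> * A_strip) powr (4/3) \<and>
          cmod (LamC t + (2 * cnj \<alpha> / 3) / br_pow (- pi / 2) (t + \<i> * A_strip) (1/3))
            \<le> C * cmod (t + \<i> * A_strip) powr (1/3)))"
proof -
  let ?p = "\<i> * complex_of_real A_strip"
  obtain \<nu> \<alpha> C where \<nu>: "0 < \<nu>" "\<nu> \<le> A_strip" "\<nu> \<le> height - A_strip" and \<alpha>: "\<alpha> ^ 3 = 1 / 2"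
    and up: "\<And>t. t \<in> slit_disc ?p \<nu> (- 3 * pi / 2) \<Longrightarrow>
       cmod (sep_ext t - pi - 3 * \<alpha> * br_pow (- 3 * pi / 2) (t - ?p) (2/3)) \<le> C * cmod (t - ?p) powr (4/3) \<and>
       cmod (sep_mom t + (2 * \<alpha> / 3) / br_pow (- 3 * pi / 2) (t - ?p) (1/3)) \<le> C * cmod (t - ?p) powr (1/3)"
    using corner_expansion by metis
  \<comment> \<open>Both quantities are conjugates of those at \<open>cnj t\<close> near the upper
    corner, because the two argument windows are conjugate; this is where
    \<open>cnj \<alpha>\<close> comes from.\<close>
  have low: "cmod (sep_ext t - pi - 3 * cnj \<alpha> * br_pow (- pi / 2) (t + ?p) (2/3)) \<le> C * cmod (t + ?p) powr (4/3) \<and>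
       cmod (sep_mom t + (2 * cnj \<alpha> / 3) / br_pow (- pi / 2) (t + ?p) (1/3)) \<le> C * cmod (t + ?p) powr (1/3)"
    if t: "t \<in> slit_disc (- \<i> * of_real A_strip) \<nu> (- pi / 2)" for t
  proof -
    define s where "s = cnj t"
    have s: "s \<in> slit_disc ?p \<nu> (- 3 * pi / 2)" using slit_disc_lower[of t ?p \<nu>] t by (simp add: s_def)
    have nR: "\<i> * (s - ?p) \<notin> \<real>\<^sub>\<le>\<^sub>0" using s unfolding slit_disc_upper by simp
    have ss: "s \<in> slit_strip" using s slit_strip_subsets(2)[OF \<nu>(3,2)] by blast
    have tp: "t + ?p = cnj (s - ?p)" by (simp add: s_def)
    have ts: "t = cnj s" by (simp add: s_def)
    have 1: "sep_ext t - pi - 3 * cnj \<alpha> * br_pow (- pi / 2) (t + ?p) (2/3)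
        = cnj (sep_ext s - pi - 3 * \<alpha> * br_pow (- 3 * pi / 2) (s - ?p) (2/3))"
      unfolding tp br_pow_cnj[OF nR] unfolding ts sep_ext_cnj by simp
    have 2: "sep_mom t + (2 * cnj \<alpha> / 3) / br_pow (- pi / 2) (t + ?p) (1/3)
        = cnj (sep_mom s + (2 * \<alpha> / 3) / br_pow (- 3 * pi / 2) (s - ?p) (1/3))"
      unfolding tp br_pow_cnj[OF nR] unfolding ts sep_mom_cnj[OF ss] by simp
    show ?thesis unfolding 1 2 unfolding tp complex_mod_cnj using up[OF s] .
  qed
  define U where "U = Pi_strip A_strip \<union> slit_disc ?p \<nu> (- 3 * pi / 2) \<union> slit_disc (- \<i> * of_real A_strip) \<nu> (- pi / 2)"
  have U: "U \<subseteq> slit_strip" unfolding U_def using slit_strip_subsets \<nu> by blast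
  have H0: "H_pend (lam 0) (Lam 0) = - 1 / 2" using energy init by simp
  have real: "sep_ext (of_real x) = of_real (lam x)" for x
    by (rule sep_ext_separatrix[of lam Lam, OF ode_lam ode_Lam right_sep init(2) H0])
  \<comment> \<open>\<open>sep_ext\<close> restricted to the real line is \<open>lam\<close>, so its
    complex derivative there is \<open>- 3 * Lam x\<close>.\<close>
  have realm: "sep_mom (of_real x) = of_real (Lam x)" for x
  proof -
    have "(sep_ext has_field_derivative deriv sep_ext (of_real x)) (at (of_real x))"
      by (rule holomorphic_derivI[OF holomorphic_sep_ext open_slit_strip of_real_in_slit_strip])
    then have "((\<lambda>x. sep_ext (of_real x)) has_vector_derivative deriv sep_ext (of_real x)) (at x)"
      by (rule has_vector_derivative_real_field)
    moreover have "((\<lambda>x. sep_ext (of_real x)) has_vector_derivative of_real (- 3 * Lam x)) (at x)"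
      unfolding real by (rule has_vector_derivative_of_real[OF ode_lam])
    ultimately have "deriv sep_ext (of_real x) = of_real (- 3 * Lam x)" by (rule vector_derivative_unique_at)
    then show ?thesis by (simp add: sep_mom_def)
  qed
  \<comment> \<open>Such a \<open>z\<close> has nonzero real part, and
    \<open>A_strip < height\<close> then places it in the open set \<open>slit_strip\<close>, where
    \<open>F\<close> itself is the extension.\<close>
  have ext: "extends_holo_at F (Pi_strip A_strip) z"
    if F: "F holomorphic_on slit_strip" and z: "\<bar>Im z\<bar> = A_strip" "z \<noteq> ?p" "z \<noteq> - \<i> * of_real A_strip" for F z
  proof -
    have "Re z \<noteq> 0" using z by (auto simp: complex_eq_iff abs_if split: if_splits)
    then have "z \<in> slit_strip" using z A_less_height by (simp add: slit_strip_def)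
    then obtain e where "0 < e" "ball z e \<subseteq> slit_strip" using open_slit_strip open_contains_ball by blast
    then show ?thesis unfolding extends_holo_at_def using F holomorphic_on_subset by blast
  qed
  have \<alpha>0: "2 * \<alpha> / 3 \<noteq> 0" "2 * cnj \<alpha> / 3 \<noteq> 0" using \<alpha> by auto
  \<comment> \<open>The corner is approached from straight below, along a segment that lies in both
    the strip and the slit disc. The momentum witnesses the singularity, since it blows up
    there.\<close>
  have no_up: "\<not> extends_holo_at sep_mom (Pi_strip A_strip) ?p"
  proof (rule not_extends_corner[of "- \<i>" "2 * \<alpha> / 3" \<nu> _ _ _ C])
    fix s :: real assume s: "0 < s" "s < \<nu>"
    show "?p + of_real s * - \<i> \<in> Pi_strip A_strip" using s \<nu> by (simp add: Pi_strip_def)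
    have sd: "?p + of_real s * - \<i> \<in> slit_disc ?p \<nu> (- 3 * pi / 2)"
      using s unfolding slit_disc_upper by (simp add: norm_mult i_times_nonpos_Reals_iff)
    have w: "?p + of_real s * - \<i> - ?p = - \<i> * of_real s" by simp
    have "cmod (br_pow (- 3 * pi / 2) (- \<i> * of_real s) (1/3)) = s powr (1/3)"
      using s by (subst norm_br_pow) (auto simp: norm_mult)
    moreover have "cmod (- \<i> * complex_of_real s) = s" using s by (simp add: norm_mult)
    ultimately show "\<exists>b. cmod b = s powr (1/3) \<and> cmod (sep_mom (?p + of_real s * - \<i>) + 2 * \<alpha> / 3 / b) \<le> C * s powr (1/3)"
      using conjunct2[OF up[OF sd]] unfolding w by auto
  qed (use \<nu> \<alpha>0 in auto)
  have no_low: "\<not> extends_holo_at sep_mom (Pi_strip A_strip) (- \<i> * of_real A_strip)"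
  proof (rule not_extends_corner[of "\<i>" "2 * cnj \<alpha> / 3" \<nu> _ _ _ C])
    fix s :: real assume s: "0 < s" "s < \<nu>"
    let ?t = "- \<i> * of_real A_strip + of_real s * \<i>"
    show "?t \<in> Pi_strip A_strip" using s \<nu> by (simp add: Pi_strip_def)
    have "cnj ?t \<in> slit_disc ?p \<nu> (- 3 * pi / 2)"
      using s unfolding slit_disc_upper by (simp add: norm_mult i_times_nonpos_Reals_iff)
    from slit_disc_upper_lower[OF this]
    have sd: "?t \<in> slit_disc (- \<i> * of_real A_strip) \<nu> (- pi / 2)" by simp
    have w: "?t + ?p = \<i> * of_real s" by simp
    have "cmod (br_pow (- pi / 2) (\<i> * of_real s) (1/3)) = s powr (1/3)"
      using s by (subst norm_br_pow) (auto simp: norm_mult)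
    moreover have "cmod (\<i> * complex_of_real s) = s" using s by (simp add: norm_mult)
    ultimately show "\<exists>b. cmod b = s powr (1/3) \<and> cmod (sep_mom ?t + 2 * cnj \<alpha> / 3 / b) \<le> C * s powr (1/3)"
      using conjunct2[OF low[OF sd]] unfolding w by auto
  qed (use \<nu> \<alpha>0 in auto)
  show ?thesis
  proof (rule exI[of _ \<nu>], rule conjI[OF \<nu>(1)], rule exI[of _ \<alpha>], rule conjI[OF \<alpha>],
      rule exI[of _ sep_ext], rule exI[of _ sep_mom], intro conjI)
    show "sep_ext holomorphic_on (Pi_strip A_strip \<union> slit_disc ?p \<nu> (- 3 * pi / 2)
        \<union> slit_disc (- \<i> * of_real A_strip) \<nu> (- pi / 2))"
      using holomorphic_on_subset[OF holomorphic_sep_ext U] by (simp only: U_def)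
    show "sep_mom holomorphic_on (Pi_strip A_strip \<union> slit_disc ?p \<nu> (- 3 * pi / 2)
        \<union> slit_disc (- \<i> * of_real A_strip) \<nu> (- pi / 2))"
      using holomorphic_on_subset[OF holomorphic_sep_mom U] by (simp only: U_def)
    show "\<exists>C. \<forall>t \<in> slit_disc ?p \<nu> (- 3 * pi / 2).
          cmod (sep_ext t - pi - 3 * \<alpha> * br_pow (- 3 * pi / 2) (t - ?p) (2/3)) \<le> C * cmod (t - ?p) powr (4/3) \<and>
          cmod (sep_mom t + (2 * \<alpha> / 3) / br_pow (- 3 * pi / 2) (t - ?p) (1/3)) \<le> C * cmod (t - ?p) powr (1/3)"
      using up by blast
    show "\<exists>C. \<forall>t \<in> slit_disc (- \<i> * of_real A_strip) \<nu> (- pi / 2).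
          cmod (sep_ext t - pi - 3 * cnj \<alpha> * br_pow (- pi / 2) (t + ?p) (2/3)) \<le> C * cmod (t + ?p) powr (4/3) \<and>
          cmod (sep_mom t + (2 * cnj \<alpha> / 3) / br_pow (- pi / 2) (t + ?p) (1/3)) \<le> C * cmod (t + ?p) powr (1/3)"
      using low by blast
  qed (use \<nu> \<alpha> real realm no_up no_low ext[OF holomorphic_sep_ext] ext[OF holomorphic_sep_mom] in auto)
qed

end
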